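(* Let $G$ be a non-cyclic finite abelian group. Then: \begin{enumerate} \item If $G$ has rank $2$ (i.e. $G\cong C_{n_1}\oplus C_{n_2}$ with $1<n_1\mid n_2$), then $C_0(G)=[D(G)+1,\eta(G)-1]$. \item If $G=C_{p^nm}\oplus H$ with $p$ a prime, $n,m$ positive integers, and $H$ a finite abelian $p$-group with $p^n\geq D(H)$, then $C_0(G)=[D(G)+1,\eta(G)-1]$. \item $C_0(C_3^4)=\{\eta(C_3^4)-2,\eta(C_3^4)-1\}=\{37,38\}$. \item For every integer $r\geq 3$, $C_0(C_2^r)=\{\eta(C_2^r)-3,\eta(C_2^r)-2\}$. \end{enumerate}
   Context: All groups are finite abelian, written additively; $C_n$ is the cyclic group of order $n$, $C_n^r$ the direct sum of $r$ copies of $C_n$, and $[a,b]=\{x\in\mathbb Z: a\le x\le b\}$. A sequence over $G$ is a finite unordered list of elements of $G$ with repetition allowed; length $|S|$ counts terms with multiplicity, $\sigma(S)$ is the sum of the terms, subsequences are sub-multisets. $S$ is zero-sum if $\sigma(S)=0$; a short zero-sum sequence is a zero-sum sequence with $1\leq |S|\leq \exp(G)$. $D(G)$ is the smallest $d$ such that every sequence over $G$ of length $\geq d$ has a nonempty zero-sum subsequence; $\eta(G)$ is the smallest $d$ such that every sequence over $G$ of length $\geq d$ has a short zero-sum subsequence. $C_0(G)$ is the set of integers $t\in[D(G)+1,\eta(G)-1]$ such that every zero-sum sequence over $G$ of length exactly $t$ contains a short zero-sum subsequence. *)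

theory Defs
  imports "HOL-Algebra.FiniteProduct" "HOL-Algebra.Product_Groups"
    "HOL-Computational_Algebra.Primes" "HOL-Library.Multiset"
begin

text \<open>Groups are HOL-Algebra groups and hence written multiplicatively. A sequence over \<open>G\<close> is a
  finite multiset of elements of the carrier, and a subsequence is a sub-multiset.\<close>

definition seq_over :: "('a, 'm) monoid_scheme \<Rightarrow> 'a multiset \<Rightarrow> bool" where
  "seq_over G S \<longleftrightarrow> set_mset S \<subseteq> carrier G"

text \<open>The sum \<open>\<sigma>(S)\<close>: each distinct term \<open>g\<close> of \<open>S\<close> contributes its multiple by the multiplicity
  of \<open>g\<close> in \<open>S\<close>.\<close>

definition seq_sum :: "('a, 'm) monoid_scheme \<Rightarrow> 'a multiset \<Rightarrow> 'a" where
  "seq_sum G S = (\<Otimes>\<^bsub>G\<^esub>g\<in>set_mset S. g [^]\<^bsub>G\<^esub> count S g)"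

definition zero_sum :: "('a, 'm) monoid_scheme \<Rightarrow> 'a multiset \<Rightarrow> bool" where
  "zero_sum G S \<longleftrightarrow> seq_sum G S = \<one>\<^bsub>G\<^esub>"

definition group_exp :: "('a, 'm) monoid_scheme \<Rightarrow> nat" where
  "group_exp G = (LEAST n. 0 < n \<and> (\<forall>x\<in>carrier G. x [^]\<^bsub>G\<^esub> n = \<one>\<^bsub>G\<^esub>))"

definition short_zero_sum :: "('a, 'm) monoid_scheme \<Rightarrow> 'a multiset \<Rightarrow> bool" where
  "short_zero_sum G S \<longleftrightarrow> zero_sum G S \<and> 1 \<le> size S \<and> size S \<le> group_exp G"

definition davenport :: "('a, 'm) monoid_scheme \<Rightarrow> nat" where
  "davenport G = (LEAST d. \<forall>S. seq_over G S \<and> d \<le> size S \<longrightarrow>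
     (\<exists>T. T \<subseteq># S \<and> T \<noteq> {#} \<and> zero_sum G T))"

definition eta :: "('a, 'm) monoid_scheme \<Rightarrow> nat" where
  "eta G = (LEAST d. \<forall>S. seq_over G S \<and> d \<le> size S \<longrightarrow>
     (\<exists>T. T \<subseteq># S \<and> short_zero_sum G T))"

text \<open>A set of integers, so that \<open>eta G - 1\<close> and similar bounds do not truncate.\<close>

definition C0 :: "('a, 'm) monoid_scheme \<Rightarrow> int set" where
  "C0 G = {t \<in> {int (davenport G) + 1..int (eta G) - 1}.
     \<forall>S. seq_over G S \<and> zero_sum G S \<and> int (size S) = t \<longrightarrow>
       (\<exists>T. T \<subseteq># S \<and> short_zero_sum G T)}"

definition cyclic_power :: "nat \<Rightarrow> nat \<Rightarrow> (nat \<Rightarrow> int) monoid" where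
  "cyclic_power n r = product_group {..<r} (\<lambda>_. integer_mod_group n)"

definition finite_p_group :: "nat \<Rightarrow> ('a, 'm) monoid_scheme \<Rightarrow> bool" where
  "finite_p_group p H \<longleftrightarrow> group H \<and> finite (carrier H) \<and> (\<exists>k. order H = p ^ k)"

end

(* Parts 1 and 2: a zero-sum sequence longer than the Davenport constant splits into two zero-sum
   parts, one of which is short unless the length exceeds 2 exp(G) + 1. In that case map G onto
   C_e + H with cyclic kernel of order m, where exp(G) = m e. If every zero-sum sequence over the image
   of length at least 2 e + 1 has a zero-sum subsequence of length at most e, one extracts m such
   blocks, and their sums in the kernel, taken over consecutive blocks, hit zero by pigeonhole. That
   property of the image follows for p-groups from Olson's theorem (nilpotency of the augmentation
   ideal) by padding with zeros, and for C_n + C_n by induction over the primes of n, in a version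
   where one term may count with length two.
   Part 3: sequences over C_3^4 without short zero-sum subsequences live on a cap containing 0. Level
   sizes of the linear functionals on a cap have determined moments; linear programming certificates
   against them show that caps have at most 20 points and that no point x of a 20-point cap C has
   sum(C) + x = 0.
   Part 4: over C_2^r these sequences are the sets of distinct nonzero elements. *)
theory Submission
  imports Defs "HOL-Algebra.Multiplicative_Group" "HOL-Library.Numeral_Type" "HOL-Library.Product_Plus"
begin

section \<open>Sums of sequences\<close>

text \<open>The zero-sum hypothesis enters twice. Removing a block from a sequence with zero-sum
  image leaves a zero-sum image, so extraction can go on down to 2 e + 1 terms; since (m + 1) e
  \<le> 2 m e, a length above 2 exp(G) + 1 lasts for m blocks. Moreover, a zero-sum subsequence that
  is too long can be exchanged for its complement. Weight two in the rank two induction is what the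
  leftover costs: modulo p the blocks have weight at most p, while the remainder is only known to
  have weight at most 2 p. In the p-group case the nilpotency index has to be bounded by D(H)
  itself: only then is D(H) + 2 q - 2 below 3 q, with q the order of the cyclic factor, so that a
  length divisible by q is q or 2 q. The certificates do not exclude caps of 21 points by
  themselves. If the sum of the points is nonzero, the result on 20-point caps shows that it is not
  a difference of two points, which fixes one more moment; if the sum is 0, the certificate is
  exactly tight and parity decides.\<close>

context comm_group
begin

lemma seq_sum_empty [simp]: "seq_sum G {#} = \<one>"
  by (simp add: seq_sum_def)

lemma seq_sum_add_mset:
  assumes "seq_over G S" "x \<in> carrier G"
  shows "seq_sum G (add_mset x S) = x \<otimes> seq_sum G S"
proof -
  \<comment> \<open>Splitting off \<open>x\<close> even if it does not occur in \<open>S\<close>, as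
    a power with exponent 0, makes both cases look alike.\<close>
  define F where "F = set_mset S - {x}"
  have F: "finite F" "x \<notin> F" "F \<subseteq> carrier G"
    using assms by (auto simp: F_def seq_over_def)
  have cl: "(\<lambda>g. g [^] count S g) \<in> F \<rightarrow> carrier G"
    using F by auto
  have S: "seq_sum G S = x [^] count S x \<otimes> (\<Otimes>g\<in>F. g [^] count S g)"
  proof (cases "x \<in># S")
    case True
    then have "set_mset S = insert x F" by (auto simp: F_def)
    then show ?thesis
      unfolding seq_sum_def using F cl assms(2) by (simp add: finprod_insert)
  next
    case False
    then have "set_mset S = F" "count S x = 0" by (auto simp: F_def not_in_iff)
    then show ?thesis
      unfolding seq_sum_def using cl by (simp add: finprod_closed)
  qed
  have ins: "set_mset (add_mset x S) = insert x F" by (auto simp: F_def)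
  have "seq_sum G (add_mset x S)
      = x [^] Suc (count S x) \<otimes> (\<Otimes>g\<in>F. g [^] count (add_mset x S) g)"
    unfolding seq_sum_def ins using F assms(2)
    by (subst finprod_insert) (auto simp del: nat_pow_Suc)
  also have "(\<Otimes>g\<in>F. g [^] count (add_mset x S) g) = (\<Otimes>g\<in>F. g [^] count S g)"
    using F cl by (intro finprod_cong') auto
  finally show ?thesis
    using assms(2) cl S
    by (simp add: m_ac finprod_closed)
qed

lemma seq_sum_closed: "seq_over G S \<Longrightarrow> seq_sum G S \<in> carrier G"
  by (induction S) (auto simp: seq_sum_add_mset seq_over_def)

lemma seq_sum_union:
  "seq_over G S \<Longrightarrow> seq_over G T \<Longrightarrow> seq_sum G (S + T) = seq_sum G S \<otimes> seq_sum G T"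
  by (induction S) (auto simp: seq_sum_add_mset seq_over_def seq_sum_closed m_assoc)

lemma seq_sum_diff_zero_sum:
  assumes "seq_over G S" "T \<subseteq># S" "zero_sum G S" "zero_sum G T"
  shows "zero_sum G (S - T)"
proof -
  have o: "seq_over G T" "seq_over G (S - T)"
    using assms(1,2) by (auto simp: seq_over_def dest: mset_subset_eqD in_diffD)
  have "seq_sum G S = seq_sum G T \<otimes> seq_sum G (S - T)"
    using seq_sum_union[OF o] assms(2) by simp
  then show ?thesis
    using assms(3,4) o by (simp add: zero_sum_def seq_sum_closed)
qed

lemma seq_sum_image_hom:
  assumes "comm_group K" "\<phi> \<in> hom G K" "seq_over G S"
  shows "seq_sum K (image_mset \<phi> S) = \<phi> (seq_sum G S)"
proof -
  interpret K: comm_group K by fact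
  show ?thesis using assms(3)
  proof (induction S)
    case empty
    then show ?case using hom_one[OF assms(2)] by (simp add: is_group K.is_group)
  next
    case (add x S)
    then have o: "seq_over G S" "x \<in> carrier G" by (auto simp: seq_over_def)
    have "seq_over K (image_mset \<phi> S)" "\<phi> x \<in> carrier K"
      using o assms(2) by (auto simp: seq_over_def hom_def)
    then show ?case
      using add.IH[OF o(1)] o hom_mult[OF assms(2) o(2) seq_sum_closed[OF o(1)]]
      by (simp add: K.seq_sum_add_mset seq_sum_add_mset)
  qed
qed

lemma seq_sum_in_subgroup:
  assumes "subgroup K G" "set_mset S \<subseteq> K"
  shows "seq_sum G S \<in> K"
proof -
  have "set_mset S \<subseteq> K \<longrightarrow> seq_sum G S \<in> K"
  proof (induction S)
    case empty
    then show ?case using assms(1) by (simp add: subgroup.one_closed)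
  next
    case (add x S)
    show ?case
    proof
      assume "set_mset (add_mset x S) \<subseteq> K"
      moreover then have "seq_over G S" "x \<in> carrier G"
        using subgroup.subset[OF assms(1)] by (auto simp: seq_over_def)
      ultimately show "seq_sum G (add_mset x S) \<in> K"
        using add subgroup.m_closed[OF assms(1)] by (simp add: seq_sum_add_mset)
    qed
  qed
  then show ?thesis using assms(2) by simp
qed

lemma seq_sum_replicate: "x \<in> carrier G \<Longrightarrow> seq_sum G (replicate_mset n x) = x [^] n"
  by (induction n) (auto simp: seq_sum_add_mset seq_over_def m_comm set_mset_replicate_mset_subset)

lemma comm_group_subgroup:
  assumes "subgroup K G" shows "comm_group (G\<lparr>carrier := K\<rparr>)"
  using subgroup.subset[OF assms]
  by (intro group.group_comm_groupI subgroup_imp_group[OF assms]) (auto intro: m_comm)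

lemma seq_sum_subgroup:
  assumes "subgroup K G" "set_mset S \<subseteq> K"
  shows "seq_sum (G\<lparr>carrier := K\<rparr>) S = seq_sum G S"
proof -
  interpret K: comm_group "G\<lparr>carrier := K\<rparr>"
    using assms(1) by (rule comm_group_subgroup)
  have "set_mset S \<subseteq> K \<longrightarrow> seq_sum (G\<lparr>carrier := K\<rparr>) S = seq_sum G S"
  proof (induction S)
    case empty
    then show ?case using K.seq_sum_empty by simp
  next
    case (add x S)
    show ?case
    proof
      assume x: "set_mset (add_mset x S) \<subseteq> K"
      then have "seq_over (G\<lparr>carrier := K\<rparr>) S" "x \<in> K" "seq_over G S" "x \<in> carrier G"
        using subgroup.subset[OF assms(1)] by (auto simp: seq_over_def)
      then show "seq_sum (G\<lparr>carrier := K\<rparr>) (add_mset x S) = seq_sum G (add_mset x S)"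
        using add x K.seq_sum_add_mset[of S x] by (simp add: seq_sum_add_mset)
    qed
  qed
  then show ?thesis using assms(2) by simp
qed

text \<open>The prefix products, including the empty one, are \<open>length xs + 1\<close> elements
  of \<open>K\<close>, so two coincide and the terms between them multiply to the identity. With
  \<open>K\<close> the whole group this bounds the Davenport constant, with \<open>K\<close> a
  kernel it joins blocks.\<close>

lemma zero_sum_consecutive_pigeonhole:
  assumes K: "subgroup K G" "finite K" "card K \<le> length xs" "set xs \<subseteq> K"
  shows "\<exists>i j. i < j \<and> j \<le> length xs \<and> zero_sum G (mset (drop i (take j xs)))"
proof -
  define P where "P i = seq_sum G (mset (take i xs))" for i
  have "P ` {..length xs} \<subseteq> K"
    using K(4) by (auto simp: P_def intro!: seq_sum_in_subgroup[OF K(1)] dest!: in_set_takeD)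
  then have "card (P ` {..length xs}) < card {..length xs}"
    using card_mono[OF K(2), of "P ` {..length xs}"] K(3) by simp
  then have "\<not> inj_on P {..length xs}"
    by (rule pigeonhole)
  then obtain i j where ij: "i < j" "j \<le> length xs" "P i = P j"
    by (force simp: inj_on_def elim: linorder_neqE_nat)
  have o: "seq_over G (mset (drop i (take j xs)))" "seq_over G (mset (take i xs))"
    using K(4) subgroup.subset[OF K(1)] by (auto simp: seq_over_def dest!: in_set_takeD in_set_dropD)
  have "take j xs = take i xs @ drop i (take j xs)"
    using ij(1) by (metis append_take_drop_id less_imp_le_nat min.absorb1 take_take)
  then have "P j = P i \<otimes> seq_sum G (mset (drop i (take j xs)))"
    unfolding P_def by (metis mset_append o seq_sum_union)
  then have "seq_sum G (mset (drop i (take j xs))) = \<one>"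
    using ij(3) o l_cancel_one'[of "P i" "seq_sum G (mset (drop i (take j xs)))"]
    by (simp add: P_def seq_sum_closed)
  then show ?thesis using ij by (auto simp: zero_sum_def)
qed

end

section \<open>The Davenport constant\<close>

context comm_group
begin

lemma davenport_le:
  assumes "\<And>S. seq_over G S \<Longrightarrow> d \<le> size S \<Longrightarrow> \<exists>T. T \<subseteq># S \<and> T \<noteq> {#} \<and> zero_sum G T"
  shows "davenport G \<le> d"
  unfolding davenport_def by (rule Least_le) (use assms in blast)

lemma zero_sum_free_witness:
  assumes "d < davenport G"
  obtains S where "seq_over G S" "d \<le> size S"
    "\<And>T. T \<subseteq># S \<Longrightarrow> zero_sum G T \<Longrightarrow> T = {#}"
  using not_less_Least[OF assms[unfolded davenport_def]] by blast

text \<open>A \<open>LEAST\<close> has its defining property only if some number has it; by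
  pigeonhole the group order does.\<close>

lemma davenport_zero_sum:
  assumes "finite (carrier G)" "seq_over G S" "davenport G \<le> size S"
  obtains T where "T \<subseteq># S" "T \<noteq> {#}" "zero_sum G T"
proof -
  let ?P = "\<lambda>d. \<forall>S. seq_over G S \<and> d \<le> size S \<longrightarrow>
     (\<exists>T. T \<subseteq># S \<and> T \<noteq> {#} \<and> zero_sum G T)"
  have "?P (order G)"
  proof (intro allI impI, elim conjE)
    fix S assume S: "seq_over G S" "order G \<le> size S"
    obtain xs where xs: "mset xs = S" using ex_mset by blast
    then obtain i j where ij: "i < j" "j \<le> length xs" "zero_sum G (mset (drop i (take j xs)))"
      using zero_sum_consecutive_pigeonhole[OF subgroup_self assms(1), of xs] S
      by (auto simp: order_def seq_over_def)
    have "mset (drop i (take j xs)) \<subseteq># S"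
      unfolding xs[symmetric]
      by (metis append_take_drop_id mset_append mset_subset_eq_add_left mset_subset_eq_add_right
          subset_mset.order_trans)
    moreover have "mset (drop i (take j xs)) \<noteq> {#}" using ij by simp
    ultimately show "\<exists>T. T \<subseteq># S \<and> T \<noteq> {#} \<and> zero_sum G T" using ij by blast
  qed
  then have "?P (davenport G)" unfolding davenport_def by (rule LeastI)
  then show ?thesis using assms that by blast
qed

lemma davenport_pos:
  assumes "finite (carrier G)" shows "0 < davenport G"
proof (rule ccontr)
  assume "\<not> 0 < davenport G"
  then obtain T where "T \<subseteq># {#}" "T \<noteq> {#}"
    using davenport_zero_sum[OF assms, of "{#}"] by (auto simp: seq_over_def)
  then show False by simp
qed

lemma zero_sum_split:
  assumes "finite (carrier G)" "seq_over G S" "zero_sum G S" "davenport G < size S"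
  obtains T where "T \<subseteq># S" "T \<noteq> {#}" "T \<noteq> S" "zero_sum G T" "zero_sum G (S - T)"
proof -
  \<comment> \<open>One term is set aside before the Davenport constant is applied, so that
    \<open>T\<close> cannot be all of \<open>S\<close>.\<close>
  obtain x S' where S: "S = add_mset x S'"
    using assms(4) by (metis gr_implies_not0 multiset_cases size_empty)
  have "seq_over G S'" "davenport G \<le> size S'"
    using assms S by (auto simp: seq_over_def)
  then obtain T where T: "T \<subseteq># S'" "T \<noteq> {#}" "zero_sum G T"
    using davenport_zero_sum[OF assms(1)] by blast
  have "T \<subseteq># S" "T \<noteq> S"
    using T(1) S size_mset_mono[OF T(1)]
    by (auto intro: subset_mset.order_trans[OF T(1)])
  with T seq_sum_diff_zero_sum[OF assms(2) _ assms(3)] that show ?thesis by blast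
qed

text \<open>Of two nonempty parts with at most 2 e + 1 terms together, the smaller has at most
  e.\<close>

lemma zero_sum_split_short:
  assumes "finite (carrier G)" "seq_over G S" "zero_sum G S" "davenport G < size S"
    "size S \<le> 2 * e + 1"
  obtains T where "T \<subseteq># S" "T \<noteq> {#}" "zero_sum G T" "size T \<le> e"
proof -
  obtain T where T: "T \<subseteq># S" "T \<noteq> {#}" "T \<noteq> S" "zero_sum G T" "zero_sum G (S - T)"
    using zero_sum_split assms(1-4) by metis
  have "S - T \<noteq> {#}" using subset_mset.add_diff_inverse[OF T(1)] T(3) by auto
  moreover have "size S = size T + size (S - T)" using T(1)
    by (metis size_union subset_mset.add_diff_inverse)
  ultimately show ?thesis
    using that[of T] that[of "S - T"] T assms(5) by (cases "size T \<le> e") auto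
qed

end

section \<open>Difference operators modulo p\<close>

text \<open>With q = p^e, the product of i and (q choose i) is a multiple of q. If p did not divide
  the binomial coefficient, q would divide i.\<close>

lemma prime_dvd_prime_power_choose:
  assumes "prime p" "0 < i" "i < p ^ e"
  shows "p dvd (p ^ e choose i)"
proof (rule ccontr)
  assume "\<not> p dvd (p ^ e choose i)"
  then have cop: "coprime (p ^ e) (p ^ e choose i)"
    using assms(1) by (simp add: prime_imp_coprime coprime_power_left_iff)
  have "p ^ e dvd i * (p ^ e choose i)"
    using times_binomial_minus1_eq[OF assms(2), of "p ^ e"] by simp
  then have "p ^ e dvd i"
    using cop by (simp add: coprime_dvd_mult_left_iff)
  then show False using assms(2,3) by (auto dest: dvd_imp_le)
qed

text \<open>The group ring element 1 - g, acting on functions by translation of the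
  argument.\<close>

definition diff_op :: "('a, 'm) monoid_scheme \<Rightarrow> 'a \<Rightarrow> ('a \<Rightarrow> int) \<Rightarrow> 'a \<Rightarrow> int" where
  "diff_op G g f = (\<lambda>h. f h - f (g \<otimes>\<^bsub>G\<^esub> h))"

fun diffs :: "('a, 'm) monoid_scheme \<Rightarrow> 'a list \<Rightarrow> ('a \<Rightarrow> int) \<Rightarrow> 'a \<Rightarrow> int" where
  "diffs G [] f = f"
| "diffs G (g # gs) f = diff_op G g (diffs G gs f)"

text \<open>The augmentation ideal of the group ring over the field with \<open>p\<close> elements has vanishing
  \<open>N\<close>-th power, expressed through the action of the group ring on integer-valued functions.\<close>

definition aug_nilpotent :: "('a, 'm) monoid_scheme \<Rightarrow> nat \<Rightarrow> nat \<Rightarrow> bool" where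
  "aug_nilpotent G p N \<longleftrightarrow> (\<forall>f gs. set gs \<subseteq> carrier G \<and> N \<le> length gs \<longrightarrow>
     (\<forall>h\<in>carrier G. int p dvd diffs G gs f h))"

lemma aug_nilpotent_mono: "aug_nilpotent G p N \<Longrightarrow> N \<le> M \<Longrightarrow> aug_nilpotent G p M"
  unfolding aug_nilpotent_def by auto

context comm_group
begin

text \<open>The calculus is pointwise on the carrier: outside it the multiplication is
  unconstrained, so the operators need not commute as functions.\<close>

lemma diff_op_cong:
  assumes "\<And>h. h \<in> carrier G \<Longrightarrow> f h = f' h" "g \<in> carrier G" "h \<in> carrier G"
  shows "diff_op G g f h = diff_op G g f' h"
  using assms by (simp add: diff_op_def)

lemma diff_op_commute:
  assumes "g \<in> carrier G" "k \<in> carrier G" "h \<in> carrier G"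
  shows "diff_op G g (diff_op G k f) h = diff_op G k (diff_op G g f) h"
  using assms by (simp add: diff_op_def m_lcomm)

lemma diffs_snoc:
  assumes "set gs \<subseteq> carrier G" "x \<in> carrier G" "h \<in> carrier G"
  shows "diffs G (gs @ [x]) f h = diffs G (x # gs) f h"
  using assms
proof (induction gs arbitrary: h)
  case (Cons g gs)
  have "diffs G ((g # gs) @ [x]) f h = diff_op G g (diffs G (x # gs) f) h"
    using Cons by (auto intro: diff_op_cong)
  also have "\<dots> = diffs G (x # g # gs) f h"
    using Cons.prems by (simp add: diff_op_commute)
  finally show ?case .
qed auto

lemma diffs_append: "diffs G (xs @ ys) f = diffs G xs (diffs G ys f)"
  by (induction xs) auto

lemma diffs_perm:
  assumes "mset gs = mset gs'" "set gs \<subseteq> carrier G" "h \<in> carrier G"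
  shows "diffs G gs f h = diffs G gs' f h"
  using assms
proof (induction gs arbitrary: gs' h)
  case (Cons x gs)
  have "x \<in> set gs'" using Cons.prems(1) by (metis list.set_intros(1) set_mset_mset)
  then obtain ys zs where gs': "gs' = ys @ x # zs" by (auto simp: in_set_conv_decomp)
  have gs: "mset gs = mset (ys @ zs)" using Cons.prems(1) gs' by simp
  have cl: "set ys \<subseteq> carrier G" "set zs \<subseteq> carrier G" "x \<in> carrier G" "set gs \<subseteq> carrier G"
    using Cons.prems(1,2) gs' mset_eq_setD[OF gs] by auto
  have "diffs G (x # gs) f h = diff_op G x (diffs G (ys @ zs) f) h"
    using Cons.IH[OF gs cl(4)] cl Cons.prems(3) by (auto intro: diff_op_cong)
  also have "\<dots> = diffs G (x # ys) (diffs G zs f) h" by (simp add: diffs_append)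
  also have "\<dots> = diffs G (ys @ [x]) (diffs G zs f) h"
    using diffs_snoc cl Cons.prems(3) by simp
  also have "\<dots> = diffs G gs' f h" by (simp add: gs' diffs_append)
  finally show ?case .
qed auto

lemma diffs_dvd:
  assumes "set gs \<subseteq> carrier G" "\<And>h. h \<in> carrier G \<Longrightarrow> int p dvd f h" "h \<in> carrier G"
  shows "int p dvd diffs G gs f h"
  using assms(1,3) by (induction gs arbitrary: h) (auto simp: diff_op_def assms(2))

lemma diffs_replicate:
  assumes "g \<in> carrier G" "h \<in> carrier G"
  shows "diffs G (replicate n g) f h = (\<Sum>i\<le>n. (-1) ^ i * int (n choose i) * f (g [^] i \<otimes> h))"
  using assms(2)
proof (induction n arbitrary: h)
  case (Suc n)
  let ?c = "\<lambda>n i. (-1) ^ i * int (n choose i)" and ?F = "\<lambda>i::nat. f (g [^] i \<otimes> h)"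
  have sh: "g [^] i \<otimes> (g \<otimes> h) = g [^] Suc i \<otimes> h" for i
    using assms(1) Suc.prems by (simp add: m_assoc)
  have "diffs G (replicate (Suc n) g) f h
      = (\<Sum>i\<le>n. ?c n i * ?F i) - (\<Sum>i\<le>n. ?c n i * ?F (Suc i))"
    using Suc.IH[of h] Suc.IH[of "g \<otimes> h"] Suc.prems assms(1)
    by (simp add: diff_op_def sh del: nat_pow_Suc)
  also have "(\<Sum>i\<le>n. ?c n i * ?F i) = (\<Sum>i\<le>Suc n. ?c n i * ?F i)"
    by simp
  also have "\<dots> = ?F 0 + (\<Sum>i\<le>n. ?c n (Suc i) * ?F (Suc i))"
    by (subst sum.atMost_Suc_shift) simp
  also have "\<dots> - (\<Sum>i\<le>n. ?c n i * ?F (Suc i))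
      = ?F 0 + (\<Sum>i\<le>n. ?c (Suc n) (Suc i) * ?F (Suc i))"
    by (simp add: sum_subtractf sum.distrib sum_negf algebra_simps del: nat_pow_Suc)
  also have "\<dots> = (\<Sum>i\<le>Suc n. ?c (Suc n) i * ?F i)"
    by (subst sum.atMost_Suc_shift) simp
  finally show ?case .
qed (use assms in simp)

text \<open>Modulo p the power (1 - g)^q with q = p^e reduces to its two end terms, because the
  inner binomial coefficients vanish; these end terms cancel since g^q is the identity.\<close>

lemma diffs_replicate_prime_power:
  assumes "prime p" "g \<in> carrier G" "g [^] (p ^ e) = \<one>" "p ^ e \<le> n" "h \<in> carrier G"
  shows "int p dvd diffs G (replicate n g) f h"
proof -
  let ?q = "p ^ e"
  have "int p dvd diffs G (replicate ?q g) f h" if "h \<in> carrier G" for h f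
  proof -
    let ?t = "\<lambda>i. (-1) ^ i * int (?q choose i) * f (g [^] i \<otimes> h)"
    have q: "0 < ?q" using assms(1) by (simp add: prime_gt_0_nat)
    have "diffs G (replicate ?q g) f h = (\<Sum>i\<le>?q. ?t i)"
      using diffs_replicate[OF assms(2) that] .
    also have "{..?q} = insert 0 (insert ?q {0<..<?q})" using q by auto
    also have "(\<Sum>i\<in>\<dots>. ?t i) = ?t 0 + ?t ?q + (\<Sum>i\<in>{0<..<?q}. ?t i)"
      using q by simp
    also have "?t 0 + ?t ?q = (1 + (-1) ^ ?q) * f h"
      using that assms(3) by (simp add: algebra_simps)
    finally have eq: "diffs G (replicate ?q g) f h
      = (1 + (-1) ^ ?q) * f h + (\<Sum>i\<in>{0<..<?q}. ?t i)" .
    have "int p dvd (\<Sum>i\<in>{0<..<?q}. ?t i)"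
      using prime_dvd_prime_power_choose[OF assms(1)]
      by (intro dvd_sum dvd_mult2 dvd_mult) auto
    \<comment> \<open>For odd p, and for q = 1, the end terms cancel exactly; for even q they add up
      to 2 = p.\<close>
    moreover have "int p dvd 1 + (-1) ^ ?q"
    proof (cases "p = 2")
      case False
      then have "odd p" using assms(1) prime_odd_nat prime_ge_2_nat[OF assms(1)] by force
      then show ?thesis by simp
    next
      case True
      then show ?thesis by (cases "e = 0") auto
    qed
    ultimately show ?thesis unfolding eq by simp
  qed
  moreover have "replicate n g = replicate (n - ?q) g @ replicate ?q g"
    using assms(4) by (simp add: replicate_add[symmetric])
  moreover have "set (replicate (n - ?q) g) \<subseteq> carrier G" using assms(2) by auto
  ultimately show ?thesis using diffs_dvd assms(5) by (metis diffs_append)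
qed

text \<open>On a coset of the image, operators coming from \<open>K\<close> act as they do inside
  \<open>K\<close>. This carries the nilpotency of \<open>K\<close> over to functions on
  \<open>G\<close>.\<close>

lemma diffs_hom:
  assumes "comm_group K" "\<iota> \<in> hom K G" "set ks \<subseteq> carrier K" "h \<in> carrier G" "k \<in> carrier K"
  shows "diffs G (map \<iota> ks) f (\<iota> k \<otimes> h) = diffs K ks (\<lambda>k. f (\<iota> k \<otimes> h)) k"
proof -
  interpret K: comm_group K by fact
  show ?thesis using assms(3,5)
  proof (induction ks arbitrary: k)
    case (Cons x ks)
    then have c: "x \<in> carrier K" "k \<in> carrier K" "\<iota> x \<in> carrier G" "\<iota> k \<in> carrier G"
      using assms(2) by (auto simp: hom_def)
    have "\<iota> x \<otimes> (\<iota> k \<otimes> h) = \<iota> (x \<otimes>\<^bsub>K\<^esub> k) \<otimes> h"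
      using c assms(4) by (simp add: hom_mult[OF assms(2)] m_assoc)
    then show ?case
      using Cons.IH[of k] Cons.IH[of "x \<otimes>\<^bsub>K\<^esub> k"] Cons.prems c by (simp add: diff_op_def)
  qed simp
qed

text \<open>Expanding each \<open>1 - g\<^sup>a k\<close> as \<open>(1 - k) + k (1 + g + \<dots> + g\<^sup>a\<^sup>-\<^sup>1) (1 - g)\<close>,
  a long product has either \<open>N\<close> factors from \<open>K\<close> or \<open>p\<^sup>e\<close> factors \<open>1 - g\<close>.\<close>

lemma aug_nilpotent_cyclic_extension:
  assumes p: "prime p" and K: "comm_group K" "aug_nilpotent K p N" "\<iota> \<in> hom K G"
    and g: "g \<in> carrier G" "g [^] (p ^ e) = \<one>"
    and gen: "\<And>x. x \<in> carrier G \<Longrightarrow> \<exists>a k. k \<in> carrier K \<and> x = g [^] (a::nat) \<otimes> \<iota> k"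
  shows "aug_nilpotent G p (N + p ^ e - 1)"
  unfolding aug_nilpotent_def
proof (intro allI impI ballI, elim conjE)
  fix f us h
  assume us: "set us \<subseteq> carrier G" "N + p ^ e - 1 \<le> length us" "h \<in> carrier G"
  interpret K: comm_group K by fact
  have \<iota>: "\<iota> k \<in> carrier G" if "k \<in> carrier K" for k using K(3) that by (auto simp: hom_def)
  \<comment> \<open>Induction over the factors not yet expanded: \<open>b\<close> counts the factors
    1 - g collected so far, \<open>ks\<close> holds those from \<open>K\<close>, and every expansion
    step keeps the total number of factors.\<close>
  have "int p dvd diffs G (us @ replicate b g @ map \<iota> ks) f h"
    if "set us \<subseteq> carrier G" "set ks \<subseteq> carrier K" "N + p ^ e - 1 \<le> length us + b + length ks"
      "h \<in> carrier G" for us b ks h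
    using that
  proof (induction us arbitrary: b ks h)
    case Nil
    have ks: "set (map \<iota> ks) \<subseteq> carrier G" using Nil.prems(2) \<iota> by auto
    show ?case
    proof (cases "N \<le> length ks")
      case True
      have "int p dvd diffs G (map \<iota> ks) f h" if "h \<in> carrier G" for h
        using diffs_hom[OF K(1,3) Nil.prems(2) that, of "\<one>\<^bsub>K\<^esub>" f] K(2) True Nil.prems(2) that
          hom_one[OF K(3) K.is_group is_group]
        by (auto simp: aug_nilpotent_def)
      moreover have "set (replicate b g) \<subseteq> carrier G" using g by auto
      ultimately show ?thesis
        using diffs_dvd[of "replicate b g" p "diffs G (map \<iota> ks) f" h] Nil.prems(4)
        by (simp add: diffs_append)
    next
      case False
      then have "p ^ e \<le> b" using Nil.prems(3) p by (simp add: prime_gt_0_nat)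
      then show ?thesis
        using diffs_replicate_prime_power[OF p g _ Nil.prems(4)] by (simp add: diffs_append)
    qed
  next
    case (Cons u us)
    let ?rest = "us @ replicate b g @ map \<iota> ks"
    let ?F = "diffs G ?rest f"
    obtain a :: nat and k where k: "k \<in> carrier K" and u: "u = g [^] a \<otimes> \<iota> k"
      using gen[of u] Cons.prems(1) by (meson list.set_intros(1) subsetD)
    have cl: "set ?rest \<subseteq> carrier G" "set us \<subseteq> carrier G"
      using Cons.prems(1,2) g(1) \<iota> by (auto simp: set_replicate_conv_if)
    have dk: "int p dvd ?F h - ?F (\<iota> k \<otimes> h)"
    proof -
      have "int p dvd diffs G (us @ replicate b g @ map \<iota> (k # ks)) f h"
        using Cons.IH[of "k # ks" b h] Cons.prems k by simp
      also have "diffs G (us @ replicate b g @ map \<iota> (k # ks)) f h = diffs G (\<iota> k # ?rest) f h"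
        using cl \<iota> k Cons.prems(4) by (intro diffs_perm) auto
      finally show ?thesis by (simp add: diff_op_def)
    qed
    \<comment> \<open>Needed at every point \<open>h\<close>, since the telescoping sum in
      \<open>da\<close> moves the base point by one \<open>g\<close> at a time.\<close>
    have dg: "int p dvd ?F h - ?F (g \<otimes> h)" if "h \<in> carrier G" for h
    proof -
      have "int p dvd diffs G (us @ replicate (Suc b) g @ map \<iota> ks) f h"
        using Cons.IH[of ks "Suc b" h] Cons.prems that by simp
      also have "diffs G (us @ replicate (Suc b) g @ map \<iota> ks) f h = diffs G (g # ?rest) f h"
        using cl g(1) that by (intro diffs_perm) auto
      finally show ?thesis by (simp add: diff_op_def)
    qed
    have da: "int p dvd ?F h - ?F (g [^] i \<otimes> h)" if "h \<in> carrier G" for h and i :: nat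
    proof (induction i)
      case (Suc i)
      have "int p dvd ?F (g [^] i \<otimes> h) - ?F (g \<otimes> (g [^] i \<otimes> h))"
        using dg that g(1) by simp
      moreover have "g \<otimes> (g [^] i \<otimes> h) = g [^] Suc i \<otimes> h"
        using that g(1) by (simp add: m_assoc[symmetric] m_comm)
      ultimately have "int p dvd ?F (g [^] i \<otimes> h) - ?F (g [^] Suc i \<otimes> h)" by simp
      from dvd_add[OF Suc.IH this] show ?case by simp
    qed (use that in simp)
    have "u \<otimes> h = g [^] a \<otimes> (\<iota> k \<otimes> h)"
      using u g(1) \<iota> k Cons.prems(4) by (simp add: m_assoc)
    then have "int p dvd ?F h - ?F (u \<otimes> h)"
      using dvd_add[OF dk da[of "\<iota> k \<otimes> h" a]] \<iota> k Cons.prems(4) by simp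
    then show ?case by (simp add: diff_op_def)
  qed
  from this[of us "[]" 0 h] us show "int p dvd diffs G us f h" by simp
qed

lemma aug_nilpotent_trivial:
  assumes "carrier G = {\<one>}" shows "aug_nilpotent G p 1"
  unfolding aug_nilpotent_def
proof (intro allI impI ballI, elim conjE)
  fix f gs h assume "set gs \<subseteq> carrier G" "1 \<le> length gs" "h \<in> carrier G"
  then show "int p dvd diffs G gs f h"
    using assms by (cases gs) (auto simp: diff_op_def)
qed

text \<open>Evaluated on the indicator function of \<open>\<one>\<close>, the product of the \<open>1 - g\<close> over a zero-sum
  free sequence has constant term 1.\<close>

lemma aug_nilpotent_zero_sum:
  assumes "1 < p" "aug_nilpotent G p N" "seq_over G S" "N \<le> size S"
  shows "\<exists>T. T \<subseteq># S \<and> T \<noteq> {#} \<and> zero_sum G T"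
proof (rule ccontr)
  assume free: "\<not> ?thesis"
  let ?d = "\<lambda>h. if h = \<one> then 1 else 0 :: int"
  \<comment> \<open>The expanded product is supported on inverses of sums of subsequences.\<close>
  have supp: "\<exists>T. T \<subseteq># mset gs \<and> h \<otimes> seq_sum G T = \<one>"
    if "set gs \<subseteq> carrier G" "h \<in> carrier G" "diffs G gs ?d h \<noteq> 0" for gs h
    using that
  proof (induction gs arbitrary: h)
    case Nil
    then show ?case by (auto split: if_splits)
  next
    case (Cons g gs)
    then have "diffs G gs ?d h \<noteq> 0 \<or> diffs G gs ?d (g \<otimes> h) \<noteq> 0"
      by (auto simp: diff_op_def)
    then consider "diffs G gs ?d h \<noteq> 0" | "diffs G gs ?d (g \<otimes> h) \<noteq> 0" by blast
    then show ?case
    proof cases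
      case 1
      then obtain T where "T \<subseteq># mset gs" "h \<otimes> seq_sum G T = \<one>"
        using Cons.IH[of h] Cons.prems by auto
      then show ?thesis
        by (intro exI[of _ T]) (auto intro: subset_mset.order_trans)
    next
      case 2
      then obtain T where T: "T \<subseteq># mset gs" "g \<otimes> h \<otimes> seq_sum G T = \<one>"
        using Cons.IH[of "g \<otimes> h"] Cons.prems by auto
      have o: "seq_over G T" "g \<in> carrier G"
        using T(1) Cons.prems(1) by (auto simp: seq_over_def dest!: mset_subset_eqD)
      then have "h \<otimes> seq_sum G (add_mset g T) = \<one>"
        using T(2) Cons.prems(2) by (simp add: seq_sum_add_mset seq_sum_closed m_ac)
      then show ?thesis using T(1) by (intro exI[of _ "add_mset g T"]) simp
    qed
  qed
  have "diffs G gs ?d \<one> = 1" if "mset gs \<subseteq># S" for gs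
    using that
  proof (induction gs)
    case (Cons g gs)
    have sub: "mset gs \<subseteq># S"
      using Cons.prems by (auto intro: subset_mset.order_trans[of _ "mset (g # gs)"])
    have cl: "g \<in> carrier G" "set gs \<subseteq> carrier G"
      using Cons.prems assms(3) by (auto simp: seq_over_def dest: mset_subset_eqD)
    \<comment> \<open>A nonzero value would give a subsequence that \<open>g\<close> completes to a
      zero-sum one. Hence the new factor leaves the value at the identity unchanged.\<close>
    have "diffs G gs ?d g = 0"
    proof (rule ccontr)
      assume "diffs G gs ?d g \<noteq> 0"
      from supp[OF cl(2,1) this] obtain T where T: "T \<subseteq># mset gs" "g \<otimes> seq_sum G T = \<one>"
        by blast
      have "add_mset g T \<subseteq># mset (g # gs)" using T(1) by simp
      then have "add_mset g T \<subseteq># S" using Cons.prems subset_mset.order_trans by blast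
      moreover have "seq_over G T" using T(1) cl by (auto simp: seq_over_def dest!: mset_subset_eqD)
      ultimately show False
        using free T(2) cl by (metis seq_sum_add_mset zero_sum_def add_mset_not_empty)
    qed
    then show ?case using Cons.IH[OF sub] cl by (simp add: diff_op_def)
  qed simp
  moreover obtain gs where "mset gs = S" using ex_mset by blast
  ultimately have "int p dvd 1"
    using assms(2-4) unfolding aug_nilpotent_def seq_over_def
    by (metis one_closed set_mset_mset size_mset subset_mset.order_refl)
  then show False using assms(1) by simp
qed

lemma davenport_le_aug_nilpotent:
  "1 < p \<Longrightarrow> aug_nilpotent G p N \<Longrightarrow> davenport G \<le> N"
  using aug_nilpotent_zero_sum by (intro davenport_le) blast

end

section \<open>Finite abelian p-groups\<close>

context comm_group
begin

lemma int_pow_mem_subgroup: "subgroup K G \<Longrightarrow> x \<in> K \<Longrightarrow> x [^] (i::int) \<in> K"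
  using subgroup_int_pow_closed by blast

text \<open>A cyclic subgroup C of maximal order is a direct factor. Take \<open>K\<close> maximal
  among the subgroups meeting C trivially. If C and \<open>K\<close> did not generate everything,
  some \<open>y\<close> outside their product would have its p-th power in \<open>K\<close>, and
  adjoining \<open>y\<close> to \<open>K\<close> would still meet C trivially.\<close>

lemma p_group_max_cyclic_complement:
  assumes p: "prime p" and g: "g \<in> carrier G" "ord g = p ^ e"
    and max: "\<And>x. x \<in> carrier G \<Longrightarrow> x [^] (p ^ e) = \<one>" and fin: "finite (carrier G)"
  obtains K where "subgroup K G" "generate G {g} \<inter> K = {\<one>}" "generate G {g} <#> K = carrier G"
proof -
  let ?C = "generate G {g}"
  have C: "subgroup ?C G" using g by (intro generate_is_subgroup) auto
  let ?\<K> = "{K. subgroup K G \<and> ?C \<inter> K = {\<one>}}"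
  have "finite ?\<K>"
    by (rule finite_subset[of _ "Pow (carrier G)"]) (auto dest: subgroup.subset simp: fin)
  moreover have "{\<one>} \<in> ?\<K>"
    using triv_subgroup subgroup.one_closed[OF C] by auto
  ultimately obtain K where "K \<in> ?\<K>" and Kmax': "\<forall>K'\<in>?\<K>. K \<subseteq> K' \<longrightarrow> K = K'"
    using finite_has_maximal[of ?\<K>] by blast
  then have K: "subgroup K G" "?C \<inter> K = {\<one>}"
    and Kmax: "\<And>K'. K' \<in> ?\<K> \<Longrightarrow> K \<subseteq> K' \<Longrightarrow> K' = K"
    by auto
  let ?M = "?C <#> K"
  have M: "subgroup ?M G" using mult_subgroups[OF C K(1)] .
  have KM: "K \<subseteq> ?M" "?C \<subseteq> ?M"
    using subgroup.one_closed[OF C] subgroup.one_closed[OF K(1)] subgroup.subset[OF K(1)]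
      subgroup.subset[OF C]
    by (force simp: set_mult_def)+
  have "x \<in> ?M" if x: "x \<in> carrier G" for x
  proof (rule ccontr)
    assume "x \<notin> ?M"
    moreover have "x [^] (p ^ e) \<in> ?M" using max[OF x] subgroup.one_closed[OF M] by simp
    ultimately obtain j where j: "x [^] (p ^ j) \<notin> ?M" "x [^] (p ^ Suc j) \<in> ?M"
      using ex_least_nat_less[of "\<lambda>j. x [^] (p ^ j) \<in> ?M" e] x by auto
    define z where "z = x [^] (p ^ j)"
    have z: "z \<in> carrier G" "z \<notin> ?M" "z [^] p \<in> ?M"
      using j x by (auto simp: z_def nat_pow_pow mult.commute)
    then obtain c k where ck: "z [^] p = c \<otimes> k" "c \<in> ?C" "k \<in> K"
      by (auto simp: set_mult_def)
    then obtain a :: int where a: "c = g [^] a" using generate_pow[OF g(1)] by auto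
    have kc: "k \<in> carrier G" "c \<in> carrier G"
      using ck subgroup.subset[OF K(1)] subgroup.subset[OF C] by auto
    have "e \<noteq> 0"
    proof
      assume "e = 0"
      then have "z = \<one>" using max[OF z(1)] z(1) by simp
      then show False using z(2) subgroup.one_closed[OF M] by simp
    qed
    then have pe: "p ^ e = p * p ^ (e - 1)" by (cases e) auto
    \<comment> \<open>The exponent p^e kills \<open>z\<close>, so the powers of \<open>c\<close> and
      \<open>k\<close> with exponent p^(e-1) are inverse to each other and lie in the trivial
      intersection. As \<open>g\<close> has order p^e, the exponent \<open>a\<close> of
      \<open>c\<close> is divisible by p.\<close>
    have "\<one> = (c \<otimes> k) [^] (p ^ (e - 1))"
      using max[OF z(1)] z(1) by (simp add: pe nat_pow_pow ck(1)[symmetric])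
    also have "\<dots> = c [^] (p ^ (e - 1)) \<otimes> k [^] (p ^ (e - 1))"
      using kc by (simp add: pow_mult_distrib m_comm)
    finally have "c [^] (p ^ (e - 1)) = inv (k [^] (p ^ (e - 1)))"
      using kc by (metis inv_equality inv_inv nat_pow_closed inv_closed)
    then have "c [^] (p ^ (e - 1)) \<in> K"
      using ck(3) K(1) by (metis int_pow_int int_pow_mem_subgroup subgroup.m_inv_closed)
    moreover have "c [^] (p ^ (e - 1)) \<in> ?C"
      using ck(2) C by (metis int_pow_int int_pow_mem_subgroup)
    ultimately have "c [^] (p ^ (e - 1)) = \<one>" using K(2) by auto
    then have "g [^] (a * int (p ^ (e - 1))) = \<one>"
      using a g(1) by (simp add: int_pow_pow int_pow_int[symmetric])
    then have "int (p * p ^ (e - 1)) dvd a * int (p ^ (e - 1))"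
      using int_pow_eq_id[OF g(1)] g(2) pe by simp
    then have "int p dvd a" using p by (simp add: prime_gt_0_nat)
    then obtain b where b: "a = int p * b" by auto
    \<comment> \<open>Dividing \<open>z\<close> by a p-th root of \<open>c\<close> inside C leaves
      an element whose p-th power is \<open>k\<close>, still outside \<open>?M\<close>.\<close>
    define y where "y = z \<otimes> inv (g [^] b)"
    have gb: "g [^] b \<in> carrier G" "g [^] b \<in> ?M"
      using g(1) KM(2) generate_pow[OF g(1)] by auto
    have yz: "z = y \<otimes> g [^] b" using z(1) gb(1) by (simp add: y_def m_assoc)
    have y: "y \<in> carrier G" using z(1) gb(1) by (simp add: y_def)
    have yM: "y \<notin> ?M" using z(2) subgroup.m_closed[OF M _ gb(2), of y] yz by auto
    have "(g [^] b) [^] p = c"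
      using a b g(1) by (simp add: int_pow_pow int_pow_int[symmetric] mult.commute)
    then have "z [^] p = c \<otimes> y [^] p"
      using yz y gb(1) kc by (simp add: pow_mult_distrib m_comm)
    then have yp: "y [^] p = k"
      using ck(1) kc y by simp
    let ?K' = "generate G {y} <#> K"
    have Y: "subgroup (generate G {y}) G" using y by (intro generate_is_subgroup) auto
    have K': "subgroup ?K' G" using mult_subgroups[OF Y K(1)] .
    have "w = \<one>" if w: "w \<in> ?C" "w \<in> ?K'" for w
    proof -
      obtain i :: int and k' where ik: "w = y [^] i \<otimes> k'" "k' \<in> K"
        using w(2) generate_pow[OF y] by (auto simp: set_mult_def)
      have k': "k' \<in> carrier G" using ik(2) subgroup.subset[OF K(1)] by auto
      have wc: "w \<in> carrier G" using w(1) subgroup.subset[OF C] by auto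
      have "int p dvd i"
      proof (rule ccontr)
        assume "\<not> int p dvd i"
        \<comment> \<open>Otherwise Bezout writes \<open>y\<close> as a product of powers of y^p = k
          and of y^i, both in \<open>?M\<close>.\<close>
        then have "coprime (int p) i" using p by (simp add: prime_imp_coprime)
        then obtain u v where uv: "u * int p + v * i = 1"
          using bezout_int[of "int p" i] by (auto simp: coprime_iff_gcd_eq_1)
        have "y [^] i = w \<otimes> inv k'" using ik y k' by (simp add: m_assoc)
        then have yi: "y [^] i \<in> ?M"
          using w(1) subgroup.m_inv_closed[OF K(1) ik(2)] by (auto simp: set_mult_def)
        have "y [^] (u * int p + v * i) = k [^] u \<otimes> (y [^] i) [^] v"
          using y yp
          by (simp add: int_pow_mult mult.commute[of u] mult.commute[of v]
              int_pow_pow[symmetric] int_pow_int)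
        then have "y \<in> ?M"
          using uv y yi KM(1) ck(3)
            subgroup.m_closed[OF M int_pow_mem_subgroup[OF M] int_pow_mem_subgroup[OF M]]
          by (metis int_pow_1 subsetD)
        then show False using yM by simp
      qed
      then obtain l where "i = int p * l" by auto
      then have "y [^] i = k [^] l" using y yp by (simp add: int_pow_pow[symmetric] int_pow_int)
      then have "w \<in> K"
        using ik ck(3) K(1) int_pow_mem_subgroup subgroup.m_closed by metis
      then show ?thesis using w(1) K(2) by auto
    qed
    then have "?C \<inter> ?K' = {\<one>}"
      using subgroup.one_closed[OF C] subgroup.one_closed[OF K'] by blast
    then have "?K' \<in> ?\<K>" using K' by blast
    moreover have "\<one> \<otimes> x \<in> ?K'" if "x \<in> K" for x
      using subgroup.one_closed[OF Y] that unfolding set_mult_def by blast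
    then have "K \<subseteq> ?K'" using subgroup.subset[OF K(1)] by force
    ultimately have "?K' = K" using Kmax by blast
    moreover have "y \<otimes> \<one> \<in> ?K'"
      using generate.incl[of y "{y}" G] subgroup.one_closed[OF K(1)]
      unfolding set_mult_def by blast
    ultimately show False using yM KM(1) y by auto
  qed
  then have "?M = carrier G" using subgroup.subset[OF M] by auto
  then show ?thesis using K that by blast
qed

lemma ord_prime_power:
  assumes "prime p" "order G = p ^ k" "finite (carrier G)" "x \<in> carrier G"
  shows "\<exists>j. ord x = p ^ j"
  using pow_order_eq_1[OF assms(4)] pow_eq_id[OF assms(4)] assms(1,2)
  by (metis divides_primepow_nat)

text \<open>All orders are powers of p and hence totally ordered by divisibility, so the largest one
  is an exponent of the group.\<close>

lemma p_group_cyclic_decomposition: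
  assumes p: "prime p" "order G = p ^ k" "finite (carrier G)"
  obtains g e K where "g \<in> carrier G" "ord g = p ^ e" "subgroup K G"
    "generate G {g} \<inter> K = {\<one>}" "generate G {g} <#> K = carrier G" "carrier G \<noteq> {\<one>} \<Longrightarrow> 0 < e"
proof -
  have "Max (ord ` carrier G) \<in> ord ` carrier G"
    using p(3) carrier_not_empty by (intro Max_in) auto
  then obtain g where g: "g \<in> carrier G" "ord g = Max (ord ` carrier G)" by auto
  have gmax: "ord x \<le> ord g" if "x \<in> carrier G" for x
    unfolding g(2) using p(3) that by (intro Max_ge) auto
  obtain e where e: "ord g = p ^ e" using ord_prime_power[OF p g(1)] by blast
  have max: "x [^] (p ^ e) = \<one>" if x: "x \<in> carrier G" for x
  proof -
    obtain j where j: "ord x = p ^ j" using ord_prime_power[OF p x] by blast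
    have "j \<le> e" using gmax[OF x] e j prime_gt_1_nat[OF p(1)] by simp
    then have "ord x dvd p ^ e" by (simp add: j le_imp_power_dvd)
    then show ?thesis using pow_eq_id[OF x] by simp
  qed
  have "0 < e" if "carrier G \<noteq> {\<one>}"
  proof (rule ccontr)
    assume "\<not> 0 < e"
    then have "carrier G \<subseteq> {\<one>}" using max by auto
    then show False using that one_closed by auto
  qed
  then show ?thesis
    using p_group_max_cyclic_complement[OF p(1) g(1) e max p(3)] that g(1) e by metis
qed

end

text \<open>The intersection with \<open>S\<close> takes as many terms from \<open>S\<close> as
  possible; what is left over can only consist of copies of \<open>g\<close>.\<close>

lemma mset_subset_replicate_split:
  assumes "T \<subseteq># S + replicate_mset n g"
  obtains T' i where "T' \<subseteq># S" "i \<le> n" "T = T' + replicate_mset i g"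
proof -
  have "T - S \<subseteq># replicate_mset n g"
    using assms by (simp add: subset_eq_diff_conv add.commute)
  then obtain i where i: "i \<le> n" "T - S = replicate_mset i g"
    by (rule msubseteq_replicate_msetE)
  have "T = T \<inter># S + replicate_mset i g"
    unfolding i(2)[symmetric] by (auto simp: multiset_eq_iff)
  then show ?thesis using that[of "T \<inter># S" i] i(1) by simp
qed

lemma subset_image_mset_preimage:
  assumes "U \<subseteq># image_mset f M"
  obtains T where "T \<subseteq># M" "U = image_mset f T"
  using assms by (metis image_mset_eq_plusD mset_subset_eq_add_left mset_subset_eq_exists_conv)

context comm_group
begin

text \<open>A longest zero-sum free sequence over \<open>K\<close> stays zero-sum free after adding
  \<open>ord g - 1\<close> copies of \<open>g\<close>: in a zero-sum subsequence the part in
  \<open>K\<close> and the power of \<open>g\<close> are inverse to each other, hence both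
  trivial.\<close>

lemma davenport_cyclic_complement:
  assumes fin: "finite (carrier G)" and g: "g \<in> carrier G" and K: "subgroup K G"
    and int: "generate G {g} \<inter> K = {\<one>}"
  shows "davenport (G\<lparr>carrier := K\<rparr>) + ord g \<le> davenport G + 1"
proof (rule ccontr)
  assume neg: "\<not> ?thesis"
  let ?K = "G\<lparr>carrier := K\<rparr>"
  interpret K: comm_group ?K using K by (rule comm_group_subgroup)
  have og: "0 < ord g" using ord_ge_1[OF fin g] by simp
  have finK: "finite (carrier ?K)" using finite_subset[OF subgroup.subset[OF K] fin] by simp
  have "davenport ?K - 1 < davenport ?K" using K.davenport_pos[OF finK] by simp
  then obtain S where S: "seq_over ?K S" "davenport ?K - 1 \<le> size S"
    and free: "\<And>T. T \<subseteq># S \<Longrightarrow> zero_sum ?K T \<Longrightarrow> T = {#}"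
    using K.zero_sum_free_witness by blast
  have SK: "set_mset S \<subseteq> K" using S(1) by (simp add: seq_over_def)
  let ?S = "S + replicate_mset (ord g - 1) g"
  have "seq_over G ?S"
    using SK subgroup.subset[OF K] g by (auto simp: seq_over_def)
  moreover have "davenport G \<le> size ?S" using neg S(2) og by simp
  ultimately obtain T where T: "T \<subseteq># ?S" "T \<noteq> {#}" "zero_sum G T"
    using davenport_zero_sum[OF fin] by blast
  obtain T1 i where T1: "T1 \<subseteq># S" and i: "i \<le> ord g - 1" and Teq: "T = T1 + replicate_mset i g"
    using T(1) by (rule mset_subset_replicate_split)
  have T1K: "set_mset T1 \<subseteq> K" using T1 SK by (auto dest: mset_subset_eqD)
  have s1: "seq_sum G T1 \<in> K" using seq_sum_in_subgroup[OF K T1K] .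
  have o1: "seq_over G T1" using T1K subgroup.subset[OF K] by (auto simp: seq_over_def)
  have or: "seq_over G (replicate_mset i g)" using g by (simp add: seq_over_def)
  have prod: "seq_sum G T1 \<otimes> g [^] i = \<one>"
    using T(3) g seq_sum_union[OF o1 or]
    by (simp add: Teq zero_sum_def seq_sum_replicate)
  then have "seq_sum G T1 = inv (g [^] i)"
    using g o1 by (metis inv_equality nat_pow_closed seq_sum_closed)
  also have "inv (g [^] i) \<in> generate G {g}"
    using generate_pow[OF g] int_pow_neg[OF g, of "int i"]
    by (auto intro!: exI[of _ "- int i"] simp: int_pow_int)
  finally have s1_one: "seq_sum G T1 = \<one>" using s1 int by auto
  then have "zero_sum ?K T1" using seq_sum_subgroup[OF K T1K] by (simp add: zero_sum_def)
  then have "T1 = {#}" using free[OF T1] by simp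
  moreover have "ord g dvd i" using prod s1_one g pow_eq_id by simp
  then have "i = 0" using i og by (auto dest: dvd_imp_le)
  ultimately show False using Teq T(2) by simp
qed

end

text \<open>Splitting off a cyclic factor of order q raises the nilpotency index by at most q - 1
  and the Davenport constant by at least q - 1, so the bound survives induction on the
  order.\<close>

theorem aug_nilpotent_davenport:
  fixes G :: "('a, 'm) monoid_scheme"
  assumes "prime p" "comm_group G" "finite (carrier G)" "order G = p ^ k"
  shows "aug_nilpotent G p (davenport G)"
  using assms(2-)
proof (induction "order G" arbitrary: G k rule: less_induct)
  case less
  interpret comm_group G by fact
  show ?case
  proof (cases "carrier G = {\<one>\<^bsub>G\<^esub>}")
    case True
    then show ?thesis
      using aug_nilpotent_mono[OF aug_nilpotent_trivial] davenport_pos[OF less.prems(2)]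
      by (metis One_nat_def Suc_leI)
  next
    case False
    obtain g e K where g: "g \<in> carrier G" "ord g = p ^ e" and K: "subgroup K G"
      and int: "generate G {g} \<inter> K = {\<one>\<^bsub>G\<^esub>}" and gen: "generate G {g} <#>\<^bsub>G\<^esub> K = carrier G"
      and e: "0 < e"
      using p_group_cyclic_decomposition[OF assms(1) less.prems(3,2)] False by metis
    let ?K = "G\<lparr>carrier := K\<rparr>"
    interpret K: comm_group ?K using K by (rule comm_group_subgroup)
    have "g \<noteq> \<one>\<^bsub>G\<^esub>" 
      using g(2) one_less_power[OF prime_gt_1_nat[OF assms(1)] e] by auto
    then have "g \<notin> K" using int generate.incl[of g "{g}" G] by auto
    then have "K \<subset> carrier G" using g(1) subgroup.subset[OF K] by auto
    then have "order ?K < order G"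
      using psubset_card_mono[OF less.prems(2)] by (simp add: order_def)
    moreover have "finite (carrier ?K)"
      using finite_subset[OF subgroup.subset[OF K] less.prems(2)] by simp
    moreover have "\<exists>j. order ?K = p ^ j"
    proof -
      have "card K dvd p ^ k" using lagrange[OF K] less.prems(3) by (metis dvd_triv_right)
      then show ?thesis using divides_primepow_nat[OF assms(1)] by (auto simp: order_def)
    qed
    ultimately have IH: "aug_nilpotent ?K p (davenport ?K)"
      using less.hyps K.comm_group_axioms by blast
    have "aug_nilpotent G p (davenport ?K + p ^ e - 1)"
    proof (rule aug_nilpotent_cyclic_extension[OF assms(1) K.comm_group_axioms IH _ g(1)])
      show "(\<lambda>x. x) \<in> hom ?K G" using subgroup.subset[OF K] by (auto simp: hom_def)
      show "g [^]\<^bsub>G\<^esub> p ^ e = \<one>\<^bsub>G\<^esub>" using pow_ord_eq_1[OF g(1)] g(2) by simp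
      show "\<exists>a k. k \<in> carrier ?K \<and> x = g [^]\<^bsub>G\<^esub> (a::nat) \<otimes>\<^bsub>G\<^esub> k" if "x \<in> carrier G" for x
        using that generate_pow_on_finite_carrier[OF less.prems(2) g(1)]
        by (auto simp: gen[symmetric] set_mult_def)
    qed
    moreover have "davenport ?K + p ^ e - 1 \<le> davenport G"
      using davenport_cyclic_complement[OF less.prems(2) g(1) K int] g(2) by simp
    ultimately show ?thesis by (rule aug_nilpotent_mono)
  qed
qed

section \<open>Direct products with a cyclic group of prime power order\<close>

lemma comm_group_DirProd:
  assumes "comm_group G" "comm_group H" shows "comm_group (G \<times>\<times> H)"
proof -
  interpret G: comm_group G by fact
  interpret H: comm_group H by fact
  show ?thesis
    using DirProd_group[OF G.is_group H.is_group]
    by (intro group.group_comm_groupI) (auto simp: G.m_comm H.m_comm)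
qed

lemma DirProd_nat_pow: "(x, y) [^]\<^bsub>G \<times>\<times> H\<^esub> (n::nat) = (x [^]\<^bsub>G\<^esub> n, y [^]\<^bsub>H\<^esub> n)"
  unfolding nat_pow_def by (induction n) simp_all

lemma aug_nilpotent_cyclic_DirProd:
  assumes "prime p" "comm_group K" "aug_nilpotent K p N"
  shows "aug_nilpotent (integer_mod_group (p ^ e) \<times>\<times> K) p (N + p ^ e - 1)"
proof -
  let ?C = "integer_mod_group (p ^ e)"
  interpret K: comm_group K by fact
  interpret comm_group "?C \<times>\<times> K"
    by (intro comm_group_DirProd assms(2) abelian_integer_mod_group)
  have q: "0 < p ^ e" using assms(1) by (simp add: prime_gt_0_nat)
  have C: "carrier ?C = {0..<int (p ^ e)}"
    unfolding carrier_integer_mod_group using q by auto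
  show ?thesis
  \<comment> \<open>The generator is reduced explicitly because for e = 0 the carrier contains only
    0.\<close>
  proof (rule aug_nilpotent_cyclic_extension[OF assms(1-3), where \<iota> = "Pair 0" and g = "(1 mod int (p ^ e), \<one>\<^bsub>K\<^esub>)"])
    show "Pair 0 \<in> hom K (?C \<times>\<times> K)" by (auto simp: hom_def)
    show "(1 mod int (p ^ e), \<one>\<^bsub>K\<^esub>) \<in> carrier (?C \<times>\<times> K)" using q C by simp
    show "(1 mod int (p ^ e), \<one>\<^bsub>K\<^esub>) [^]\<^bsub>?C \<times>\<times> K\<^esub> p ^ e = \<one>\<^bsub>?C \<times>\<times> K\<^esub>"
      by (simp add: DirProd_nat_pow)
    show "\<exists>a k. k \<in> carrier K \<and> x = (1 mod int (p ^ e), \<one>\<^bsub>K\<^esub>) [^]\<^bsub>?C \<times>\<times> K\<^esub> (a::nat) \<otimes>\<^bsub>?C \<times>\<times> K\<^esub> (0, k)"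
      if "x \<in> carrier (?C \<times>\<times> K)" for x
      using that C q
      by (intro exI[of _ "nat (fst x)"] exI[of _ "snd x"])
        (auto simp: DirProd_nat_pow mod_mult_right_eq)
  qed
qed

section \<open>Elementary abelian groups\<close>

lemma carrier_cyclic_power: "0 < n \<Longrightarrow> carrier (cyclic_power n r) = ({..<r} \<rightarrow>\<^sub>E {0..<int n})"
  by (simp add: cyclic_power_def carrier_integer_mod_group)

lemma one_cyclic_power: "\<one>\<^bsub>cyclic_power n r\<^esub> = (\<lambda>i\<in>{..<r}. 0)"
  by (simp add: cyclic_power_def)

lemma mult_cyclic_power: "x \<otimes>\<^bsub>cyclic_power n r\<^esub> y = (\<lambda>i\<in>{..<r}. (x i + y i) mod int n)"
  by (simp add: cyclic_power_def)

lemma comm_group_cyclic_power: "comm_group (cyclic_power n r)"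
proof (rule group.group_comm_groupI)
  show "group (cyclic_power n r)" unfolding cyclic_power_def by (rule product_group) simp
  show "x \<otimes>\<^bsub>cyclic_power n r\<^esub> y = y \<otimes>\<^bsub>cyclic_power n r\<^esub> x" for x y
    unfolding mult_cyclic_power by (rule ext) (simp add: add.commute)
qed

lemma finite_cyclic_power: "0 < n \<Longrightarrow> finite (carrier (cyclic_power n r))"
  by (simp add: carrier_cyclic_power finite_PiE)

lemma cyclic_power_nat_pow:
  assumes "x \<in> carrier (cyclic_power n r)" "0 < n"
  shows "x [^]\<^bsub>cyclic_power n r\<^esub> (k::nat) = (\<lambda>i\<in>{..<r}. (int k * x i) mod int n)"
proof (induction k)
  case 0
  then show ?case by (simp add: one_cyclic_power)
next
  case (Suc k)
  interpret comm_group "cyclic_power n r" by (rule comm_group_cyclic_power)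
  show ?case
    by (simp add: Suc mult_cyclic_power mod_simps algebra_simps cong: restrict_cong)
qed

lemma aug_nilpotent_cyclic_power:
  assumes "prime p" shows "aug_nilpotent (cyclic_power p r) p (r * (p - 1) + 1)"
proof (induction r)
  case 0
  interpret comm_group "cyclic_power p 0" by (rule comm_group_cyclic_power)
  show ?case
    using aug_nilpotent_trivial[of p]
    by (simp add: one_cyclic_power carrier_cyclic_power prime_gt_0_nat[OF assms] restrict_def)
next
  case (Suc r)
  interpret comm_group "cyclic_power p (Suc r)" by (rule comm_group_cyclic_power)
  have p: "1 < p" using assms by (rule prime_gt_1_nat)
  let ?g = "\<lambda>i\<in>{..<Suc r}. if i = r then 1 else 0 :: int"
  have g: "?g \<in> carrier (cyclic_power p (Suc r))"
    using p by (auto simp: carrier_cyclic_power)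
  have "aug_nilpotent (cyclic_power p (Suc r)) p (r * (p - 1) + 1 + p ^ 1 - 1)"
  \<comment> \<open>Group elements are \<open>undefined\<close> outside their index set, so the
    embedding has to set the new coordinate to 0.\<close>
  proof (rule aug_nilpotent_cyclic_extension[OF assms comm_group_cyclic_power Suc _ g,
        where \<iota> = "\<lambda>x. x(r := 0)"])
    show "(\<lambda>x. x(r := 0)) \<in> hom (cyclic_power p r) (cyclic_power p (Suc r))"
    proof (rule homI)
      show "x(r := 0) \<in> carrier (cyclic_power p (Suc r))" if "x \<in> carrier (cyclic_power p r)" for x
        using that p by (auto simp: carrier_cyclic_power PiE_iff extensional_def less_Suc_eq)
      show "(x \<otimes>\<^bsub>cyclic_power p r\<^esub> y)(r := 0) = x(r := 0) \<otimes>\<^bsub>cyclic_power p (Suc r)\<^esub> y(r := 0)" for x y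
        by (rule ext) (simp add: mult_cyclic_power restrict_def)
    qed
    show "?g [^]\<^bsub>cyclic_power p (Suc r)\<^esub> p ^ 1 = \<one>\<^bsub>cyclic_power p (Suc r)\<^esub>"
      using p g by (auto simp: cyclic_power_nat_pow one_cyclic_power fun_eq_iff)
    show "\<exists>a k. k \<in> carrier (cyclic_power p r) \<and>
        x = ?g [^]\<^bsub>cyclic_power p (Suc r)\<^esub> (a::nat) \<otimes>\<^bsub>cyclic_power p (Suc r)\<^esub> k(r := 0)"
      if "x \<in> carrier (cyclic_power p (Suc r))" for x
    proof (intro exI conjI)
      have x: "x \<in> {..<Suc r} \<rightarrow>\<^sub>E {0..<int p}" using that p carrier_cyclic_power by simp
      then have "restrict x {..<r} \<in> {..<r} \<rightarrow>\<^sub>E {0..<int p}"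
        by (simp add: PiE_iff)
      then show "restrict x {..<r} \<in> carrier (cyclic_power p r)"
        using p carrier_cyclic_power by simp
      have "x i mod int p = x i" "0 \<le> x i" if "i < Suc r" for i
        using PiE_mem[OF x, of i] that by auto
      moreover have "x i = undefined" if "\<not> i < Suc r" for i
        using PiE_arb[OF x, of i] that by auto
      ultimately show "x = ?g [^]\<^bsub>cyclic_power p (Suc r)\<^esub> (nat (x r))
          \<otimes>\<^bsub>cyclic_power p (Suc r)\<^esub> (restrict x {..<r})(r := 0)"
        unfolding cyclic_power_nat_pow[OF g less_trans[OF zero_less_one p]] mult_cyclic_power
        by (intro ext) (simp add: less_Suc_eq)
    qed
  qed
  moreover have "r * (p - 1) + 1 + p ^ 1 - 1 = Suc r * (p - 1) + 1"
    using p by (cases p) auto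
  ultimately show ?case by metis
qed

lemma seq_sum_cyclic_power:
  assumes "0 < n"
  shows "seq_sum (cyclic_power n r) (image_mset (\<lambda>x. \<lambda>i\<in>{..<r}. f i x mod int n) M)
    = (\<lambda>i\<in>{..<r}. (\<Sum>x\<in>#M. f i x) mod int n)"
proof -
  interpret comm_group "cyclic_power n r" by (rule comm_group_cyclic_power)
  show ?thesis
  proof (induction M)
    case empty
    show ?case by (simp add: one_cyclic_power)
  next
    case (add x M)
    have "seq_over (cyclic_power n r) (image_mset (\<lambda>x. \<lambda>i\<in>{..<r}. f i x mod int n) (add_mset x M))"
      using assms by (auto simp: seq_over_def carrier_cyclic_power split: if_splits)
    then have "seq_sum (cyclic_power n r) (image_mset (\<lambda>x. \<lambda>i\<in>{..<r}. f i x mod int n) (add_mset x M))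
      = (\<lambda>i\<in>{..<r}. f i x mod int n) \<otimes>\<^bsub>cyclic_power n r\<^esub> (\<lambda>i\<in>{..<r}. (\<Sum>x\<in>#M. f i x) mod int n)"
      unfolding add.IH[symmetric] image_mset_add_mset
      by (intro seq_sum_add_mset) (auto simp: seq_over_def)
    also have "\<dots> = (\<lambda>i\<in>{..<r}. (\<Sum>x\<in>#add_mset x M. f i x) mod int n)"
      by (auto simp: mult_cyclic_power fun_eq_iff mod_simps)
    finally show ?case .
  qed
qed

text \<open>The Davenport bound for C_p^r in arithmetic form: each \<open>f i\<close> serves as one
  coordinate, so conditions on weights and on sums can be imposed together.\<close>

lemma prime_dvd_sums_submultiset:
  fixes f :: "nat \<Rightarrow> 'x \<Rightarrow> int"
  assumes "prime p" "r * (p - 1) + 1 \<le> size M"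
  obtains T where "T \<subseteq># M" "T \<noteq> {#}" "\<forall>i<r. int p dvd (\<Sum>x\<in>#T. f i x)"
proof -
  let ?G = "cyclic_power p r" and ?\<phi> = "\<lambda>x. \<lambda>i\<in>{..<r}. f i x mod int p"
  interpret comm_group ?G by (rule comm_group_cyclic_power)
  have p: "0 < p" "1 < p" using prime_gt_0_nat prime_gt_1_nat assms(1) by blast+
  have "seq_over ?G (image_mset ?\<phi> M)"
    using p by (auto simp: seq_over_def carrier_cyclic_power split: if_splits)
  then obtain U where U: "U \<subseteq># image_mset ?\<phi> M" "U \<noteq> {#}" "zero_sum ?G U"
    using aug_nilpotent_zero_sum[OF p(2) aug_nilpotent_cyclic_power[OF assms(1)]] assms(2) by force
  then obtain T where T: "T \<subseteq># M" "U = image_mset ?\<phi> T"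
    by (metis subset_image_mset_preimage)
  have "int p dvd (\<Sum>x\<in>#T. f i x)" if "i < r" for i
  proof -
    have "(\<lambda>i\<in>{..<r}. (\<Sum>x\<in>#T. f i x) mod int p) = (\<lambda>i\<in>{..<r}. 0)"
      using U(3) seq_sum_cyclic_power[OF p(1), of r f T] unfolding T(2) zero_sum_def
      by (simp add: one_cyclic_power)
    from fun_cong[OF this, of i] that show ?thesis by (simp add: mod_eq_0_iff_dvd)
  qed
  then show ?thesis using that T U(2) by auto
qed

section \<open>Reduction along a homomorphism with small kernel\<close>

lemma submultiset_of_size:
  assumes "k \<le> size M" obtains T where "T \<subseteq># M" "size T = k"
proof -
  obtain xs where xs: "mset xs = M" using ex_mset by blast
  then have "mset (take k xs) \<subseteq># M"
    by (metis append_take_drop_id mset_append mset_subset_eq_add_left)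
  moreover have "size (mset (take k xs)) = k" using assms xs by auto
  ultimately show ?thesis using that by blast
qed

text \<open>The length bound \<open>e\<close> is a parameter, so that the exponent of the image
  group need not be computed.\<close>

definition short_beyond_double :: "('a, 'm) monoid_scheme \<Rightarrow> nat \<Rightarrow> bool" where
  "short_beyond_double G e \<longleftrightarrow> (\<forall>S. seq_over G S \<and> zero_sum G S \<and> 2 * e + 1 \<le> size S \<longrightarrow>
     (\<exists>T. T \<subseteq># S \<and> T \<noteq> {#} \<and> zero_sum G T \<and> size T \<le> e))"

text \<open>Each extraction costs at most \<open>e\<close> terms and keeps the image zero-sum, so
  the last of the \<open>w\<close> extractions still finds 2 e + 1 terms.\<close>

lemma (in comm_group) extract_short_kernel_blocks:
  assumes K: "comm_group K" "\<phi> \<in> hom G K" "short_beyond_double K e"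
    and S: "seq_over G S" "\<phi> (seq_sum G S) = \<one>\<^bsub>K\<^esub>" "(w + 1) * e + 1 \<le> size S"
  shows "\<exists>Ts. length Ts = w \<and> sum_list Ts \<subseteq># S \<and>
    (\<forall>T\<in>set Ts. T \<noteq> {#} \<and> size T \<le> e \<and> \<phi> (seq_sum G T) = \<one>\<^bsub>K\<^esub>)"
  using S
proof (induction w arbitrary: S)
  case 0
  then show ?case by (intro exI[of _ "[]"]) simp
next
  case (Suc w)
  interpret K: comm_group K by fact
  have "seq_over K (image_mset \<phi> S)"
    using Suc.prems(1) K(2) by (auto simp: seq_over_def hom_def)
  moreover have "zero_sum K (image_mset \<phi> S)"
    using Suc.prems(2) by (simp add: zero_sum_def seq_sum_image_hom[OF K(1,2) Suc.prems(1)])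
  moreover have "2 * e + 1 \<le> size (image_mset \<phi> S)"
    using Suc.prems(3) by simp
  ultimately obtain U where U: "U \<subseteq># image_mset \<phi> S" "U \<noteq> {#}" "zero_sum K U" "size U \<le> e"
    using K(3) unfolding short_beyond_double_def by blast
  obtain T where T: "T \<subseteq># S" "U = image_mset \<phi> T"
    using U(1) by (rule subset_image_mset_preimage)
  have o: "seq_over G T" "seq_over G (S - T)"
    using Suc.prems(1) T(1) by (auto simp: seq_over_def dest: mset_subset_eqD in_diffD)
  have \<phi>T: "\<phi> (seq_sum G T) = \<one>\<^bsub>K\<^esub>"
    using U(3) T(2) o(1) by (simp add: zero_sum_def seq_sum_image_hom[OF K(1,2)])
  have "\<phi> (seq_sum G (S - T)) \<in> carrier K"
    using o(2) K(2) by (auto simp: hom_def seq_sum_closed)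
  moreover have "\<phi> (seq_sum G S) = \<phi> (seq_sum G T) \<otimes>\<^bsub>K\<^esub> \<phi> (seq_sum G (S - T))"
    using seq_sum_union[OF o] T(1) o by (simp add: hom_mult[OF K(2)] seq_sum_closed)
  ultimately have \<phi>ST: "\<phi> (seq_sum G (S - T)) = \<one>\<^bsub>K\<^esub>"
    using Suc.prems(2) \<phi>T by simp
  have "(w + 1) * e + 1 \<le> size (S - T)"
    using Suc.prems(3) U(4) T size_Diff_submset[OF T(1)] by simp
  from Suc.IH[OF o(2) \<phi>ST this] obtain Ts where
    Ts: "length Ts = w" "sum_list Ts \<subseteq># S - T"
      "\<And>T. T \<in> set Ts \<Longrightarrow> T \<noteq> {#} \<and> size T \<le> e \<and> \<phi> (seq_sum G T) = \<one>\<^bsub>K\<^esub>"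
    by blast
  have "T + sum_list Ts \<subseteq># S"
    using Ts(2) T(1) by (metis subset_mset.add_diff_inverse subset_mset.add_left_mono)
  then show ?case
    using Ts U T \<phi>T by (intro exI[of _ "T # Ts"]) auto
qed

context comm_group
begin

lemma seq_sum_sum_list:
  assumes "\<And>T. T \<in> set Ts \<Longrightarrow> seq_over G T"
  shows "seq_sum G (sum_list Ts) = seq_sum G (mset (map (seq_sum G) Ts)) \<and> seq_over G (sum_list Ts)"
  using assms
proof (induction Ts)
  case (Cons T Ts)
  have o: "seq_over G (mset (map (seq_sum G) Ts))"
    using Cons.prems by (auto simp: seq_over_def intro!: seq_sum_closed[unfolded seq_over_def])
  show ?case
    using Cons o
    by (auto simp: seq_sum_union seq_sum_add_mset seq_sum_closed) (auto simp: seq_over_def)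
qed (auto simp: seq_over_def)

lemma short_zero_sum_of_kernel_bound:
  assumes fin: "finite (carrier G)" and K: "comm_group K" "\<phi> \<in> hom G K" "short_beyond_double K e"
    and ker: "card (kernel G K \<phi>) \<le> m" and m: "0 < m" "m * e \<le> group_exp G"
    and S: "seq_over G S" "zero_sum G S" "davenport G < size S"
  shows "\<exists>T. T \<subseteq># S \<and> short_zero_sum G T"
proof (cases "size S \<le> 2 * group_exp G + 1")
  case True
  obtain T where "T \<subseteq># S" "T \<noteq> {#}" "zero_sum G T" "size T \<le> group_exp G"
    using zero_sum_split_short[OF fin S True] .
  then show ?thesis
    by (intro exI[of _ T]) (simp add: short_zero_sum_def Suc_le_eq nonempty_has_size[symmetric])
next
  case False
  interpret K: comm_group K by fact
  interpret \<phi>: group_hom G K \<phi> using K(2) by unfold_locales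
  \<comment> \<open>The two ranges of lengths meet here: beyond 2 exp(G) + 1 there are enough terms
    for \<open>m\<close> blocks, and any selection of these has at most m e \<le> exp(G)
    terms.\<close>
  have "(m + 1) * e \<le> 2 * (m * e)" using m(1) by (cases m) auto
  then have "(m + 1) * e + 1 \<le> size S" using False m(2) by linarith
  moreover have "\<phi> (seq_sum G S) = \<one>\<^bsub>K\<^esub>" using S(2) by (simp add: zero_sum_def)
  ultimately obtain Ts where Ts: "length Ts = m" "sum_list Ts \<subseteq># S"
    "\<And>T. T \<in> set Ts \<Longrightarrow> T \<noteq> {#} \<and> size T \<le> e \<and> \<phi> (seq_sum G T) = \<one>\<^bsub>K\<^esub>"
    using extract_short_kernel_blocks[OF K S(1)] by metis
  have sub: "T \<subseteq># sum_list Ts" if "T \<in> set Ts" for T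
    using that by (induction Ts) (auto intro: subset_mset.order_trans)
  have oTs: "seq_over G T" if "T \<in> set Ts" for T
    using mset_subset_eqD[OF subset_mset.order_trans[OF sub[OF that] Ts(2)]] S(1)
    by (auto simp: seq_over_def)
  let ?xs = "map (seq_sum G) Ts"
  have "set ?xs \<subseteq> kernel G K \<phi>"
    using Ts(3) oTs by (auto simp: kernel_def seq_sum_closed)
  moreover have "finite (kernel G K \<phi>)"
    using fin by (simp add: kernel_def)
  ultimately obtain i j where ij: "i < j" "j \<le> m" "zero_sum G (mset (drop i (take j ?xs)))"
    using zero_sum_consecutive_pigeonhole[OF \<phi>.subgroup_kernel, of ?xs] ker Ts(1) by auto
  let ?Us = "drop i (take j Ts)"
  have Us: "set ?Us \<subseteq> set Ts" by (auto dest!: in_set_takeD in_set_dropD)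
  have "Ts = take i Ts @ ?Us @ drop j Ts"
    using ij(1) by (metis append_assoc append_take_drop_id less_imp_le_nat min.absorb1 take_take)
  then have "sum_list Ts = sum_list (take i Ts) + (sum_list ?Us + sum_list (drop j Ts))"
    by (metis sum_list_append)
  then have "sum_list ?Us \<subseteq># S"
    using Ts(2) by (metis mset_subset_eq_add_left mset_subset_eq_add_right subset_mset.order_trans)
  moreover have "zero_sum G (sum_list ?Us)"
    using seq_sum_sum_list[of ?Us] oTs Us ij(3)
    by (simp add: zero_sum_def drop_map take_map subset_iff)
  moreover have "size (sum_list Us) \<le> length Us * e" if "set Us \<subseteq> set Ts" for Us
    using that by (induction Us) (use Ts(3) in \<open>auto intro: add_mono\<close>)
  then have "size (sum_list ?Us) \<le> length ?Us * e" using Us by blast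
  moreover have "length ?Us * e \<le> group_exp G"
  proof -
    have "length ?Us \<le> m" using ij(2) Ts(1) by simp
    then show ?thesis using m(2) by (meson le_trans mult_le_mono1)
  qed
  moreover have "sum_list ?Us \<noteq> {#}"
  proof -
    have "?Us \<noteq> []" using ij Ts(1) by simp
    then obtain U Us' where U: "?Us = U # Us'" by (cases ?Us) auto
    then have "U \<noteq> {#}" using Us Ts(3) by auto
    then show ?thesis using U by simp
  qed
  ultimately show ?thesis
    by (intro exI[of _ "sum_list ?Us"])
      (simp add: short_zero_sum_def Suc_le_eq nonempty_has_size[symmetric])
qed

lemma C0_eq_of_kernel_bound:
  assumes "finite (carrier G)" "comm_group K" "\<phi> \<in> hom G K" "short_beyond_double K e"
    "card (kernel G K \<phi>) \<le> m" "0 < m" "m * e \<le> group_exp G"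
  shows "C0 G = {int (davenport G) + 1..int (eta G) - 1}"
  unfolding C0_def using short_zero_sum_of_kernel_bound[OF assms] by auto

lemma group_exp_ge:
  assumes fin: "finite (carrier G)" and x: "x \<in> carrier G" "\<And>n. 0 < n \<Longrightarrow> x [^] n = \<one> \<Longrightarrow> N \<le> n"
  shows "N \<le> group_exp G"
proof -
  have "0 < order G \<and> (\<forall>x\<in>carrier G. x [^] order G = \<one>)"
    using fin pow_order_eq_1 by (simp add: order_gt_0_iff_finite)
  then have "0 < group_exp G \<and> (\<forall>x\<in>carrier G. x [^] group_exp G = \<one>)"
    unfolding group_exp_def by (rule LeastI)
  then show ?thesis using x by blast
qed

end

lemma C0_eq_of_iso_cyclic_DirProd:
  assumes G: "comm_group G" "finite (carrier G)" and H: "comm_group H"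
    and iso: "G \<cong> integer_mod_group (m * e) \<times>\<times> H" and pos: "0 < m" "0 < e"
    and short: "short_beyond_double (integer_mod_group e \<times>\<times> H) e"
  shows "C0 G = {int (davenport G) + 1..int (eta G) - 1}"
proof -
  let ?X = "integer_mod_group (m * e) \<times>\<times> H" and ?K = "integer_mod_group e \<times>\<times> H"
  interpret G: comm_group G by fact
  interpret H: comm_group H by fact
  interpret X: comm_group ?X by (intro comm_group_DirProd H abelian_integer_mod_group)
  obtain \<psi> where \<psi>: "\<psi> \<in> hom G ?X" "bij_betw \<psi> (carrier G) (carrier ?X)"
    using iso by (auto simp: is_iso_def iso_def)
  have N: "0 < m * e" using pos by simp
  then have car: "carrier (integer_mod_group (m * e)) = {0..<int (m * e)}"
    "carrier (integer_mod_group e) = {0..<int e}"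
    using pos by (auto simp: carrier_integer_mod_group)
  \<comment> \<open>The kernel of this reduction consists of the \<open>m\<close> multiples of
    \<open>e\<close> below m e, paired with the identity of \<open>H\<close>.\<close>
  let ?\<rho> = "\<lambda>(a, h). (a mod int e, h)"
  have \<rho>: "?\<rho> \<in> hom ?X ?K"
    using pos car by (auto simp: hom_def mod_simps mod_mod_cancel)
  have hom: "?\<rho> \<circ> \<psi> \<in> hom G ?K" using \<psi>(1) \<rho> by (rule hom_compose)
  let ?ker = "kernel G ?K (?\<rho> \<circ> \<psi>)"
  have "\<psi> ` ?ker \<subseteq> (\<lambda>k. (int k * int e, \<one>\<^bsub>H\<^esub>)) ` {..<m}"
  proof
    fix y assume "y \<in> \<psi> ` ?ker"
    then obtain x where x: "x \<in> carrier G" "y = \<psi> x" "?\<rho> (\<psi> x) = \<one>\<^bsub>?K\<^esub>"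
      by (auto simp: kernel_def)
    obtain a h where ah: "\<psi> x = (a, h)" by fastforce
    have "\<psi> x \<in> carrier ?X" using \<psi>(1) x(1) by (auto simp: hom_def)
    then have a: "0 \<le> a" "a < int (m * e)" "a mod int e = 0" "h = \<one>\<^bsub>H\<^esub>"
      using x(3) ah car by auto
    then obtain c where c: "a = int e * c" by (auto simp: mod_eq_0_iff_dvd)
    have "0 \<le> c" using a(1) c pos by (simp add: zero_le_mult_iff)
    moreover have "c < int m" using a(2) c pos by (simp add: mult.commute)
    ultimately show "y \<in> (\<lambda>k. (int k * int e, \<one>\<^bsub>H\<^esub>)) ` {..<m}"
      using c x(2) ah a(4) by (intro image_eqI[of _ _ "nat c"]) auto
  qed
  then have "card (\<psi> ` ?ker) \<le> card {..<m}" by (rule surj_card_le[OF finite_lessThan])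
  moreover have "inj_on \<psi> ?ker"
    using \<psi>(2) by (auto simp: bij_betw_def kernel_def intro: inj_on_subset)
  ultimately have ker: "card ?ker \<le> m" by (simp add: card_image)
  \<comment> \<open>The generator of the cyclic factor has order m e, which bounds the exponent of
    \<open>G\<close> from below.\<close>
  have one: "(1 mod int (m * e), \<one>\<^bsub>H\<^esub>) \<in> carrier ?X" using N car by simp
  then obtain x where x: "x \<in> carrier G" "\<psi> x = (1 mod int (m * e), \<one>\<^bsub>H\<^esub>)"
    using \<psi>(2) by (metis (no_types, lifting) bij_betw_imp_surj_on imageE)
  have "m * e \<le> n" if n: "0 < n" "x [^]\<^bsub>G\<^esub> n = \<one>\<^bsub>G\<^esub>" for n :: nat
  proof -
    interpret \<psi>: group_hom G ?X \<psi> using \<psi>(1) by unfold_locales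
    have "\<psi> x [^]\<^bsub>?X\<^esub> n = \<one>\<^bsub>?X\<^esub>" using \<psi>.hom_nat_pow[OF x(1), of n] n(2) by simp
    then have "int n mod int (m * e) = 0"
      using x(2) by (simp add: DirProd_nat_pow mod_simps)
    then have "m * e dvd n" by (metis mod_eq_0_iff_dvd of_nat_dvd_iff)
    then show ?thesis using n(1) by (rule dvd_imp_le)
  qed
  then have "m * e \<le> group_exp G" using G.group_exp_ge[OF G(2) x(1)] by blast
  then show ?thesis
    using G.C0_eq_of_kernel_bound[OF G(2) _ hom short ker pos(1)]
      comm_group_DirProd[OF abelian_integer_mod_group H] by blast
qed

section \<open>Groups \<open>C\<^bsub>q\<^esub> \<oplus> H\<close> with a p-group \<open>H\<close> of small Davenport constant\<close>

lemma seq_sum_DirProd: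
  assumes "comm_group G" "comm_group H" "seq_over (G \<times>\<times> H) S"
  shows "seq_sum (G \<times>\<times> H) S = (seq_sum G (image_mset fst S), seq_sum H (image_mset snd S))"
proof -
  interpret X: comm_group "G \<times>\<times> H" using assms(1,2) by (rule comm_group_DirProd)
  have "fst \<in> hom (G \<times>\<times> H) G" "snd \<in> hom (G \<times>\<times> H) H" by (auto simp: hom_def)
  then show ?thesis
    using X.seq_sum_image_hom[OF assms(1) _ assms(3)] X.seq_sum_image_hom[OF assms(2) _ assms(3)]
    by (simp add: prod_eq_iff)
qed

lemma seq_sum_integer_mod_group:
  assumes "0 < n" "seq_over (integer_mod_group n) S"
  shows "seq_sum (integer_mod_group n) S = \<Sum>\<^sub># S mod int n"
proof -
  interpret comm_group "integer_mod_group n" by (rule abelian_integer_mod_group)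
  show ?thesis using assms(2)
    by (induction S) (auto simp: seq_over_def seq_sum_add_mset mod_simps)
qed

text \<open>The auxiliary coordinate \<open>1\<close> in \<open>C\<^bsub>q\<^esub>\<close> controls the length of the zero-sum subsequence; up to
  \<open>k\<close> of its terms are padding zeros.\<close>

lemma padded_zero_sum:
  assumes p: "prime p" and G: "comm_group G" "aug_nilpotent G p N"
    and S: "seq_over G S" "N + p ^ e - 1 \<le> size S + k"
  obtains T j where "T \<subseteq># S" "j \<le> k" "0 < size T + j" "zero_sum G T" "p ^ e dvd size T + j"
proof -
  let ?q = "p ^ e" and ?C = "integer_mod_group (p ^ e)"
  let ?X = "?C \<times>\<times> G"
  have q: "0 < ?q" using p by (simp add: prime_gt_0_nat)
  have one: "1 mod int ?q \<in> carrier ?C" unfolding carrier_integer_mod_group using q by auto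
  interpret G: comm_group G by fact
  interpret X: comm_group ?X by (intro comm_group_DirProd G abelian_integer_mod_group)
  let ?\<iota> = "Pair (1 mod int ?q)"
  have "seq_over ?X (image_mset ?\<iota> (S + replicate_mset k \<one>\<^bsub>G\<^esub>))"
    using S(1) one by (auto simp: seq_over_def)
  moreover have "N + ?q - 1 \<le> size (image_mset ?\<iota> (S + replicate_mset k \<one>\<^bsub>G\<^esub>))" using S(2) by simp
  ultimately obtain U where U: "U \<subseteq># image_mset ?\<iota> (S + replicate_mset k \<one>\<^bsub>G\<^esub>)"
      "U \<noteq> {#}" "zero_sum ?X U"
    using X.aug_nilpotent_zero_sum[OF prime_gt_1_nat[OF p] aug_nilpotent_cyclic_DirProd[OF p G]]
    by blast
  obtain T' where T': "T' \<subseteq># S + replicate_mset k \<one>\<^bsub>G\<^esub>" "U = image_mset ?\<iota> T'"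
    using U(1) by (rule subset_image_mset_preimage)
  obtain T j where T: "T \<subseteq># S" "j \<le> k" "T' = T + replicate_mset j \<one>\<^bsub>G\<^esub>"
    using T'(1) by (rule mset_subset_replicate_split)
  have o: "seq_over G T" "seq_over G (replicate_mset j \<one>\<^bsub>G\<^esub>)"
    using S(1) T(1) by (auto simp: seq_over_def dest: mset_subset_eqD)
  have oU: "seq_over ?X U" using o one by (auto simp: seq_over_def T' T)
  then have oC: "seq_over ?C (image_mset fst U)" by (auto simp: seq_over_def)
  have "seq_sum ?C (image_mset fst U) = 0" "seq_sum G (image_mset snd U) = \<one>\<^bsub>G\<^esub>"
    using U(3) seq_sum_DirProd[OF abelian_integer_mod_group G(1) oU] by (auto simp: zero_sum_def)
  moreover have "image_mset fst U = replicate_mset (size T + j) (1 mod int ?q)"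
    by (simp add: T' T multiset.map_comp comp_def image_mset_const_eq multiset_eq_iff)
  moreover have "image_mset snd U = T + replicate_mset j \<one>\<^bsub>G\<^esub>"
    by (simp add: T' T multiset.map_comp comp_def)
  ultimately have *: "int (size T + j) * (1 mod int ?q) mod int ?q = 0" "seq_sum G T = \<one>\<^bsub>G\<^esub>"
    using seq_sum_integer_mod_group[OF q oC] G.seq_sum_union[OF o] o
    by (auto simp: G.seq_sum_replicate G.seq_sum_closed)
  have "int ?q dvd int (size T + j)" using *(1) by (simp add: mod_simps mod_eq_0_iff_dvd)
  then have "?q dvd size T + j" by (simp only: of_nat_dvd_iff)
  moreover have "0 < size T + j" using U(2) T' T by (auto simp: nonempty_has_size[symmetric])
  ultimately show ?thesis using that[of T j] T *(2) by (simp add: zero_sum_def)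
qed

lemma multiple_below_triple:
  assumes "q dvd (s::nat)" "0 < s" "s < 3 * q" shows "s = q \<or> s = 2 * q"
proof -
  obtain c where c: "s = q * c" using assms(1) by auto
  then have "0 < c" "c < 3" using assms by auto
  then have "c = 1 \<or> c = 2" by auto
  then show ?thesis using c by auto
qed

text \<open>An extra coordinate in C_q forces the length of a zero-sum subsequence to be q or 2 q.
  Length 2 q is repaired in one of two ways: a long \<open>S\<close> allows splitting, because 2 q
  exceeds the Davenport constant, and in a short \<open>S\<close> the complement is short
  enough.\<close>

lemma short_beyond_double_p_group:
  assumes p: "prime p" and H: "comm_group H" "finite_p_group p H" and D: "davenport H \<le> p ^ e"
  shows "short_beyond_double (integer_mod_group (p ^ e) \<times>\<times> H) (p ^ e)"
  unfolding short_beyond_double_def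
proof (intro allI impI, elim conjE)
  let ?q = "p ^ e" let ?G = "integer_mod_group ?q \<times>\<times> H" let ?N = "davenport H"
  fix S assume S: "seq_over ?G S" "zero_sum ?G S" "2 * ?q + 1 \<le> size S"
  have G: "comm_group ?G" by (intro comm_group_DirProd H abelian_integer_mod_group)
  interpret G: comm_group ?G by fact
  interpret H: comm_group H by fact
  have q: "0 < ?q" using p by (simp add: prime_gt_0_nat)
  have finH: "finite (carrier H)" using H(2) by (simp add: finite_p_group_def)
  have N: "0 < ?N" using H.davenport_pos[OF finH] .
  have finG: "finite (carrier ?G)"
    using finH q by (auto simp: carrier_integer_mod_group)
  have "aug_nilpotent H p ?N"
    using aug_nilpotent_davenport[OF p H(1) finH] H(2) by (auto simp: finite_p_group_def)
  then have nil: "aug_nilpotent ?G p (?N + ?q - 1)"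
    by (rule aug_nilpotent_cyclic_DirProd[OF p H(1)])
  have DG: "davenport ?G < 2 * ?q"
    using G.davenport_le_aug_nilpotent[OF prime_gt_1_nat[OF p] nil] D q by linarith
  \<comment> \<open>The nilpotency index of the group with one more factor C_q for the length; it is
    at most 3 q - 2 because D(H) \<le> q.\<close>
  let ?M = "?N + ?q - 1 + ?q - 1"
  show "\<exists>T. T \<subseteq># S \<and> T \<noteq> {#} \<and> zero_sum ?G T \<and> size T \<le> ?q"
  proof (cases "?M \<le> size S")
    case True
    obtain S' where S': "S' \<subseteq># S" "size S' = ?M" using submultiset_of_size[OF True] .
    have oS': "seq_over ?G S'" using S(1) S'(1) by (auto simp: seq_over_def dest: mset_subset_eqD)
    obtain T j where T: "T \<subseteq># S'" "j \<le> 0" "0 < size T + j" "zero_sum ?G T" "?q dvd size T + j"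
      using padded_zero_sum[OF p G nil oS', of e 0] S'(2) by auto
    have TS: "T \<subseteq># S" using T(1) S'(1) by (rule subset_mset.order_trans)
    have "size T \<le> ?M" using size_mset_mono[OF T(1)] S'(2) by simp
    then have "size T = ?q \<or> size T = 2 * ?q"
      using T(2,3,5) D q N by (intro multiple_below_triple) auto
    then show ?thesis
    proof
      assume "size T = ?q"
      then show ?thesis using TS T by (intro exI[of _ T]) auto
    next
      assume sz: "size T = 2 * ?q"
      have "seq_over ?G T" using T(1) oS' by (auto simp: seq_over_def dest: mset_subset_eqD)
      then obtain T' where "T' \<subseteq># T" "T' \<noteq> {#}" "zero_sum ?G T'" "size T' \<le> ?q"
        using G.zero_sum_split_short[OF finG, of T ?q] T(4) DG sz by auto
      then show ?thesis using TS subset_mset.order_trans by blast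
    qed
  next
    case False
    define k where "k = ?M - size S"
    \<comment> \<open>Fewer than q padding terms cannot form a subsequence of length q on their
      own.\<close>
    have k: "size S + k = ?M" "k < ?q" using False S(3) D N by (auto simp: k_def)
    obtain T j where T: "T \<subseteq># S" "j \<le> k" "0 < size T + j" "zero_sum ?G T" "?q dvd size T + j"
      using padded_zero_sum[OF p G nil S(1), of e k] k(1) by auto
    have sz: "size S = size T + size (S - T)" using T(1)
      by (metis size_union subset_mset.add_diff_inverse)
    have "size T + j = ?q \<or> size T + j = 2 * ?q"
      using T(2,3,5) k(1) sz D q N by (intro multiple_below_triple) auto
    then show ?thesis
    proof
      assume "size T + j = ?q"
      then show ?thesis using T k(2) by (intro exI[of _ T]) auto
    next
      assume sum: "size T + j = 2 * ?q"
      have "zero_sum ?G (S - T)" using G.seq_sum_diff_zero_sum S(1,2) T by blast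
      moreover have "0 < size (S - T)" using sum sz S(3) by simp
      \<comment> \<open>The complement has at most ?M - 2 q = D(H) - 2 terms; it is nonempty since
        \<open>S\<close> has more than 2 q.\<close>
      moreover have "size (S - T) \<le> ?q" using sum sz k(1) T(2) D by simp
      ultimately show ?thesis by (intro exI[of _ "S - T"]) auto
    qed
  qed
qed

section \<open>Rank two\<close>

text \<open>An item \<open>(w, a, b)\<close> is a block of \<open>w\<close> units of length with sum \<open>(a, b)\<close>. The leftover of a
  decomposition modulo a prime becomes the single item of weight 2.\<close>

type_synonym item = "nat \<times> int \<times> int"

definition weight :: "item multiset \<Rightarrow> nat" where
  "weight M = (\<Sum>x\<in>#M. fst x)"

definition balanced :: "nat \<Rightarrow> item multiset \<Rightarrow> bool" where
  "balanced n M \<longleftrightarrow> int n dvd (\<Sum>x\<in>#M. fst (snd x)) \<and> int n dvd (\<Sum>x\<in>#M. snd (snd x))"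

text \<open>The total excess over weight 1 is at most one: at most a single item has weight
  2.\<close>

definition near_unit :: "item multiset \<Rightarrow> bool" where
  "near_unit M \<longleftrightarrow> (\<forall>x\<in>#M. 1 \<le> fst x) \<and> weight M \<le> size M + 1"

definition short_items :: "nat \<Rightarrow> bool" where
  "short_items n \<longleftrightarrow> (\<forall>M. near_unit M \<and> balanced n M \<and> 2 * n + 1 \<le> weight M \<longrightarrow>
     (\<exists>T. T \<subseteq># M \<and> T \<noteq> {#} \<and> balanced n T \<and> weight T \<le> n))"

lemma weight_union [simp]: "weight (M + N) = weight M + weight N"
  by (simp add: weight_def)

lemma weight_empty [simp]: "weight {#} = 0"
  by (simp add: weight_def)

lemma weight_add [simp]: "weight (add_mset x M) = fst x + weight M"
  by (simp add: weight_def)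

lemma weight_replicate: "weight (replicate_mset n x) = n * fst x"
  by (induction n) auto

lemma weight_diff: "T \<subseteq># M \<Longrightarrow> weight (M - T) = weight M - weight T"
  by (metis add_diff_cancel_left' subset_mset.add_diff_inverse weight_union)

lemma weight_mono: "T \<subseteq># M \<Longrightarrow> weight T \<le> weight M"
  by (metis le_add1 subset_mset.add_diff_inverse weight_union)

lemma weight_ge_size: "\<forall>x\<in>#M. 1 \<le> fst x \<Longrightarrow> size M \<le> weight M"
  by (induction M) auto

lemma near_unit_mono:
  assumes "near_unit M" "T \<subseteq># M" shows "near_unit T"
proof -
  have M: "\<forall>x\<in>#M. 1 \<le> fst x" "weight M \<le> size M + 1" using assms(1) by (auto simp: near_unit_def)
  then have "size (M - T) \<le> weight (M - T)" by (intro weight_ge_size) (auto dest: in_diffD)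
  then have "weight T \<le> size T + 1"
    using M(2) assms(2) weight_mono[OF assms(2)] size_mset_mono[OF assms(2)]
    by (simp add: weight_diff size_Diff_submset)
  then show ?thesis using M(1) assms(2) by (auto simp: near_unit_def dest: mset_subset_eqD)
qed

lemma balanced_diff:
  assumes "balanced n M" "balanced n T" "T \<subseteq># M" shows "balanced n (M - T)"
proof -
  obtain N where "M = T + N" using assms(3) by (metis subset_mset.add_diff_inverse)
  then show ?thesis using assms(1,2) by (auto simp: balanced_def dvd_add_right_iff)
qed

text \<open>Modulo 1 every single item is balanced, so an item of weight 1 suffices. If all weights
  were at least 2, there would be at most one item, of weight at most 2.\<close>

lemma short_items_1: "short_items 1"
  unfolding short_items_def
proof (intro allI impI, elim conjE)
  fix M assume M: "near_unit M" "2 * 1 + 1 \<le> weight M"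
  have "\<exists>x\<in>#M. fst x = 1"
  proof (rule ccontr)
    assume "\<not> ?thesis"
    then have "\<forall>x\<in>#M. 2 \<le> fst x" using M(1) by (force simp: near_unit_def)
    then have "2 * size M \<le> weight M" by (induction M) auto
    then show False using M by (simp add: near_unit_def)
  qed
  then obtain x where "x \<in># M" "fst x = 1" by blast
  then show "\<exists>T. T \<subseteq># M \<and> T \<noteq> {#} \<and> balanced 1 T \<and> weight T \<le> 1"
    by (intro exI[of _ "{#x#}"]) (simp add: balanced_def)
qed

text \<open>Weight and the two coordinates are three conditions modulo p, so 3 (p - 1) + 1 = 3 p - 2
  items contain a balanced part of weight divisible by p.\<close>

lemma short_items_prime:
  assumes p: "prime p" shows "short_items p"
  unfolding short_items_def
proof (intro allI impI, elim conjE)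
  fix M assume M: "near_unit M" "balanced p M" "2 * p + 1 \<le> weight M"
  let ?f = "\<lambda>(i::nat) (x::item). if i = 0 then int (fst x) else if i = 1 then fst (snd x) else snd (snd x)"
  have p2: "2 \<le> p" using p by (rule prime_ge_2_nat)
  have w1: "\<forall>x\<in>#M. 1 \<le> fst x" and w2: "weight M \<le> size M + 1"
    using M(1) by (auto simp: near_unit_def)
  have int_weight: "(\<Sum>x\<in>#T. int (fst x)) = int (weight T)" for T :: "item multiset"
    by (induction T) auto
  have ex: "\<exists>T. T \<subseteq># N \<and> T \<noteq> {#} \<and> balanced p T \<and> p dvd weight T" if "3 * p - 2 \<le> size N" for N
  proof -
    have "3 * (p - 1) + 1 \<le> size N" using that p2 by simp
    obtain T where T: "T \<subseteq># N" "T \<noteq> {#}" "\<forall>i<3. int p dvd (\<Sum>x\<in>#T. ?f i x)"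
      by (rule prime_dvd_sums_submultiset[OF p \<open>3 * (p - 1) + 1 \<le> size N\<close>, of ?f])
    from T(3)[rule_format, of 0] T(3)[rule_format, of 1] T(3)[rule_format, of 2] have "balanced p T" "p dvd weight T"
      by (auto simp: balanced_def int_weight)
    then show ?thesis using T by blast
  qed
  show "\<exists>T. T \<subseteq># M \<and> T \<noteq> {#} \<and> balanced p T \<and> weight T \<le> p"
  proof (cases "size M \<le> 3 * p - 2")
    case True
    \<comment> \<open>Padding with items of weight 1 and sum 0 reaches the required number. The
      padded weight is at most 3 p - 1, so the part found has weight p or 2 p; in the latter case
      the complement in \<open>M\<close> is used.\<close>
    define k where "k = 3 * p - 2 - size M"
    have k: "size M + k = 3 * p - 2" "k < p" using True M(3) w2 p2 by (auto simp: k_def)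
    let ?z = "(1, 0, 0) :: item"
    obtain U where U: "U \<subseteq># M + replicate_mset k ?z" "U \<noteq> {#}" "balanced p U" "p dvd weight U"
      using ex[of "M + replicate_mset k ?z"] k(1) by auto
    obtain T j where T: "T \<subseteq># M" "j \<le> k" "U = T + replicate_mset j ?z"
      using U(1) by (rule mset_subset_replicate_split)
    have wU: "weight U = weight T + j" by (simp add: T(3) weight_def)
    have bT: "balanced p T" using U(3) by (simp add: T(3) balanced_def)
    have "size U \<le> weight U" using T(1,3) w1 by (intro weight_ge_size) (auto dest: mset_subset_eqD)
    then have "0 < weight U" using U(2) by (metis nonempty_has_size order_less_le_trans)
    moreover have "weight U < 3 * p" using weight_mono[OF T(1)] T(2) k w2 wU p2 by linarith
    ultimately have "weight U = p \<or> weight U = 2 * p" using U(4) by (intro multiple_below_triple)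
    then show ?thesis
    proof
      assume "weight U = p"
      then show ?thesis using T bT wU k(2) by (intro exI[of _ T]) auto
    next
      assume *: "weight U = 2 * p"
      have "weight (M - T) \<le> p" using * wU T(1,2) k w2 p2 by (simp add: weight_diff)
      moreover have "0 < weight (M - T)" using * wU T(1) M(3) by (simp add: weight_diff)
      ultimately show ?thesis
        using balanced_diff[OF M(2) bT T(1)] by (intro exI[of _ "M - T"]) auto
    qed
  next
    case False
    \<comment> \<open>Even without the possible item of weight 2 there are 3 p - 2 items, and among
      the unit items weight is size.\<close>
    let ?M1 = "filter_mset (\<lambda>x. fst x = 1) M"
    have "size M + size (filter_mset (\<lambda>x. fst x \<noteq> 1) M) \<le> weight M"
      using w1 by (induction M) auto
    moreover have "size ?M1 + size (filter_mset (\<lambda>x. fst x \<noteq> 1) M) = size M"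
      by (metis multiset_partition size_union)
    ultimately have "3 * p - 2 \<le> size ?M1" using False w2 by linarith
    then obtain N where N: "N \<subseteq># ?M1" "size N = 3 * p - 2" by (rule submultiset_of_size)
    obtain T where T: "T \<subseteq># N" "T \<noteq> {#}" "balanced p T" "p dvd weight T"
      using ex[of N] N(2) by auto
    have unit: "weight T' = size T'" if "T' \<subseteq># ?M1" for T'
    proof -
      have "\<forall>x\<in>#T'. fst x = 1" using mset_subset_eqD[OF that] by auto
      then show ?thesis by (induction T') auto
    qed
    have TM1: "T \<subseteq># ?M1" using T(1) N(1) by (rule subset_mset.order_trans)
    have M1: "T' \<subseteq># M" if "T' \<subseteq># ?M1" for T'
      using that multiset_filter_subset subset_mset.order_trans by blast
    have "weight T = p \<or> weight T = 2 * p"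
      using T size_mset_mono[OF T(1)] N(2) unit[OF TM1] p2
      by (intro multiple_below_triple) (auto simp: nonempty_has_size[symmetric])
    then show ?thesis
    proof
      assume "weight T = p"
      then show ?thesis using T M1[OF TM1] by (intro exI[of _ T]) auto
    next
      assume *: "weight T = 2 * p"
      \<comment> \<open>Setting \<open>x\<close> aside leaves 2 p - 1 = 2 (p - 1) + 1 items, enough
        for a balanced \<open>V\<close> that is not all of \<open>T\<close>. One of \<open>V\<close>
        and its complement has weight at most p.\<close>
      obtain x T1 where x: "T = add_mset x T1" using T(2) by (metis multiset_cases)
      have "2 * (p - 1) + 1 \<le> size T1" using * unit[OF TM1] x p2 by simp
      obtain V where V: "V \<subseteq># T1" "V \<noteq> {#}" "\<forall>i<2. int p dvd (\<Sum>x\<in>#V. ?f (Suc i) x)"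
        by (rule prime_dvd_sums_submultiset[OF p \<open>2 * (p - 1) + 1 \<le> size T1\<close>, of "\<lambda>i. ?f (Suc i)"])
      from V(3)[rule_format, of 0] V(3)[rule_format, of 1] have bV: "balanced p V" by (auto simp: balanced_def)
      have VT: "V \<subseteq># T" using V(1) x by (auto intro: subset_mset.order_trans)
      have "V \<noteq> T" using size_mset_mono[OF V(1)] x by auto
      then have ne: "T - V \<noteq> {#}" using subset_mset.add_diff_inverse[OF VT] by auto
      have bTV: "balanced p (T - V)" using balanced_diff[OF T(3) bV VT] .
      have sub: "V \<subseteq># M" "T - V \<subseteq># M"
        using VT M1[OF TM1] by (auto intro: subset_mset.order_trans diff_subset_eq_self)
      have "weight V \<le> p \<or> weight (T - V) \<le> p" using * weight_mono[OF VT] by (auto simp: weight_diff VT)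
      then show ?thesis using V(2) bV ne bTV sub by blast
    qed
  qed
qed

text \<open>Blocks of weight at most p are peeled off while the weight exceeds 2 p, so what remains
  is never empty.\<close>

lemma items_decomposition:
  assumes p: "short_items p" "0 < p" and M: "near_unit M" "balanced p M" "M \<noteq> {#}"
  shows "\<exists>\<T> R. M = \<Sum>\<^sub># \<T> + R \<and> R \<noteq> {#} \<and> balanced p R \<and> weight R \<le> 2 * p \<and>
    (\<forall>T\<in>#\<T>. T \<noteq> {#} \<and> balanced p T \<and> weight T \<le> p)"
  using M
proof (induction "size M" arbitrary: M rule: less_induct)
  case less
  show ?case
  proof (cases "weight M \<le> 2 * p")
    case True
    then show ?thesis using less.prems by (intro exI[of _ "{#}"] exI[of _ M]) simp
  next
    case False
    then obtain T where T: "T \<subseteq># M" "T \<noteq> {#}" "balanced p T" "weight T \<le> p"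
      using p(1) less.prems unfolding short_items_def by (metis Suc_eq_plus1 not_less_eq_eq)
    have "0 < weight (M - T)" using False T(1,4) p(2) by (simp add: weight_diff)
    then have ne: "M - T \<noteq> {#}" by auto
    have "size (M - T) < size M"
      using T(1,2) size_mset_mono[OF T(1)] by (simp add: size_Diff_submset nonempty_has_size)
    from less.hyps[OF this near_unit_mono[OF less.prems(1) diff_subset_eq_self]
        balanced_diff[OF less.prems(2) T(3,1)] ne]
    obtain \<T> R where *: "M - T = \<Sum>\<^sub># \<T> + R" "R \<noteq> {#}" "balanced p R" "weight R \<le> 2 * p"
      "\<forall>T\<in>#\<T>. T \<noteq> {#} \<and> balanced p T \<and> weight T \<le> p" by blast
    have "M = \<Sum>\<^sub># (add_mset T \<T>) + R"
      using *(1) subset_mset.add_diff_inverse[OF T(1)] by (simp add: add.assoc)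
    then show ?thesis using * T by (intro exI[of _ "add_mset T \<T>"] exI[of _ R]) auto
  qed
qed

text \<open>Blocks modulo p become items of weight 1 and the remainder an item of weight 2, with
  sums divided by p. The new weight times p bounds the old weight, so a light balanced part modulo n
  lifts to one modulo p n.\<close>

lemma short_items_mult:
  assumes p: "short_items p" "0 < p" and n: "short_items n" "0 < n"
  shows "short_items (p * n)"
  unfolding short_items_def
proof (intro allI impI, elim conjE)
  fix M assume M: "near_unit M" "balanced (p * n) M" "2 * (p * n) + 1 \<le> weight M"
  have "balanced p M" using M(2) by (auto simp: balanced_def elim: dvd_mult_left)
  moreover have "M \<noteq> {#}" using M(3) by auto
  ultimately obtain \<T> R where dec: "M = \<Sum>\<^sub># \<T> + R" "R \<noteq> {#}" "balanced p R" "weight R \<le> 2 * p"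
      "\<And>T. T \<in># \<T> \<Longrightarrow> T \<noteq> {#} \<and> balanced p T \<and> weight T \<le> p"
    using items_decomposition[OF p M(1)] by blast
  define h :: "nat \<Rightarrow> item multiset \<Rightarrow> item" where
    "h w T = (w, (\<Sum>x\<in>#T. fst (snd x)) div int p, (\<Sum>x\<in>#T. snd (snd x)) div int p)" for w T
  have h: "fst (h w T) = w"
    "balanced p T \<Longrightarrow> int p * fst (snd (h w T)) = (\<Sum>x\<in>#T. fst (snd x))"
    "balanced p T \<Longrightarrow> int p * snd (snd (h w T)) = (\<Sum>x\<in>#T. snd (snd x))" for w T
    by (auto simp: h_def balanced_def)
  have sums: "int p * (\<Sum>x\<in>#image_mset (h w) \<U>. fst (snd x)) = (\<Sum>x\<in>#\<Sum>\<^sub># \<U>. fst (snd x))"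
    "int p * (\<Sum>x\<in>#image_mset (h w) \<U>. snd (snd x)) = (\<Sum>x\<in>#\<Sum>\<^sub># \<U>. snd (snd x))"
    if "\<forall>T\<in>#\<U>. balanced p T" for \<U> w
    using that by (induction \<U>) (auto simp: h distrib_left)
  have lift: "balanced n (image_mset (h w) \<U> + image_mset (h w') \<V>) \<longleftrightarrow> balanced (p * n) (\<Sum>\<^sub># \<U> + \<Sum>\<^sub># \<V>)"
    if "\<forall>T\<in>#\<U>. balanced p T" "\<forall>T\<in>#\<V>. balanced p T" for \<U> \<V> w w'
    using p(2) unfolding balanced_def image_mset_union sum_mset.union sums[OF that(1), of w, symmetric]
      sums[OF that(2), of w', symmetric] distrib_left[symmetric] of_nat_mult
    by simp
  have wh: "weight (image_mset (h w) \<U>) = w * size \<U>" for w \<U>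
    by (induction \<U>) (auto simp: h)
  have wsum: "weight (\<Sum>\<^sub># \<U>) \<le> p * size \<U>" if "\<U> \<subseteq># \<T>" for \<U>
  proof -
    have "\<forall>T\<in>#\<U>. weight T \<le> p" using dec(5) that by (auto dest: mset_subset_eqD)
    then show ?thesis by (induction \<U>) auto
  qed
  \<comment> \<open>The form \<open>replicate_mset 1\<close> lets
    \<open>mset_subset_replicate_split\<close> tell whether a part contains the remainder.\<close>
  let ?M = "image_mset (h 1) \<T> + replicate_mset 1 (h 2 R)"
  have "near_unit ?M" by (auto simp: near_unit_def h wh)
  moreover have "balanced n ?M"
    using lift[of \<T> "{#R#}" 1 2] dec M(2) by simp
  moreover have "2 * n + 1 \<le> weight ?M"
  proof -
    \<comment> \<open>From 2 p n < weight M \<le> p (size \<T> + 2) the new weight, which is the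
      bracket, exceeds 2 n.\<close>
    have "weight M \<le> p * size \<T> + 2 * p" using wsum[of \<T>] dec(1,4) by simp
    then have "p * (2 * n) < p * (size \<T> + 2)" using M(3) by (simp add: algebra_simps)
    then have "2 * n < size \<T> + 2" by (metis mult_less_cancel1)
    then show ?thesis by (simp add: wh h)
  qed
  ultimately obtain U where U: "U \<subseteq># ?M" "U \<noteq> {#}" "balanced n U" "weight U \<le> n"
    using n(1) unfolding short_items_def by blast
  obtain U1 i where U1: "U1 \<subseteq># image_mset (h 1) \<T>" "i \<le> 1" "U = U1 + replicate_mset i (h 2 R)"
    using U(1) by (rule mset_subset_replicate_split)
  obtain \<U> where \<U>: "\<U> \<subseteq># \<T>" "U1 = image_mset (h 1) \<U>"
    using U1(1) by (rule subset_image_mset_preimage)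
  have bU: "\<forall>T\<in>#\<U>. balanced p T" "\<forall>T\<in>#\<U>. T \<noteq> {#}"
    using dec(5) \<U>(1) by (auto dest: mset_subset_eqD)
  let ?T = "\<Sum>\<^sub># \<U> + \<Sum>\<^sub># (replicate_mset i R)"
  have "\<Sum>\<^sub># \<U> \<subseteq># \<Sum>\<^sub># \<T>" using \<U>(1)
    by (metis mset_subset_eq_add_left subset_mset.add_diff_inverse sum_mset.union)
  moreover have "\<Sum>\<^sub># (replicate_mset i R) \<subseteq># R" using U1(2) by (cases i) auto
  ultimately have "?T \<subseteq># M" unfolding dec(1) by (rule subset_mset.add_mono)
  moreover have "?T \<noteq> {#}"
  proof (cases "i = 0")
    case True
    then obtain T where "T \<in># \<U>" using U(2) U1(3) \<U>(2) by fastforce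
    then show ?thesis using bU(2) by auto
  next
    case False
    then show ?thesis using dec(2) U1(2) by (cases i) auto
  qed
  moreover have "balanced (p * n) ?T"
    using lift[of \<U> "replicate_mset i R" 1 2] bU dec(3) U(3) unfolding U1(3) \<U>(2)
    by (simp split: if_splits)
  moreover have "weight ?T \<le> p * n"
  proof -
    have "weight ?T \<le> p * size \<U> + i * (2 * p)"
      using wsum[OF \<U>(1)] dec(4) U1(2) by (cases i) auto
    also have "\<dots> = p * weight U" by (simp add: U1(3) \<U>(2) wh weight_replicate h algebra_simps)
    finally show ?thesis using U(4) by (meson le_trans mult_le_mono2)
  qed
  ultimately show "\<exists>T. T \<subseteq># M \<and> T \<noteq> {#} \<and> balanced (p * n) T \<and> weight T \<le> p * n" by blast
qed

lemma short_items: "0 < n \<Longrightarrow> short_items n"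
proof (induction n rule: less_induct)
  case (less n)
  show ?case
  proof (cases "n = 1")
    case False
    then obtain p where p: "prime p" "p dvd n" using prime_factor_nat by blast
    then obtain m where m: "n = p * m" by auto
    have m0: "0 < m" "m < n" using m less.prems prime_gt_1_nat[OF p(1)] by auto
    show ?thesis
      unfolding m using short_items_mult[OF short_items_prime[OF p(1)] _ less.IH[OF m0(2,1)] m0(1)] p(1)
      by (simp add: prime_gt_0_nat)
  qed (simp only: short_items_1)
qed

lemma short_beyond_double_rank_2:
  assumes n: "0 < n"
  shows "short_beyond_double (integer_mod_group n \<times>\<times> integer_mod_group n) n"
  unfolding short_beyond_double_def
proof (intro allI impI, elim conjE)
  let ?C = "integer_mod_group n" let ?G = "?C \<times>\<times> ?C"
  fix S assume S: "seq_over ?G S" "zero_sum ?G S" "2 * n + 1 \<le> size S"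
  have zs: "zero_sum ?G T \<longleftrightarrow> balanced n (image_mset (Pair 1) T)" if "T \<subseteq># S" for T
  proof -
    have o: "seq_over ?G T" using that S(1) by (auto simp: seq_over_def dest: mset_subset_eqD)
    then have "seq_over ?C (image_mset fst T)" "seq_over ?C (image_mset snd T)"
      by (auto simp: seq_over_def)
    then show ?thesis
      using seq_sum_integer_mod_group[OF n]
        seq_sum_DirProd[OF abelian_integer_mod_group abelian_integer_mod_group o]
      by (simp add: zero_sum_def balanced_def mod_eq_0_iff_dvd multiset.map_comp comp_def)
  qed
  have w: "weight (image_mset (Pair 1) T) = size T" for T :: "(int \<times> int) multiset"
    by (induction T) auto
  have "near_unit (image_mset (Pair 1) S)" using w[of S] by (auto simp: near_unit_def)
  moreover have "balanced n (image_mset (Pair 1) S)" using zs[of S] S(2) by simp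
  ultimately obtain U where U: "U \<subseteq># image_mset (Pair 1) S" "U \<noteq> {#}" "balanced n U" "weight U \<le> n"
    using short_items[OF n] S(3) w[of S] unfolding short_items_def by metis
  obtain T where T: "T \<subseteq># S" "U = image_mset (Pair 1) T"
    using U(1) by (rule subset_image_mset_preimage)
  show "\<exists>T. T \<subseteq># S \<and> T \<noteq> {#} \<and> zero_sum ?G T \<and> size T \<le> n"
    using U T zs[OF T(1)] w[of T] by (intro exI[of _ T]) auto
qed

lemma C0_rank_two:
  assumes "comm_group G" "finite (carrier G)" "0 < n1" "0 < n2" "n1 dvd n2"
    and iso: "G \<cong> integer_mod_group n1 \<times>\<times> integer_mod_group n2"
  shows "C0 G = {int (davenport G) + 1..int (eta G) - 1}"
proof -
  obtain m where m: "n2 = m * n1" using assms(5) by (metis dvd_def mult.commute)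
  have "G \<cong> integer_mod_group (m * n1) \<times>\<times> integer_mod_group n1"
    using iso_trans[OF iso DirProd_commute_iso] m by simp
  then show ?thesis
    using assms m short_beyond_double_rank_2[OF assms(3)]
    by (intro C0_eq_of_iso_cyclic_DirProd[where H = "integer_mod_group n1" and m = m and e = n1]) auto
qed

lemma C0_p_group_extension:
  assumes "comm_group G" "finite (carrier G)" "prime p" "0 < m" "comm_group H" "finite_p_group p H"
    and D: "davenport H \<le> p ^ n" and iso: "G \<cong> integer_mod_group (p ^ n * m) \<times>\<times> H"
  shows "C0 G = {int (davenport G) + 1..int (eta G) - 1}"
  using assms short_beyond_double_p_group[OF assms(3,5,6) D]
  by (intro C0_eq_of_iso_cyclic_DirProd[where H = H and m = m and e = "p ^ n"])
    (auto simp: mult.commute prime_gt_0_nat)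

section \<open>Elementary 2-groups\<close>

context comm_group
begin

lemma eta_eqI:
  assumes "\<And>S. seq_over G S \<Longrightarrow> d \<le> size S \<Longrightarrow> \<exists>T. T \<subseteq># S \<and> short_zero_sum G T"
    and "seq_over G S" "d \<le> size S + 1" "\<And>T. T \<subseteq># S \<Longrightarrow> \<not> short_zero_sum G T"
  shows "eta G = d"
  unfolding eta_def
proof (rule Least_equality)
  fix e assume "\<forall>S. seq_over G S \<and> e \<le> size S \<longrightarrow> (\<exists>T. T \<subseteq># S \<and> short_zero_sum G T)"
  then have "\<not> e \<le> size S" using assms(2,4) by blast
  then show "d \<le> e" using assms(3) by simp
qed (use assms(1) in blast)

end

lemma group_exp_cyclic_power:
  assumes "0 < n" "0 < r" shows "group_exp (cyclic_power n r) = n"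
proof (rule antisym)
  interpret comm_group "cyclic_power n r" by (rule comm_group_cyclic_power)
  have pow: "x [^]\<^bsub>cyclic_power n r\<^esub> k = (\<lambda>i\<in>{..<r}. int k * x i mod int n)"
    if "x \<in> carrier (cyclic_power n r)" for x and k :: nat
    using cyclic_power_nat_pow[OF that assms(1)] .
  show "group_exp (cyclic_power n r) \<le> n"
    unfolding group_exp_def
    by (rule Least_le) (auto simp: assms(1) pow one_cyclic_power)
  let ?g = "\<lambda>i\<in>{..<r}. 1 mod int n"
  have g: "?g \<in> carrier (cyclic_power n r)"
    using assms(1) carrier_cyclic_power[OF assms(1)] by auto
  show "n \<le> group_exp (cyclic_power n r)"
  proof (rule group_exp_ge[OF finite_cyclic_power[OF assms(1)] g])
    fix k :: nat assume k: "0 < k" "?g [^]\<^bsub>cyclic_power n r\<^esub> k = \<one>\<^bsub>cyclic_power n r\<^esub>"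
    then have "(?g [^]\<^bsub>cyclic_power n r\<^esub> k) 0 = \<one>\<^bsub>cyclic_power n r\<^esub> 0" by simp
    then have "int k mod int n = 0"
      unfolding pow[OF g] one_cyclic_power using assms(2) by (simp add: mod_simps)
    then have "n dvd k" by (metis mod_eq_0_iff_dvd of_nat_dvd_iff)
    then show "n \<le> k" using k(1) by (rule dvd_imp_le)
  qed
qed

lemma card_cyclic_power: "0 < n \<Longrightarrow> card (carrier (cyclic_power n r)) = n ^ r"
  by (simp add: carrier_cyclic_power card_PiE)

lemma davenport_cyclic_power_le:
  "prime p \<Longrightarrow> davenport (cyclic_power p r) \<le> r * (p - 1) + 1"
  using comm_group.davenport_le_aug_nilpotent[OF comm_group_cyclic_power]
    aug_nilpotent_cyclic_power prime_gt_1_nat by blast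

locale elementary_2_group = comm_group +
  assumes square [simp]: "x \<in> carrier G \<Longrightarrow> x \<otimes> x = \<one>"
    and fin: "finite (carrier G)"
begin

lemma mult_eq_one_iff: "x \<in> carrier G \<Longrightarrow> y \<in> carrier G \<Longrightarrow> x \<otimes> y = \<one> \<longleftrightarrow> x = y"
  by (metis Units_eq Units_l_cancel square)

lemma mult_eq_iff:
  "x \<in> carrier G \<Longrightarrow> y \<in> carrier G \<Longrightarrow> z \<in> carrier G \<Longrightarrow> x \<otimes> y = z \<longleftrightarrow> y = x \<otimes> z"
  by (metis l_one m_assoc square)

lemma square_left [simp]: "x \<in> carrier G \<Longrightarrow> y \<in> carrier G \<Longrightarrow> x \<otimes> (x \<otimes> y) = y"
  by (simp add: m_assoc[symmetric])

lemma pow_2_eq_one: "x \<in> carrier G \<Longrightarrow> x [^] (2::nat) = \<one>"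
  by (simp add: numeral_2_eq_2)

lemma zero_sum_singleton: "x \<in> carrier G \<Longrightarrow> zero_sum G {#x#} \<longleftrightarrow> x = \<one>"
  by (simp add: zero_sum_def seq_sum_add_mset seq_over_def)

lemma zero_sum_pair: "x \<in> carrier G \<Longrightarrow> y \<in> carrier G \<Longrightarrow> zero_sum G {#x, y#} \<longleftrightarrow> x = y"
  by (simp add: zero_sum_def seq_sum_add_mset seq_over_def mult_eq_one_iff)

text \<open>For exponent 2 the short zero-sum sequences are the identity alone and pairs of equal
  elements.\<close>

lemma no_short_zero_sum_iff:
  assumes e: "group_exp G = 2" and S: "seq_over G S"
  shows "(\<nexists>T. T \<subseteq># S \<and> short_zero_sum G T) \<longleftrightarrow> (\<exists>A\<subseteq>carrier G - {\<one>}. S = mset_set A)"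
proof
  assume no: "\<nexists>T. T \<subseteq># S \<and> short_zero_sum G T"
  have car: "x \<in> carrier G" if "x \<in># S" for x using S that by (auto simp: seq_over_def)
  have "x \<noteq> \<one>" if "x \<in># S" for x
    using no that zero_sum_singleton[OF car[OF that]] e
    by (auto simp: short_zero_sum_def dest!: spec[of _ "{#x#}"])
  moreover have "count S x = 1" if x: "x \<in># S" for x
  proof (rule ccontr)
    assume "count S x \<noteq> 1"
    then have "2 \<le> count S x" using count_greater_zero_iff[of S x] x by linarith
    then have "{#x, x#} \<subseteq># S"
      by (metis count_le_replicate_mset_subset_eq numeral_2_eq_2 replicate_mset_0 replicate_mset_Suc)
    then show False
      using no zero_sum_pair[OF car[OF x] car[OF x]] e
      by (auto simp: short_zero_sum_def dest!: spec[of _ "{#x, x#}"])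
  qed
  then have "S = mset_set (set_mset S)"
    by (auto simp: multiset_eq_iff count_mset_set' not_in_iff)
  ultimately show "\<exists>A\<subseteq>carrier G - {\<one>}. S = mset_set A"
    using car by (intro exI[of _ "set_mset S"]) auto
next
  assume "\<exists>A\<subseteq>carrier G - {\<one>}. S = mset_set A"
  then obtain A where A: "A \<subseteq> carrier G - {\<one>}" "S = mset_set A" by blast
  have finA: "finite A" using A(1) fin finite_subset by blast
  show "\<nexists>T. T \<subseteq># S \<and> short_zero_sum G T"
  proof
    assume "\<exists>T. T \<subseteq># S \<and> short_zero_sum G T"
    then obtain T where T: "T \<subseteq># mset_set A" "zero_sum G T" "1 \<le> size T" "size T \<le> 2"
      using A(2) e by (auto simp: short_zero_sum_def)
    have memT: "x \<in> carrier G" "x \<noteq> \<one>" if "x \<in># T" for x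
      using mset_subset_eqD[OF T(1) that] A(1) finA by auto
    consider "size T = 1" | "size T = 2" using T(3,4) by linarith
    then show False
    proof cases
      case 1
      then obtain x where "T = {#x#}" using size_1_singleton_mset by blast
      then show False using T(2) memT[of x] zero_sum_singleton by auto
    next
      case 2
      then obtain x T' where T': "T = add_mset x T'" "size T' = 1"
        using size_eq_Suc_imp_eq_union[of T 1] by auto
      then obtain y where xy: "T = {#x, y#}" using size_1_singleton_mset by blast
      then have "x \<in> carrier G" "y \<in> carrier G" using memT by auto
      then have "x = y" using T(2) zero_sum_pair unfolding xy by blast
      then have "2 \<le> count (mset_set A) x"
        using mset_subset_eq_count[OF T(1), of x] xy by simp
      then show False using count_mset_set'[of A x] by (simp split: if_splits)
    qed
  qed
qed

section \<open>Zero-sum sets of nonzero elements\<close>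

abbreviation set_sum :: "'a set \<Rightarrow> 'a" where
  "set_sum A \<equiv> seq_sum G (mset_set A)"

lemma set_sum_insert:
  "finite A \<Longrightarrow> A \<subseteq> carrier G \<Longrightarrow> x \<in> carrier G \<Longrightarrow> x \<notin> A \<Longrightarrow> set_sum (insert x A) = x \<otimes> set_sum A"
  by (simp add: seq_sum_add_mset seq_over_def)

lemma set_sum_closed: "A \<subseteq> carrier G \<Longrightarrow> set_sum A \<in> carrier G"
  using finite_subset[OF _ fin] by (intro seq_sum_closed) (auto simp: seq_over_def)

text \<open>\<open>Y\<close> is a union of pairs y, y s, and each pair has sum s.\<close>

lemma union_of_pairs:
  assumes s: "s \<in> carrier G" "s \<noteq> \<one>" and Y: "Y \<subseteq> carrier G" "\<And>y. y \<in> Y \<Longrightarrow> y \<otimes> s \<in> Y"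
    and k: "2 * k \<le> card Y"
  shows "\<exists>Z\<subseteq>Y. card Z = 2 * k \<and> (\<forall>z\<in>Z. z \<otimes> s \<in> Z) \<and> set_sum Z = s [^] k"
  using k
proof (induction k)
  case 0
  then show ?case by (intro exI[of _ "{}"]) simp
next
  case (Suc k)
  then obtain Z where Z: "Z \<subseteq> Y" "card Z = 2 * k" "\<And>z. z \<in> Z \<Longrightarrow> z \<otimes> s \<in> Z" "set_sum Z = s [^] k"
    by force
  have finZ: "finite Z" using Z(1) Y(1) fin by (meson finite_subset)
  have "Z \<noteq> Y" using Suc.prems Z(2) by auto
  then obtain y where y: "y \<in> Y" "y \<notin> Z" using Z(1) by auto
  have yc: "y \<in> carrier G" "y \<otimes> s \<in> carrier G" using y(1) Y(1) s(1) by auto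
  have ys: "y \<otimes> s \<notin> Z" using Z(3)[of "y \<otimes> s"] y(2) yc s(1) by (auto simp: m_assoc)
  have ne: "y \<noteq> y \<otimes> s" using s yc(1) by (metis l_cancel_one)
  have Zc: "Z \<subseteq> carrier G" using Z(1) Y(1) by auto
  let ?Z = "insert y (insert (y \<otimes> s) Z)"
  have "set_sum ?Z = y \<otimes> (y \<otimes> s \<otimes> set_sum Z)"
    using finZ Zc yc y(2) ys ne by (simp add: seq_sum_add_mset seq_over_def)
  also have "\<dots> = s [^] Suc k"
    using Z(4) yc s(1) m_lcomm[of y s "y \<otimes> s [^] k"] by (simp add: m_assoc m_comm)
  finally have "set_sum ?Z = s [^] Suc k" .
  moreover have "card ?Z = 2 * Suc k" using finZ Z(2) y(2) ys ne by simp
  moreover have "?Z \<subseteq> Y" using Z(1) y(1) Y(2) by auto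
  moreover have "\<forall>z\<in>?Z. z \<otimes> s \<in> ?Z" using Z(3) yc s(1) by (auto simp: m_assoc)
  ultimately show ?case by blast
qed

lemma pow_even: "s \<in> carrier G \<Longrightarrow> even k \<Longrightarrow> s [^] (k::nat) = \<one>"
  by (metis evenE nat_pow_one nat_pow_pow pow_2_eq_one)

text \<open>An even number of pairs y, y s has sum 0, an odd number has sum s. The other residues of
  \<open>t\<close> modulo 4 are reached by adding to an odd number of pairs a few elements with sum
  s: s itself; x, y, x y s; or x, y, x y, s.\<close>

lemma exists_zero_sum_set:
  assumes N: "card (carrier G) = N" "8 \<le> N" "4 dvd N"
    and t: "3 \<le> t" "t + 4 \<le> N \<or> t + 1 = N"
  shows "\<exists>A\<subseteq>carrier G - {\<one>}. card A = t \<and> set_sum A = \<one>"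
proof -
  have big: "\<exists>z\<in>carrier G. z \<notin> F" if "finite F" "card F < N" for F
    using card_mono[OF that(1), of "carrier G"] that(2) N(1) by auto
  obtain s where s: "s \<in> carrier G" "s \<noteq> \<one>" using big[of "{\<one>}"] N(2) by auto
  let ?X = "carrier G - {\<one>, s}"
  have cX: "card ?X = N - 2" using card_Diff_subset[of "{\<one>, s}" "carrier G"] s N(1) by auto
  have X: "?X \<subseteq> carrier G" "\<And>y. y \<in> ?X \<Longrightarrow> y \<otimes> s \<in> ?X"
    using s mult_eq_one_iff by (auto simp: l_cancel_one)
  have pairs: "\<exists>Z\<subseteq>?X. card Z = 2 * k \<and> set_sum Z = s [^] k" if "2 * k + 2 \<le> N" for k
  proof -
    have "2 * k \<le> card ?X" using cX that by simp
    from union_of_pairs[OF s X this] show ?thesis by blast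
  qed
  have "card {\<one>, s} < N" using N(2) s(2) by simp
  then obtain x where x: "x \<in> carrier G" "x \<notin> {\<one>, s}" using big[of "{\<one>, s}"] by auto
  have "card {\<one>, s, x, x \<otimes> s} \<le> 4" using card_length[of "[\<one>, s, x, x \<otimes> s]"] by simp
  then obtain y where y: "y \<in> carrier G" "y \<notin> {\<one>, s, x, x \<otimes> s}"
    using big[of "{\<one>, s, x, x \<otimes> s}"] N(2) by auto
  \<comment> \<open>Closed under multiplication by \<open>s\<close> and containing all the extra
    elements except \<open>s\<close>, which \<open>?X\<close> already omits. Pairs from the
    complement are therefore disjoint from them.\<close>
  let ?W = "{x, x \<otimes> s, y, y \<otimes> s, x \<otimes> y, x \<otimes> y \<otimes> s}"
  let ?Y = "?X - ?W"
  have c: "x \<otimes> y \<in> carrier G" "x \<otimes> s \<in> carrier G" "y \<otimes> s \<in> carrier G" using x y s by auto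
  have xys: "x \<otimes> y \<noteq> \<one>" "x \<otimes> y \<noteq> s" "x \<otimes> y \<noteq> x" "x \<otimes> y \<noteq> y"
    using x y s mult_eq_iff[of x y] by (auto simp: mult_eq_one_iff)
  let ?v = "x \<otimes> y \<otimes> s"
  have vs: "?v \<otimes> s = x \<otimes> y" using x(1) y(1) s(1) by (simp add: m_assoc)
  have v: "?v \<in> carrier G" "?v \<noteq> \<one>" "?v \<noteq> s" "?v \<noteq> x" "?v \<noteq> y"
  proof -
    show "?v \<in> carrier G" using c s(1) by simp
    show "?v \<noteq> \<one>" using vs xys(2) s(1) by auto
    show "?v \<noteq> s" using vs xys(1) s(1) by auto
    show "?v \<noteq> x"
    proof
      assume "?v = x"
      then have "x \<otimes> (x \<otimes> s) = x \<otimes> (x \<otimes> y)" using vs by simp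
      then show False using x(1) y s(1) by simp
    qed
    show "?v \<noteq> y"
    proof
      assume "?v = y"
      then have "y \<otimes> (y \<otimes> s) = y \<otimes> (y \<otimes> x)" using vs x(1) y(1) by (simp add: m_comm)
      then show False using x y(1) s(1) by simp
    qed
  qed
  have W: "z \<otimes> s \<in> ?W" if "z \<in> ?W" for z
    using that x(1) y(1) s(1) by (auto simp: m_assoc)
  have Y: "?Y \<subseteq> carrier G" by auto
  have Ys: "z \<otimes> s \<in> ?Y" if "z \<in> ?Y" for z
  proof -
    have "z \<otimes> s \<notin> ?W" using W[of "z \<otimes> s"] that s(1) by (simp add: m_assoc) blast
    then show ?thesis using X(2)[of z] that by blast
  qed
  have "card ?W \<le> 6" using card_length[of "[x, x \<otimes> s, y, y \<otimes> s, x \<otimes> y, ?v]"] by simp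
  then have "N - 8 \<le> card ?Y" using diff_card_le_card_Diff[of ?W ?X] cX by simp
  then have pairs': "\<exists>Z\<subseteq>?Y. card Z = 2 * k \<and> set_sum Z = s [^] k" if "2 * k + 8 \<le> N" for k
  proof -
    have "2 * k \<le> card ?Y" using \<open>N - 8 \<le> card ?Y\<close> that by simp
    from union_of_pairs[OF s Y Ys this] show ?thesis by blast
  qed
  obtain m where c4: "N = 4 * m" using N(3) by (rule dvdE)
  have finS: "finite Z" if "Z \<subseteq> carrier G" for Z using that fin by (rule finite_subset)
  consider j where "t = 4 * j" | j where "t = 4 * j + 3" | j where "t = 4 * j + 5" | j where "t = 4 * j + 6"
  proof -
    have "(\<exists>j. t = 4 * j) \<or> (\<exists>j. t = 4 * j + 3) \<or> (\<exists>j. t = 4 * j + 5) \<or> (\<exists>j. t = 4 * j + 6)"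
      using t(1) by presburger
    then show ?thesis using that by blast
  qed
  then show ?thesis
  proof cases
    case (1 j)
    have "2 * (2 * j) + 2 \<le> N" using 1 t(2) c4 by presburger
    from pairs[OF this] obtain Z
      where "Z \<subseteq> ?X" "card Z = 2 * (2 * j)" "set_sum Z = s [^] (2 * j)" by blast
    then show ?thesis using 1 s(1) pow_even by (intro exI[of _ Z]) auto
  next
    case (2 j)
    have "2 * (2 * j + 1) + 2 \<le> N" using 2 t(2) c4 by presburger
    from pairs[OF this] obtain Z
      where Z: "Z \<subseteq> ?X" "card Z = 2 * (2 * j + 1)" "set_sum Z = s [^] (2 * j + 1)" by blast
    have "Z \<subseteq> carrier G" "s \<notin> Z" using Z(1) by auto
    then have "set_sum (insert s Z) = s \<otimes> s [^] (2 * j + 1)"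
      using set_sum_insert[of Z s] Z(3) finS[of Z] s(1) by metis
    also have "\<dots> = \<one>" using s(1) pow_even[of s "2 * j"] by simp
    finally have "set_sum (insert s Z) = \<one>" .
    moreover have "card (insert s Z) = t" using Z 2 finS[of Z] by (subst card_insert_disjoint) auto
    ultimately show ?thesis using Z(1) s by (intro exI[of _ "insert s Z"]) auto
  next
    case (3 j)
    have "2 * (2 * j + 1) + 8 \<le> N" using 3 t(2) c4 by presburger
    from pairs'[OF this] obtain Z
      where Z: "Z \<subseteq> ?Y" "card Z = 2 * (2 * j + 1)" "set_sum Z = s [^] (2 * j + 1)" by blast
    have Zc: "Z \<subseteq> carrier G" using Z(1) by auto
    have nin: "x \<notin> Z" "y \<notin> Z" "?v \<notin> Z" "x \<noteq> y" using Z(1) y by auto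
    let ?A = "insert x (insert y (insert ?v Z))"
    have "set_sum ?A = x \<otimes> (y \<otimes> (?v \<otimes> set_sum Z))"
      using nin v x(1) y(1) Zc finS[OF Zc] by (simp add: seq_sum_add_mset seq_over_def)
    also have "\<dots> = \<one>"
      using s(1) x(1) y(1) pow_even[of s "2 * j"] m_comm[of x y] by (simp add: Z(3) m_assoc)
    finally have "set_sum ?A = \<one>" .
    moreover have "card ?A = t" using Z(2) 3 nin v finS[OF Zc] by simp
    ultimately show ?thesis using Zc Z(1) x y v by (intro exI[of _ ?A]) auto
  next
    case (4 j)
    have "2 * (2 * j + 1) + 8 \<le> N" using 4 t(2) c4 by presburger
    from pairs'[OF this] obtain Z
      where Z: "Z \<subseteq> ?Y" "card Z = 2 * (2 * j + 1)" "set_sum Z = s [^] (2 * j + 1)" by blast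
    have Zc: "Z \<subseteq> carrier G" using Z(1) by auto
    have nin: "x \<notin> Z" "y \<notin> Z" "x \<otimes> y \<notin> Z" "s \<notin> Z" "x \<noteq> y" using Z(1) y by auto
    let ?A = "insert x (insert y (insert (x \<otimes> y) (insert s Z)))"
    have "set_sum ?A = x \<otimes> (y \<otimes> (x \<otimes> y \<otimes> (s \<otimes> set_sum Z)))"
      using nin xys x y c(1) s(1) Zc finS[OF Zc] by (simp add: seq_sum_add_mset seq_over_def)
    also have "\<dots> = \<one>"
      using s(1) x(1) y(1) pow_even[of s "2 * j"] m_comm[of x y] by (simp add: Z(3) m_assoc)
    finally have "set_sum ?A = \<one>" .
    moreover have "card ?A = t" using Z(2) 4 nin xys x y s finS[OF Zc] by simp
    ultimately show ?thesis using Zc Z(1) x y s c xys by (intro exI[of _ ?A]) auto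
  qed
qed

text \<open>For length N - 1 the previous result leaves only the set of all nonzero
  elements.\<close>

lemma total_sum:
  assumes "card (carrier G) = N" "8 \<le> N" "4 dvd N"
  shows "set_sum (carrier G - {\<one>}) = \<one>"
proof -
  obtain A where A: "A \<subseteq> carrier G - {\<one>}" "card A = N - 1" "set_sum A = \<one>"
  proof -
    have "3 \<le> N - 1" "N - 1 + 4 \<le> N \<or> N - 1 + 1 = N" using assms(2) by auto
    then show ?thesis using exists_zero_sum_set[OF assms] that by blast
  qed
  moreover have "card (carrier G - {\<one>}) = N - 1" using assms(1) by (simp add: card_Diff_singleton)
  ultimately have "A = carrier G - {\<one>}" using fin by (intro card_subset_eq) auto
  then show ?thesis using A(3) by simp
qed

text \<open>The complement among the nonzero elements also has sum 0, but it would have one or two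
  elements.\<close>

lemma no_zero_sum_set:
  assumes N: "card (carrier G) = N" "8 \<le> N" "4 dvd N"
    and A: "A \<subseteq> carrier G - {\<one>}" "set_sum A = \<one>"
  shows "card A + 2 \<noteq> N" "card A + 3 \<noteq> N"
proof -
  let ?B = "carrier G - {\<one>} - A"
  have finA: "finite A" using A(1) fin by (meson finite_Diff finite_subset)
  have "mset_set (carrier G - {\<one>}) = mset_set (A \<union> ?B)" using A(1) by (simp add: Un_absorb1)
  also have "\<dots> = mset_set A + mset_set ?B" using finA fin by (intro mset_set_Union) auto
  finally have "set_sum (carrier G - {\<one>}) = set_sum A \<otimes> set_sum ?B"
    using A(1) fin finA by (simp add: seq_sum_union seq_over_def) (subst seq_sum_union; auto simp: seq_over_def)
  moreover have "?B \<subseteq> carrier G" by auto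
  ultimately have B: "set_sum ?B = \<one>" using total_sum[OF N] A(2) set_sum_closed[of ?B] by simp
  have "card ?B = N - 1 - card A"
    using card_Diff_subset[OF finA A(1)] N(1) by (simp add: card_Diff_singleton)
  moreover have "card A \<le> N - 1" using card_mono[OF _ A(1)] fin N(1) by (simp add: card_Diff_singleton)
  moreover have "card ?B \<noteq> 1"
  proof
    assume "card ?B = 1"
    then obtain b where b: "?B = {b}" by (rule card_1_singletonE)
    then have "b \<in> carrier G" "b \<noteq> \<one>" by auto
    then show False using B b zero_sum_singleton[of b] by (simp add: zero_sum_def)
  qed
  moreover have "card ?B \<noteq> 2"
  proof
    assume "card ?B = 2"
    then obtain b c where b: "?B = {b, c}" "b \<noteq> c" by (auto simp: card_2_iff)
    then have "b \<in> carrier G" "c \<in> carrier G" by auto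
    then show False using B b zero_sum_pair[of b c] by (simp add: zero_sum_def)
  qed
  ultimately show "card A + 2 \<noteq> N" "card A + 3 \<noteq> N" using N(2) by linarith+
qed

end

theorem C0_cyclic_power_2:
  assumes "3 \<le> r"
  shows "C0 (cyclic_power 2 r) =
    {int (eta (cyclic_power 2 r)) - 3, int (eta (cyclic_power 2 r)) - 2}"
proof -
  let ?G = "cyclic_power 2 r"
  interpret comm_group ?G by (rule comm_group_cyclic_power)
  interpret elementary_2_group ?G
  proof
    show "x \<otimes>\<^bsub>?G\<^esub> x = \<one>\<^bsub>?G\<^esub>" for x
      by (rule ext) (simp add: mult_cyclic_power one_cyclic_power)
    show "finite (carrier ?G)" by (simp add: finite_cyclic_power)
  qed
  let ?N = "2 ^ r :: nat"
  have e: "group_exp ?G = 2" using group_exp_cyclic_power[of 2 r] assms by simp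
  have N: "card (carrier ?G) = ?N" by (simp add: card_cyclic_power)
  have N8: "8 \<le> ?N" "4 dvd ?N"
    using power_increasing[OF assms, of "2::nat"] le_imp_power_dvd[of 2 r "2::nat"] assms by simp_all
  note no_short = no_short_zero_sum_iff[OF e]
  have cardA: "card A + 1 \<le> ?N" if "A \<subseteq> carrier ?G - {\<one>\<^bsub>?G\<^esub>}" for A
    using card_mono[OF _ that] fin N N8 by (simp add: card_Diff_singleton)
  have eta: "eta ?G = ?N"
  proof (rule eta_eqI)
    fix S assume S: "seq_over ?G S" "?N \<le> size S"
    show "\<exists>T. T \<subseteq># S \<and> short_zero_sum ?G T"
    proof (rule ccontr)
      assume "\<not> ?thesis"
      then obtain A where "A \<subseteq> carrier ?G - {\<one>\<^bsub>?G\<^esub>}" "S = mset_set A"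
        using no_short[OF S(1)] by blast
      then show False using cardA[of A] S(2) by simp
    qed
  next
    let ?S = "mset_set (carrier ?G - {\<one>\<^bsub>?G\<^esub>})"
    show S: "seq_over ?G ?S" using fin by (auto simp: seq_over_def)
    show "?N \<le> size ?S + 1" using N fin by (simp add: card_Diff_singleton)
    show "\<not> short_zero_sum ?G T" if "T \<subseteq># ?S" for T using no_short[OF S] that by blast
  qed
  have D1: "1 < davenport ?G"
  proof (rule ccontr)
    assume D: "\<not> 1 < davenport ?G"
    obtain g where g: "g \<in> carrier ?G" "g \<noteq> \<one>\<^bsub>?G\<^esub>"
      using card_mono[of "{\<one>\<^bsub>?G\<^esub>}" "carrier ?G"] N N8 by fastforce
    then obtain T where "T \<subseteq># {#g#}" "T \<noteq> {#}" "zero_sum ?G T"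
      using davenport_zero_sum[OF fin, of "{#g#}"] D by (auto simp: seq_over_def)
    moreover have "T = {#g#}"
      using \<open>T \<subseteq># {#g#}\<close> \<open>T \<noteq> {#}\<close> by (metis subset_mset.le_less subset_mset_def mset_subset_size size_single less_one size_eq_0_iff_empty)
    ultimately show False using zero_sum_singleton g by simp
  qed
  \<comment> \<open>This puts even the smaller length 2^r - 3 above the Davenport constant; the
    estimate r + 5 \<le> 2^r is tight for r = 3.\<close>
  have D2: "davenport ?G + 4 \<le> ?N"
  proof -
    have "davenport ?G \<le> r + 1" using davenport_cyclic_power_le[of 2 r] by simp
    moreover have "r + 5 \<le> 2 ^ r" using assms by (induction r rule: dec_induct) auto
    ultimately show ?thesis by simp
  qed
  have key: "int t \<in> C0 ?G \<longleftrightarrow> davenport ?G < t \<and> t < ?N \<and>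
      (\<nexists>A. A \<subseteq> carrier ?G - {\<one>\<^bsub>?G\<^esub>} \<and> card A = t \<and> set_sum A = \<one>\<^bsub>?G\<^esub>)" for t
  proof -
    have fA: "finite A" "seq_over ?G (mset_set A)" if "A \<subseteq> carrier ?G - {\<one>\<^bsub>?G\<^esub>}" for A
    proof -
      show "finite A" using that fin by (meson finite_Diff finite_subset)
      then show "seq_over ?G (mset_set A)" using that by (auto simp: seq_over_def)
    qed
    have "(\<forall>S. seq_over ?G S \<and> zero_sum ?G S \<and> size S = t \<longrightarrow> (\<exists>T. T \<subseteq># S \<and> short_zero_sum ?G T))
      \<longleftrightarrow> (\<nexists>A. A \<subseteq> carrier ?G - {\<one>\<^bsub>?G\<^esub>} \<and> card A = t \<and> set_sum A = \<one>\<^bsub>?G\<^esub>)"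
      (is "?L = ?R")
    proof
      assume L: ?L
      show ?R
      proof
        assume "\<exists>A. A \<subseteq> carrier ?G - {\<one>\<^bsub>?G\<^esub>} \<and> card A = t \<and> set_sum A = \<one>\<^bsub>?G\<^esub>"
        then obtain A where A: "A \<subseteq> carrier ?G - {\<one>\<^bsub>?G\<^esub>}" "card A = t" "set_sum A = \<one>\<^bsub>?G\<^esub>"
          by blast
        then have "\<exists>T. T \<subseteq># mset_set A \<and> short_zero_sum ?G T"
          using L fA[OF A(1)] by (simp add: zero_sum_def)
        then show False using no_short[OF fA(2)[OF A(1)]] A(1) by blast
      qed
    next
      assume R: ?R
      show ?L
      proof (intro allI impI, rule ccontr)
        fix S assume S: "seq_over ?G S \<and> zero_sum ?G S \<and> size S = t"
          and no: "\<nexists>T. T \<subseteq># S \<and> short_zero_sum ?G T"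
        then obtain A where "A \<subseteq> carrier ?G - {\<one>\<^bsub>?G\<^esub>}" "S = mset_set A"
          using no_short[of S] by blast
        then show False using R S by (auto simp: zero_sum_def)
      qed
    qed
    then show ?thesis unfolding C0_def eta by auto
  qed
  show ?thesis
  proof (rule Set.set_eqI)
    fix u :: int
    have "u \<in> C0 ?G \<longleftrightarrow> (\<exists>t. u = int t \<and> (t + 3 = ?N \<or> t + 2 = ?N))"
    proof
      assume u: "u \<in> C0 ?G"
      then have "0 \<le> u" by (simp add: C0_def)
      then obtain t where t: "u = int t" using nonneg_int_cases by blast
      have "davenport ?G < t" "t < ?N" using key u t by auto
      moreover have "\<not> (t + 4 \<le> ?N \<or> t + 1 = ?N)"
      proof
        assume h: "t + 4 \<le> ?N \<or> t + 1 = ?N"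
        have "3 \<le> t" using D1 \<open>davenport ?G < t\<close> by simp
        from exists_zero_sum_set[OF N N8 this h] show False using key[of t] u t by blast
      qed
      ultimately show "\<exists>t. u = int t \<and> (t + 3 = ?N \<or> t + 2 = ?N)" using t by auto
    next
      assume "\<exists>t. u = int t \<and> (t + 3 = ?N \<or> t + 2 = ?N)"
      then show "u \<in> C0 ?G"
        using key D2 no_zero_sum_set[OF N N8] by fastforce
    qed
    moreover have "(\<exists>t. u = int t \<and> (t + 3 = n \<or> t + 2 = n)) \<longleftrightarrow> u = int n - 3 \<or> u = int n - 2"
      if "8 \<le> n" for n
      using that by presburger
    ultimately show "u \<in> C0 ?G \<longleftrightarrow> u \<in> {int (eta ?G) - 3, int (eta ?G) - 2}"
      unfolding eta using N8(1) by blast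
  qed
qed

section \<open>Caps in the affine space of dimension 4 over the field with 3 elements\<close>

lemma exhaust_mod_3: "(x::3) = 0 \<or> x = 1 \<or> x = 2"
proof (cases x)
  case (of_int z)
  then have "z = 0 \<or> z = 1 \<or> z = 2" by auto
  then show ?thesis using of_int by auto
qed

lemma reduce_mod_3: "(3::3) = 0" "(4::3) = 1"
  by simp_all

type_synonym vec3 = "3 \<times> 3 \<times> 3 \<times> 3"

fun dot :: "vec3 \<Rightarrow> vec3 \<Rightarrow> 3" where
  "dot (a, b, c, d) (a', b', c', d') = a * a' + b * b' + c * c' + d * d'"

lemma dot_add_left: "dot (l + l') v = dot l v + dot l' v"
  by (cases l; cases l'; cases v) (simp add: algebra_simps)

lemma dot_add_right: "dot l (v + w) = dot l v + dot l w"
  by (cases l; cases v; cases w) (simp add: algebra_simps)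

lemma dot_zero [simp]: "dot 0 v = 0" "dot l 0 = 0"
  by (cases v; simp add: zero_prod_def) (cases l; simp add: zero_prod_def)

lemma dot_minus_left: "dot (- l) v = - dot l v"
  by (cases l; cases v) simp

lemma dot_diff_right: "dot l (v - w) = dot l v - dot l w"
  by (cases l; cases v; cases w) (simp add: algebra_simps)

lemma dot_sum_right: "dot l (\<Sum>x\<in>A. f x) = (\<Sum>x\<in>A. dot l (f x))"
  by (induction A rule: infinite_finite_induct) (simp_all add: dot_add_right)

lemma triple_3: "(x::3) + x + x = 0"
  using exhaust_mod_3[of x] by auto

lemma triple_vec3: "(v::vec3) + v + v = 0"
  by (cases v) (simp only: add_Pair triple_3 zero_prod_def)

lemma double_vec3: "(v::vec3) + v = - v"
  using triple_vec3[of v] by (simp add: eq_neg_iff_add_eq_0)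

lemma card_vec3: "card (UNIV :: vec3 set) = 81"
  by (simp add: card_prod UNIV_Times_UNIV[symmetric] del: UNIV_Times_UNIV)

lemma exists_dual_vector: "v \<noteq> 0 \<Longrightarrow> \<exists>l. dot l v = 1"
proof -
  assume v: "v \<noteq> 0"
  obtain a b c d where abcd: "v = (a, b, c, d)" by (cases v)
  have sq: "x \<noteq> 0 \<Longrightarrow> x * x = 1" for x :: 3
    using exhaust_mod_3[of x] by auto
  consider "a \<noteq> 0" | "b \<noteq> 0" | "c \<noteq> 0" | "d \<noteq> 0" using v abcd by (auto simp: zero_prod_def)
  then show ?thesis
  proof cases
    case 1 then show ?thesis using sq abcd by (intro exI[of _ "(a, 0, 0, 0)"]) simp
  next
    case 2 then show ?thesis using sq abcd by (intro exI[of _ "(0, b, 0, 0)"]) simp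
  next
    case 3 then show ?thesis using sq abcd by (intro exI[of _ "(0, 0, c, 0)"]) simp
  next
    case 4 then show ?thesis using sq abcd by (intro exI[of _ "(0, 0, 0, d)"]) simp
  qed
qed

definition killing :: "vec3 \<Rightarrow> vec3 set" where
  "killing v = {l. dot l v = 0}"

text \<open>Adding a functional with value 1 at \<open>v\<close> permutes the three fibres
  cyclically, so each contains a third of the 81 functionals.\<close>

lemma card_killing: assumes "v \<noteq> 0" shows "card (killing v) = 27"
proof -
  obtain l0 where l0: "dot l0 v = 1" using exists_dual_vector[OF assms] by blast
  let ?K = "\<lambda>c. {l. dot l v = c}"
  have shift: "card (?K (c + 1)) = card (?K c)" for c
  proof -
    have "?K (c + 1) = (\<lambda>l. l + l0) ` ?K c"
    proof (intro Set.set_eqI iffI)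
      fix l assume "l \<in> ?K (c + 1)"
      then have "dot (l - l0) v = c" using dot_add_left[of "l - l0" l0 v] l0 by simp
      then show "l \<in> (\<lambda>l. l + l0) ` ?K c" by (intro image_eqI[of _ _ "l - l0"]) auto
    qed (auto simp: dot_add_left l0)
    then show ?thesis by (simp add: card_image inj_on_def)
  qed
  have "(UNIV :: vec3 set) = ?K 0 \<union> ?K 1 \<union> ?K 2" using exhaust_mod_3 by auto
  then have "81 = card (?K 0 \<union> ?K 1 \<union> ?K 2)" using card_vec3 by simp
  also have "\<dots> = card (?K 0) + card (?K 1) + card (?K 2)"
    by (subst card_Un_disjoint; (subst card_Un_disjoint)?) auto
  also have "\<dots> = 3 * card (?K 0)" using shift[of 0] shift[of 1] by simp
  finally show ?thesis by (simp add: killing_def)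
qed

lemma finite_vec3 [simp]: "finite (A :: vec3 set)"
  by (rule finite_subset[OF subset_UNIV]) simp

text \<open>Of the four vectors \<open>v\<close>, \<open>w\<close>, \<open>v + w\<close>, \<open>v - w\<close> a functional kills exactly one, or all of them.\<close>

lemma card_killing_pair:
  assumes "v \<noteq> 0" "w \<noteq> 0" "v \<noteq> w" "v + w \<noteq> 0"
  shows "card (killing v \<inter> killing w) = 9"
proof -
  let ?k = "\<lambda>u l. of_bool (dot l u = 0) :: int"
  have "?k v l + ?k w l + ?k (v + w) l + ?k (v - w) l = 1 + 3 * of_bool (dot l v = 0 \<and> dot l w = 0)" for l
    using exhaust_mod_3[of "dot l v"] exhaust_mod_3[of "dot l w"]
    by (auto simp: dot_add_right dot_diff_right)
  then have "(\<Sum>l\<in>UNIV. ?k v l + ?k w l + ?k (v + w) l + ?k (v - w) l)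
      = (\<Sum>l::vec3\<in>UNIV. 1 + 3 * of_bool (l \<in> killing v \<inter> killing w))"
    by (simp add: killing_def)
  moreover have "(\<Sum>l\<in>UNIV. ?k u l) = int (card (killing u))" for u
    by (simp add: killing_def of_bool_def sum.If_cases)
  ultimately have "int (card (killing v)) + int (card (killing w)) + int (card (killing (v + w)))
      + int (card (killing (v - w))) = 81 + 3 * int (card (killing v \<inter> killing w))"
    by (simp add: sum.distrib sum_distrib_left[symmetric] card_vec3 of_bool_def sum.If_cases del: Int_iff)
  then show ?thesis using assms by (simp add: card_killing)
qed

lemma killing_0 [simp]: "killing 0 = UNIV"
  by (simp add: killing_def)

text \<open>Over the field with three elements P + Q + R = 0 says that the points coincide or form a
  line, and P = Q already forces R = P.\<close>

definition cap :: "vec3 set \<Rightarrow> bool" where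
  "cap C \<longleftrightarrow> (\<forall>P\<in>C. \<forall>Q\<in>C. \<forall>R\<in>C. P + Q + R = 0 \<longrightarrow> P = Q)"

lemma cap_subset: "cap C \<Longrightarrow> D \<subseteq> C \<Longrightarrow> cap D"
  unfolding cap_def by blast

section \<open>Moments of the level sizes by double counting\<close>

definition level :: "vec3 set \<Rightarrow> vec3 \<Rightarrow> 3 \<Rightarrow> vec3 set" where
  "level C l c = {P \<in> C. dot l P = c}"

definition lcard :: "vec3 set \<Rightarrow> vec3 \<Rightarrow> 3 \<Rightarrow> int" where
  "lcard C l c = int (card (level C l c))"

definition squares :: "vec3 set \<Rightarrow> vec3 \<Rightarrow> int" where
  "squares C l = (lcard C l 0)^2 + (lcard C l 1)^2 + (lcard C l 2)^2"

definition cubes :: "vec3 set \<Rightarrow> vec3 \<Rightarrow> int" where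
  "cubes C l = (lcard C l 0)^3 + (lcard C l 1)^3 + (lcard C l 2)^3"

lemma sum_levels: "(\<Sum>x\<in>C. f x) = (\<Sum>x\<in>level C l 0. f x) + (\<Sum>x\<in>level C l 1. f x) + (\<Sum>x\<in>level C l 2. f x)"
proof -
  have C: "C = level C l 0 \<union> level C l 1 \<union> level C l 2"
    using exhaust_mod_3 by (auto simp: level_def)
  have "(\<Sum>x\<in>level C l 0 \<union> level C l 1 \<union> level C l 2. f x)
      = (\<Sum>x\<in>level C l 0. f x) + (\<Sum>x\<in>level C l 1. f x) + (\<Sum>x\<in>level C l 2. f x)"
    by (subst sum.union_disjoint; (subst sum.union_disjoint)?) (auto simp: level_def)
  then show ?thesis using C by simp
qed

lemma lcard_nonneg: "0 \<le> lcard C l c"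
  by (simp add: lcard_def)

lemma lcard_total: "lcard C l 0 + lcard C l 1 + lcard C l 2 = int (card C)"
  using sum_levels[of "\<lambda>_. 1::int" C l] by (simp add: lcard_def)

lemma lcard_zero_functional: "lcard C 0 0 = int (card C)" "lcard C 0 1 = 0" "lcard C 0 2 = 0"
  by (simp_all add: lcard_def level_def)

text \<open>Summing over the points weights each level by its size, which raises the exponent by
  one.\<close>

lemma sum_lcard_power:
  "(\<Sum>x\<in>C. lcard C l (dot l x)) = squares C l"
  "(\<Sum>x\<in>C. (lcard C l (dot l x))^2) = cubes C l"
proof -
  have c: "(\<Sum>x\<in>level C l c. f (lcard C l (dot l x))) = lcard C l c * f (lcard C l c)" for f :: "int \<Rightarrow> int" and c
  proof -
    have "(\<Sum>x\<in>level C l c. f (lcard C l (dot l x))) = (\<Sum>x\<in>level C l c. f (lcard C l c))"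
      by (intro sum.cong) (auto simp: level_def)
    then show ?thesis by (simp add: lcard_def)
  qed
  show "(\<Sum>x\<in>C. lcard C l (dot l x)) = squares C l"
    using sum_levels[of "\<lambda>x. lcard C l (dot l x)" C l] c[of "\<lambda>n. n"]
    by (simp add: squares_def power2_eq_square)
  show "(\<Sum>x\<in>C. (lcard C l (dot l x))^2) = cubes C l"
    using sum_levels[of "\<lambda>x. (lcard C l (dot l x))^2" C l] c[of "\<lambda>n. n^2"]
    by (simp add: cubes_def power2_eq_square power3_eq_cube)
qed

lemma lcard_eq_sum: "lcard C l (dot l x) = (\<Sum>P\<in>C. of_bool (l \<in> killing (P - x)))"
proof -
  have "level C l (dot l x) = C \<inter> {P. l \<in> killing (P - x)}"
    by (auto simp: level_def killing_def dot_diff_right)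
  then show ?thesis by (simp add: lcard_def of_bool_def sum.If_cases)
qed

lemma sum_of_bool_card: "(\<Sum>l\<in>\<Lambda>. of_bool (l \<in> A)) = int (card (\<Lambda> \<inter> A))" for A :: "vec3 set"
  by (simp add: of_bool_def sum.If_cases)

lemma sum_lcard: "(\<Sum>l\<in>\<Lambda>. lcard C l (dot l x)) = (\<Sum>P\<in>C. int (card (\<Lambda> \<inter> killing (P - x))))"
  unfolding lcard_eq_sum by (subst sum.swap) (simp only: sum_of_bool_card)

lemma sum_squares: "(\<Sum>l\<in>\<Lambda>. squares C l) = (\<Sum>x\<in>C. \<Sum>P\<in>C. int (card (\<Lambda> \<inter> killing (P - x))))"
  unfolding sum_lcard_power(1)[symmetric] by (subst sum.swap) (simp only: sum_lcard)

lemma sum_lcard_square: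
  "(\<Sum>l\<in>UNIV. (lcard C l (dot l x))^2)
    = (\<Sum>P\<in>C. \<Sum>Q\<in>C. int (card (killing (P - x) \<inter> killing (Q - x))))"
proof -
  have "(lcard C l (dot l x))^2 = (\<Sum>P\<in>C. \<Sum>Q\<in>C. of_bool (l \<in> killing (P - x) \<inter> killing (Q - x)))" for l
    unfolding lcard_eq_sum power2_eq_square sum_product
    by (intro sum.cong refl) auto
  then have "(\<Sum>l\<in>UNIV. (lcard C l (dot l x))^2)
    = (\<Sum>l\<in>UNIV. \<Sum>P\<in>C. \<Sum>Q\<in>C. of_bool (l \<in> killing (P - x) \<inter> killing (Q - x)))" by simp
  also have "\<dots> = (\<Sum>P\<in>C. \<Sum>l\<in>UNIV. \<Sum>Q\<in>C. of_bool (l \<in> killing (P - x) \<inter> killing (Q - x)))"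
    by (rule sum.swap)
  also have "\<dots> = (\<Sum>P\<in>C. \<Sum>Q\<in>C. \<Sum>l\<in>UNIV. of_bool (l \<in> killing (P - x) \<inter> killing (Q - x)))"
    by (intro sum.cong refl sum.swap)
  finally show ?thesis by (simp only: sum_of_bool_card Int_UNIV_left)
qed

lemma sum_split_point:
  fixes C :: "vec3 set"
  assumes "x \<in> C" "\<And>P. P \<in> C \<Longrightarrow> P \<noteq> x \<Longrightarrow> f P = (k::int)"
  shows "(\<Sum>P\<in>C. f P) = f x + k * (int (card C) - 1)"
proof -
  have "(\<Sum>P\<in>C. f P) = f x + (\<Sum>P\<in>C - {x}. f P)" using assms(1) by (intro sum.remove) auto
  also have "(\<Sum>P\<in>C - {x}. f P) = (\<Sum>P\<in>C - {x}. k)" using assms(2) by (intro sum.cong) auto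
  also have "\<dots> = k * (int (card C) - 1)"
    using assms(1) card_gt_0_iff[of C] by (simp add: card_Diff_singleton of_nat_diff Suc_le_eq) auto
  finally show ?thesis .
qed

lemma sum_lcard_UNIV:
  assumes "x \<in> C"
  shows "(\<Sum>l\<in>UNIV. lcard C l (dot l x)) = 81 + 27 * (int (card C) - 1)"
  unfolding sum_lcard Int_UNIV_left
  using sum_split_point[OF assms, of "\<lambda>P. int (card (killing (P - x)))" 27]
  by (simp add: card_killing card_vec3)

lemma sum_squares_UNIV:
  "(\<Sum>l\<in>UNIV. squares C l) = int (card C) * (81 + 27 * (int (card C) - 1))"
  unfolding sum_squares sum_lcard[symmetric] using sum_lcard_UNIV by simp

text \<open>As -2 x = x, the sum of the two differences is P + Q + x, so the absence of lines makes
  the differences independent.\<close>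

lemma cap_card_killing:
  assumes "cap C" "P \<in> C" "Q \<in> C" "x \<in> C" "P \<noteq> x" "Q \<noteq> x" "P \<noteq> Q"
  shows "card (killing (P - x) \<inter> killing (Q - x)) = 9"
proof (rule card_killing_pair)
  have "(P - x) + (Q - x) = P + Q + x - (x + x + x)" by (simp add: algebra_simps)
  also have "\<dots> = P + Q + x" by (simp only: triple_vec3 diff_zero)
  finally have e: "(P - x) + (Q - x) = P + Q + x" .
  show "(P - x) + (Q - x) \<noteq> 0" unfolding e using assms unfolding cap_def by blast
qed (use assms in auto)

text \<open>The sum over pairs P, Q of the number of functionals killing both P - x and Q - x. The
  pairs with P = x contribute 81 + 27 (n - 1); each other P contributes 27 for Q = x, 27 for Q = P
  and 9 for every further Q.\<close>

definition pair_moment :: "int \<Rightarrow> int" where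
  "pair_moment n = 81 + 27 * (n - 1) + (n - 1) * (27 + 27 + 9 * (n - 2))"

lemma sum_lcard_square_UNIV:
  assumes C: "cap C" "x \<in> C"
  shows "(\<Sum>l\<in>UNIV. (lcard C l (dot l x))^2) = pair_moment (int (card C))"
proof -
  let ?n = "int (card C)"
  let ?K = "\<lambda>P Q. int (card (killing (P - x) \<inter> killing (Q - x)))"
  have "(\<Sum>Q\<in>C. ?K P Q) = 27 + 27 + 9 * (?n - 2)" if P: "P \<in> C" "P \<noteq> x" for P
  proof -
    have "(\<Sum>Q\<in>C. ?K P Q) = ?K P x + (\<Sum>Q\<in>C - {x}. ?K P Q)"
      using C(2) by (intro sum.remove) auto
    also have "(\<Sum>Q\<in>C - {x}. ?K P Q) = ?K P P + 9 * (int (card (C - {x})) - 1)"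
      using P C by (intro sum_split_point) (auto intro: cap_card_killing)
    also have "int (card (C - {x})) = ?n - 1"
      using C(2) card_gt_0_iff[of C] by (simp add: card_Diff_singleton of_nat_diff Suc_le_eq) auto
    finally show ?thesis using P by (simp add: card_killing)
  qed
  from sum_split_point[OF C(2), of "\<lambda>P. \<Sum>Q\<in>C. ?K P Q", OF this]
  have "(\<Sum>P\<in>C. \<Sum>Q\<in>C. ?K P Q) = (\<Sum>Q\<in>C. ?K x Q) + (27 + 27 + 9 * (?n - 2)) * (?n - 1)" .
  also have "(\<Sum>Q\<in>C. ?K x Q) = 81 + 27 * (?n - 1)"
    using sum_split_point[OF C(2), of "?K x" 27] by (simp add: card_killing card_vec3)
  finally show ?thesis unfolding sum_lcard_square pair_moment_def by (simp add: algebra_simps)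
qed

lemma sum_cubes_UNIV:
  assumes "cap C"
  shows "(\<Sum>l\<in>UNIV. cubes C l) = int (card C) * pair_moment (int (card C))"
  unfolding sum_lcard_power(2)[symmetric]
  by (subst sum.swap) (simp add: sum_lcard_square_UNIV[OF assms])

section \<open>Caps in planes and in hyperplanes\<close>

definition annihilator :: "vec3 set \<Rightarrow> vec3 set" where
  "annihilator C = {l. \<forall>P\<in>C. \<forall>Q\<in>C. dot l P = dot l Q}"

lemma annihilator_mono: "D \<subseteq> C \<Longrightarrow> annihilator C \<subseteq> annihilator D"
  unfolding annihilator_def by blast

lemma annihilator_closed:
  "0 \<in> annihilator C" "l \<in> annihilator C \<Longrightarrow> l' \<in> annihilator C \<Longrightarrow> l + l' \<in> annihilator C"
  "l \<in> annihilator C \<Longrightarrow> - l \<in> annihilator C"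
  unfolding annihilator_def mem_Collect_eq dot_add_left dot_minus_left by (simp, metis, metis)

lemma annihilator_level: "l \<in> annihilator (level C l c)" "annihilator C \<subseteq> annihilator (level C l c)"
  unfolding annihilator_def level_def by blast+

text \<open>The annihilator is a subspace whose size encodes the affine span: 9 functionals mean a
  plane, 3 a hyperplane. Three points of a cap are not collinear, so they span a plane.\<close>

lemma card_annihilator_le_9:
  assumes "cap C" "3 \<le> card C" shows "card (annihilator C) \<le> 9"
proof -
  obtain D where D: "D \<subseteq> C" "card D = 3" using assms(2) by (meson obtain_subset_with_card_n)
  then obtain x P Q where "D = {x, P, Q}" "x \<noteq> P" "x \<noteq> Q" "P \<noteq> Q" by (auto simp: card_3_iff)
  then have xPQ: "x \<in> C" "P \<in> C" "Q \<in> C" "P \<noteq> x" "Q \<noteq> x" "P \<noteq> Q" using D(1) by auto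
  have "annihilator C \<subseteq> killing (P - x) \<inter> killing (Q - x)"
    using xPQ by (auto simp: annihilator_def killing_def dot_diff_right)
  then have "card (annihilator C) \<le> card (killing (P - x) \<inter> killing (Q - x))"
    by (intro card_mono) auto
  then show ?thesis using cap_card_killing[OF assms(1) xPQ(2,3,1,4,5,6)] by simp
qed

text \<open>The cosets of \<open>A\<close> by 0, x and 2 x are disjoint subsets of \<open>B\<close>.
  This replaces dimension arguments.\<close>

lemma triple_card_le:
  fixes A B :: "vec3 set"
  assumes A: "\<And>a b. a \<in> A \<Longrightarrow> b \<in> A \<Longrightarrow> a + b \<in> A" "\<And>a. a \<in> A \<Longrightarrow> - a \<in> A"
    and B: "\<And>a b. a \<in> B \<Longrightarrow> b \<in> B \<Longrightarrow> a + b \<in> B" and AB: "A \<subseteq> B" and x: "x \<in> B" "x \<notin> A"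
  shows "3 * card A \<le> card B"
proof -
  let ?A1 = "(\<lambda>a. a + x) ` A" and ?A2 = "(\<lambda>a. a + (x + x)) ` A"
  have d1: "a \<noteq> b + x" if "a \<in> A" "b \<in> A" for a b
    using A(1)[OF that(1) A(2)[OF that(2)]] x(2) by (auto simp: algebra_simps)
  have d2: "a \<noteq> b + (x + x)" if "a \<in> A" "b \<in> A" for a b
  proof
    assume "a = b + (x + x)"
    then have "x = b + - a" by (simp add: double_vec3)
    then show False using A(1)[OF that(2) A(2)[OF that(1)]] x(2) by simp
  qed
  have d3: "a + x \<noteq> b + (x + x)" if "a \<in> A" "b \<in> A" for a b
    using d1[OF that] by (simp add: add.assoc[symmetric])
  have dis: "A \<inter> ?A1 = {}" "(A \<union> ?A1) \<inter> ?A2 = {}"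
    using d1 d2 d3 by blast+
  have "card (A \<union> ?A1 \<union> ?A2) = 3 * card A"
    using dis by (simp add: card_Un_disjoint card_image inj_on_def)
  moreover have "A \<union> ?A1 \<union> ?A2 \<subseteq> B" using AB x(1) B[OF x(1) x(1)] B by blast
  ultimately show ?thesis using card_mono[of B "A \<union> ?A1 \<union> ?A2"] by simp
qed

lemma squares_le: "squares C l \<le> (int (card C))^2"
proof -
  have "squares C l \<le> (lcard C l 0 + lcard C l 1 + lcard C l 2)^2"
    using lcard_nonneg[of C l]
    by (simp add: squares_def power2_eq_square algebra_simps)
  then show ?thesis by (simp only: lcard_total)
qed

lemma sum_squares_le:
  assumes "\<And>l. l \<notin> annihilator C \<Longrightarrow> squares C l \<le> b"
  shows "(\<Sum>l\<in>UNIV. squares C l)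
    \<le> int (card (annihilator C)) * (int (card C))^2 + (81 - int (card (annihilator C))) * b"
proof -
  let ?A = "annihilator C"
  have "(\<Sum>l\<in>UNIV. squares C l) = (\<Sum>l\<in>?A. squares C l) + (\<Sum>l\<in>- ?A. squares C l)"
    by (subst sum.union_disjoint[symmetric]) (auto simp: Compl_partition)
  also have "(\<Sum>l\<in>?A. squares C l) \<le> int (card ?A) * (int (card C))^2"
    using sum_bounded_above[of ?A "squares C"] squares_le by simp
  also have "(\<Sum>l\<in>- ?A. squares C l) \<le> int (card (- ?A)) * b"
    using sum_bounded_above[of "- ?A" "squares C"] assms by simp
  also have "int (card (- ?A)) = 81 - int (card ?A)"
    using card_mono[of "UNIV :: vec3 set" ?A] by (simp add: Compl_eq_Diff_UNIV card_Diff_subset card_vec3 of_nat_diff)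
  finally show ?thesis by simp
qed

lemma square_bound_5:
  fixes a b c :: int
  assumes "0 \<le> a" "0 \<le> b" "0 \<le> c" "a \<le> 2" "b \<le> 2" "c \<le> 2" "a + b + c = 5"
  shows "a^2 + b^2 + c^2 \<le> 9"
proof -
  have "a \<in> {0, 1, 2}" "b \<in> {0, 1, 2}" "c = 5 - a - b" using assms by auto
  then show ?thesis using assms by auto
qed

lemma square_bound_10:
  fixes a b c :: int
  assumes "0 \<le> a" "0 \<le> b" "0 \<le> c" "a \<le> 4" "b \<le> 4" "c \<le> 4" "a + b + c = 10"
  shows "a^2 + b^2 + c^2 \<le> 36"
proof -
  have "a \<in> {0, 1, 2, 3, 4}" "b \<in> {0, 1, 2, 3, 4}" "c = 10 - a - b" using assms by auto
  then show ?thesis using assms by auto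
qed

text \<open>For five points, a functional that is not constant on them has at most 2 on each level,
  hence squares at most 4 + 4 + 1. The total is then at most 9 times 25 plus 72 times 9, which is
  873, but it equals 945.\<close>

lemma cap_in_plane:
  assumes "cap C" "9 \<le> card (annihilator C)" shows "card C \<le> 4"
proof (rule ccontr)
  assume "\<not> card C \<le> 4"
  then have "5 \<le> card C" by simp
  then obtain D where D: "D \<subseteq> C" "card D = 5" by (meson obtain_subset_with_card_n)
  have capD: "cap D" using assms(1) D(1) by (rule cap_subset)
  have "9 \<le> card (annihilator D)"
    using assms(2) card_mono[OF _ annihilator_mono[OF D(1)]] by simp
  then have a9: "card (annihilator D) = 9" using card_annihilator_le_9[OF capD] D(2) by simp
  have "lcard D l c \<le> 2" if l: "l \<notin> annihilator D" for l c
  proof (rule ccontr)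
    assume "\<not> lcard D l c \<le> 2"
    then have "3 \<le> card (level D l c)" by (simp add: lcard_def)
    moreover have "cap (level D l c)" by (rule cap_subset[OF capD]) (auto simp: level_def)
    ultimately have "card (annihilator (level D l c)) \<le> 9" by (intro card_annihilator_le_9)
    moreover have "insert l (annihilator D) \<subseteq> annihilator (level D l c)"
      using annihilator_level by auto
    then have "card (insert l (annihilator D)) \<le> card (annihilator (level D l c))"
      by (intro card_mono) auto
    ultimately show False using l a9 by simp
  qed
  then have "squares D l \<le> 9" if "l \<notin> annihilator D" for l
    using square_bound_5[of "lcard D l 0" "lcard D l 1" "lcard D l 2"] that lcard_total[of D l] D(2)
      lcard_nonneg by (simp add: squares_def)
  from sum_squares_le[OF this] show False by (simp add: sum_squares_UNIV D(2) a9)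
qed

text \<open>For ten points, levels of a nonconstant functional lie in planes, so squares are at most
  16 + 16 + 4. The total 3240 then forces at least 6 functionals in the annihilator, hence 9 because
  it is a subspace, and ten points would lie in a plane.\<close>

lemma cap_in_space:
  assumes "cap C" "3 \<le> card (annihilator C)" shows "card C \<le> 9"
proof (rule ccontr)
  assume "\<not> card C \<le> 9"
  then have "10 \<le> card C" by simp
  then obtain D where D: "D \<subseteq> C" "card D = 10" by (meson obtain_subset_with_card_n)
  have capD: "cap D" using assms(1) D(1) by (rule cap_subset)
  let ?A = "annihilator D"
  have a3: "3 \<le> card ?A"
    using assms(2) card_mono[OF _ annihilator_mono[OF D(1)]] by simp
  have a8: "card ?A \<le> 8" using cap_in_plane[OF capD] D(2) by force
  have "lcard D l c \<le> 4" if l: "l \<notin> ?A" for l c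
  proof -
    have "3 * card ?A \<le> card (annihilator (level D l c))"
      using triple_card_le[of ?A "annihilator (level D l c)" l] annihilator_level annihilator_closed l
      by blast
    then have "9 \<le> card (annihilator (level D l c))" using a3 by simp
    moreover have "cap (level D l c)" by (rule cap_subset[OF capD]) (auto simp: level_def)
    ultimately show ?thesis using cap_in_plane[of "level D l c"] by (simp add: lcard_def)
  qed
  then have "squares D l \<le> 36" if "l \<notin> ?A" for l
    using square_bound_10[of "lcard D l 0" "lcard D l 1" "lcard D l 2"] that lcard_total[of D l] D(2)
      lcard_nonneg by (simp add: squares_def)
  from sum_squares_le[OF this] have a6: "6 \<le> card ?A" by (simp add: sum_squares_UNIV D(2))
  have "\<not> ?A \<subseteq> {0}" using card_mono[of "{0::vec3}" ?A] a3 by auto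
  then obtain l where l: "l \<in> ?A" "l \<noteq> 0" by auto
  let ?L = "{0, l, - l}"
  have "l \<noteq> - l" using l(2) triple_vec3[of l] by (metis add.left_neutral add_eq_0_iff2)
  then have cL: "card ?L = 3" using l(2) by auto
  have "\<not> ?A \<subseteq> ?L" using card_mono[of ?L ?A] a6 cL by auto
  then obtain l' where l': "l' \<in> ?A" "l' \<notin> ?L" by auto
  have "3 * card ?L \<le> card ?A"
  proof (rule triple_card_le[OF _ _ _ _ l'])
    show "a + b \<in> ?L" if "a \<in> ?L" "b \<in> ?L" for a b
      using that by (auto simp: double_vec3 minus_add_distrib[symmetric] simp del: minus_add_distrib)
    show "?L \<subseteq> ?A" using l(1) annihilator_closed by auto
  qed (auto intro: annihilator_closed)
  then show False using cL a8 by simp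
qed

text \<open>A level of \<open>l\<close> lies in a hyperplane, as 0, l and -l are constant on
  it.\<close>

lemma lcard_le_9:
  assumes "cap C" "l \<noteq> 0" shows "lcard C l c \<le> 9"
proof -
  have "l \<noteq> - l" using assms(2) triple_vec3[of l] by (metis add.left_neutral add_eq_0_iff2)
  then have "3 = card {0, l, - l}" using assms(2) by auto
  also have "\<dots> \<le> card (annihilator (level C l c))"
    using annihilator_level(1)[of l C c] annihilator_closed by (intro card_mono) auto
  finally have "3 \<le> card (annihilator (level C l c))" .
  moreover have "cap (level C l c)" by (rule cap_subset[OF assms(1)]) (auto simp: level_def)
  ultimately show ?thesis using cap_in_space[of "level C l c"] by (simp add: lcard_def)
qed

text \<open>Relative to level \<open>s\<close>, the points on the next two levels contribute 1 and
  2. So the sum of the points controls whether these two level sizes agree modulo 3.\<close>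

lemma mod_3_levels:
  "dot l (\<Sum>C) - of_nat (card C) * s = of_int (lcard C l (s + 1)) + 2 * of_int (lcard C l (s + 2))"
proof -
  have c: "(\<Sum>P\<in>level C l c. dot l P - s) = of_int (lcard C l c) * (c - s)" for c
  proof -
    have "(\<Sum>P\<in>level C l c. dot l P - s) = (\<Sum>P\<in>level C l c. c - s)"
      by (intro sum.cong) (auto simp: level_def)
    then show ?thesis by (simp add: lcard_def)
  qed
  have "dot l (\<Sum>C) - of_nat (card C) * s = (\<Sum>P\<in>C. dot l P - s)"
    by (simp add: sum_subtractf dot_sum_right[of l "\<lambda>x. x"])
  also have "\<dots> = of_int (lcard C l (s + 1)) + 2 * of_int (lcard C l (s + 2))"
    unfolding sum_levels[of _ C l] c
    using exhaust_mod_3[of s] exhaust_mod_3[of "of_int (lcard C l 0)"]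
      exhaust_mod_3[of "of_int (lcard C l 1)"] exhaust_mod_3[of "of_int (lcard C l 2)"]
    by (auto simp: reduce_mod_3)
  finally show ?thesis .
qed

lemma of_int_mod_3: "(of_int a + 2 * of_int b :: 3) = 0 \<longleftrightarrow> a mod 3 = b mod 3"
proof -
  have "(of_int a + 2 * of_int b :: 3) = of_int (a + 2 * b)" by simp
  also have "\<dots> = 0 \<longleftrightarrow> 3 dvd (a + 2 * b)" by (simp only: of_int_eq_0_iff_char_dvd) simp
  also have "\<dots> \<longleftrightarrow> a mod 3 = b mod 3" by presburger
  finally show ?thesis .
qed

lemma shifted_powers:
  "squares C l = (lcard C l s)^2 + (lcard C l (s + 1))^2 + (lcard C l (s + 2))^2"
  "cubes C l = (lcard C l s)^3 + (lcard C l (s + 1))^3 + (lcard C l (s + 2))^3"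
  "int (card C) = lcard C l s + lcard C l (s + 1) + lcard C l (s + 2)"
  using exhaust_mod_3[of s] lcard_total[of C l] by (auto simp: squares_def cubes_def reduce_mod_3)

text \<open>The next three inequalities are linear programming certificates: summed over all nonzero
  functionals they contradict the values of the moments.\<close>

lemma certificate_20:
  fixes a b c :: int
  assumes "0 < a" "a \<le> 9" "0 \<le> b" "b \<le> 9" "0 \<le> c" "c \<le> 9" "a + b + c = 20" "b mod 3 = c mod 3"
  shows "0 \<le> 1528 - 3 * a - 18 * (a^2 + b^2 + c^2) + (a^3 + b^3 + c^3)"
proof -
  \<comment> \<open>Ranging over a singleton, \<open>c\<close> is computed from the other two sizes
    and the check runs over pairs only.\<close>
  have "\<forall>a\<in>set [1..9::int]. \<forall>b\<in>set [0..9]. \<forall>c\<in>{20 - a - b}. c \<le> 9 \<longrightarrow> b mod 3 = c mod 3 \<longrightarrow>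
    0 \<le> 1528 - 3 * a - 18 * (a^2 + b^2 + c^2) + (a^3 + b^3 + c^3)"
    by code_simp
  moreover have "a \<in> set [1..9]" "b \<in> set [0..9]" "c \<in> {20 - a - b}" using assms by auto
  ultimately show ?thesis using assms by blast
qed

lemma certificate_21_distinct:
  fixes a b c :: int
  assumes "0 \<le> a" "a \<le> 9" "0 \<le> b" "b \<le> 9" "0 \<le> c" "c \<le> 9" "a + b + c = 21" "b mod 3 \<noteq> c mod 3"
  shows "0 \<le> 3669 - 39 * (a^2 + b^2 + c^2) + 2 * (a^3 + b^3 + c^3)"
proof -
  have "\<forall>a\<in>set [0..9::int]. \<forall>b\<in>set [0..9]. \<forall>c\<in>{21 - a - b}. c \<le> 9 \<longrightarrow> b mod 3 \<noteq> c mod 3 \<longrightarrow>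
    0 \<le> 3669 - 39 * (a^2 + b^2 + c^2) + 2 * (a^3 + b^3 + c^3)"
    by code_simp
  moreover have "a \<in> set [0..9]" "b \<in> set [0..9]" "c \<in> {21 - a - b}" using assms by auto
  ultimately show ?thesis using assms by blast
qed

lemma certificate_21_equal:
  fixes a b c :: int
  assumes "0 \<le> a" "a \<le> 9" "0 \<le> b" "b \<le> 9" "0 \<le> c" "c \<le> 9" "a + b + c = 21" "b mod 3 = c mod 3"
  shows "0 \<le> 3528 - 38 * (a^2 + b^2 + c^2) + 2 * (a^3 + b^3 + c^3)"
    "0 \<le> 1764 - 19 * (a^2 + b^2 + c^2) + (a^3 + b^3 + c^3)"
    "1764 - 19 * (a^2 + b^2 + c^2) + (a^3 + b^3 + c^3) = 0 \<Longrightarrow>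
      a^2 + b^2 + c^2 - 147 = 24 * of_bool (a^2 + b^2 + c^2 = 171)"
proof -
  have "\<forall>a\<in>set [0..9::int]. \<forall>b\<in>set [0..9]. \<forall>c\<in>{21 - a - b}. c \<le> 9 \<longrightarrow> b mod 3 = c mod 3 \<longrightarrow>
    0 \<le> 3528 - 38 * (a^2 + b^2 + c^2) + 2 * (a^3 + b^3 + c^3) \<and>
    0 \<le> 1764 - 19 * (a^2 + b^2 + c^2) + (a^3 + b^3 + c^3) \<and>
    (1764 - 19 * (a^2 + b^2 + c^2) + (a^3 + b^3 + c^3) = 0 \<longrightarrow>
      a^2 + b^2 + c^2 - 147 = 24 * of_bool (a^2 + b^2 + c^2 = 171))"
    by code_simp
  moreover have "a \<in> set [0..9]" "b \<in> set [0..9]" "c \<in> {21 - a - b}" using assms by auto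
  ultimately show "0 \<le> 3528 - 38 * (a^2 + b^2 + c^2) + 2 * (a^3 + b^3 + c^3)"
    "0 \<le> 1764 - 19 * (a^2 + b^2 + c^2) + (a^3 + b^3 + c^3)"
    "1764 - 19 * (a^2 + b^2 + c^2) + (a^3 + b^3 + c^3) = 0 \<Longrightarrow>
      a^2 + b^2 + c^2 - 147 = 24 * of_bool (a^2 + b^2 + c^2 = 171)"
    using assms by blast+
qed

lemma sum_nonzero: "(\<Sum>l\<in>UNIV - {0}. f l) = (\<Sum>l\<in>UNIV. f l) - f 0" for f :: "vec3 \<Rightarrow> int"
  using sum.remove[of UNIV 0 f] by simp

lemma card_nonzero: "card (UNIV - {0::vec3}) = 80"
  by (simp add: card_Diff_singleton card_vec3)

lemma powers_zero_functional: "squares C 0 = (int (card C))^2" "cubes C 0 = (int (card C))^3"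
  by (simp_all add: squares_def cubes_def lcard_zero_functional)

text \<open>If the sum vanished, every functional would have congruent sizes modulo 3 on the two
  levels not containing \<open>x\<close>. The certificate then applies to all 80 nonzero
  functionals, although its values add up to -162.\<close>

lemma cap_20_sum:
  assumes C: "cap C" "card C = 20" and x: "x \<in> C"
  shows "(\<Sum>C) + x \<noteq> 0"
proof
  assume s: "(\<Sum>C) + x = 0"
  have "0 \<le> 1528 - 3 * lcard C l (dot l x) - 18 * squares C l + cubes C l" if l: "l \<noteq> 0" for l
  proof -
    let ?s = "dot l x"
    have "x \<in> level C l ?s" using x by (simp add: level_def)
    then have pos: "0 < lcard C l ?s" by (auto simp: lcard_def card_gt_0_iff)
    have "dot l (\<Sum>C) + ?s = 0" using s dot_add_right[of l "\<Sum>C" x] by simp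
    \<comment> \<open>The sum has value -s at \<open>l\<close>, and -s - 20 s = -21 s is 0 modulo
      3.\<close>
    then have "dot l (\<Sum>C) - of_nat (card C) * ?s = 0"
      using exhaust_mod_3[of ?s] C(2) by (auto simp: add_eq_0_iff2)
    then have "lcard C l (?s + 1) mod 3 = lcard C l (?s + 2) mod 3"
      using mod_3_levels[of l C ?s] of_int_mod_3 by metis
    then show ?thesis
      using certificate_20[OF pos] lcard_le_9[OF C(1) l] lcard_nonneg shifted_powers[of C l ?s] C(2)
      by simp
  qed
  then have "0 \<le> (\<Sum>l\<in>UNIV - {0}. 1528 - 3 * lcard C l (dot l x) - 18 * squares C l + cubes C l)"
    by (intro sum_nonneg) auto
  also have "\<dots> = - 162"
    using sum_lcard_UNIV[OF x] sum_squares_UNIV[of C] sum_cubes_UNIV[OF C(1)]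
    by (simp add: sum.distrib sum_subtractf sum_distrib_left[symmetric] sum_nonzero card_nonzero
        powers_zero_functional lcard_zero_functional C(2) pair_moment_def)
  finally show False by simp
qed

lemma even_card_symmetric:
  assumes "0 \<notin> Z" "\<And>l. l \<in> Z \<Longrightarrow> - l \<in> (Z :: vec3 set)"
  shows "even (card Z)"
  using finite_vec3[of Z] assms
proof (induction Z rule: finite_psubset_induct)
  case (psubset Z)
  show ?case
  proof (cases "Z = {}")
    case False
    then obtain l where l: "l \<in> Z" by blast
    then have ne: "l \<noteq> - l"
      using psubset.prems(1) triple_vec3[of l] by (metis add.left_neutral add_eq_0_iff2)
    let ?Z = "Z - {l, - l}"
    have sub: "{l, - l} \<subseteq> Z" using l psubset.prems(2) by blast
    have "- x \<in> ?Z" if "x \<in> ?Z" for x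
      using that psubset.prems(2)[of x] by (metis Diff_iff insert_iff minus_minus singletonD)
    then have "even (card ?Z)"
      using l psubset.prems(1) by (intro psubset.IH) blast+
    moreover have "card ?Z = card Z - 2"
      using ne card_Diff_subset[OF _ sub] by simp
    moreover have "2 \<le> card Z" using card_mono[OF _ sub] ne by simp
    ultimately show ?thesis by simp
  qed simp
qed

text \<open>For 21 points the residues of the levels depend only on whether \<open>l\<close> kills
  the sum of the points, which selects the certificate that applies to \<open>l\<close>.\<close>

theorem cap_card_le_20:
  assumes "cap C" shows "card C \<le> 20"
proof (rule ccontr)
  assume "\<not> card C \<le> 20"
  then have "21 \<le> card C" by simp
  then obtain D where D: "D \<subseteq> C" "card D = 21" by (meson obtain_subset_with_card_n)
  have D': "cap D" using assms D(1) by (rule cap_subset)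
  have total: "(\<Sum>l\<in>UNIV. squares D l) = 13041" "(\<Sum>l\<in>UNIV. cubes D l) = 107541"
    using sum_squares_UNIV[of D] sum_cubes_UNIV[OF D'] D(2) by (simp_all add: pair_moment_def)
  let ?\<sigma> = "\<Sum>D"
  have residue: "lcard D l 1 mod 3 = lcard D l 2 mod 3 \<longleftrightarrow> dot l ?\<sigma> = 0" for l
    using mod_3_levels[of l D 0] of_int_mod_3[of "lcard D l 1" "lcard D l 2"] D(2) by simp
  have equal: "0 \<le> 3528 - 38 * squares D l + 2 * cubes D l"
    "0 \<le> 1764 - 19 * squares D l + cubes D l"
    "1764 - 19 * squares D l + cubes D l = 0 \<Longrightarrow> squares D l - 147 = 24 * of_bool (squares D l = 171)"
    if "l \<noteq> 0" "dot l ?\<sigma> = 0" for l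
    using certificate_21_equal[of "lcard D l 0" "lcard D l 1" "lcard D l 2"] residue[of l]
      lcard_le_9[OF D' that(1)] lcard_nonneg[of D l] lcard_total[of D l] D(2) that(2)
    by (simp_all add: squares_def cubes_def)
  show False
  proof (cases "?\<sigma> = 0")
    case True
    let ?Z = "{l. l \<noteq> 0 \<and> squares D l = 171}"
    let ?f = "\<lambda>l. 1764 - 19 * squares D l + cubes D l"
    \<comment> \<open>The certificate is tight, so the level sizes are 7, 7, 7 or, up to order, 9,
      9, 3, with squares 147 and 171. The surplus 840 = 24 times 35 leaves 35 functionals of the
      second kind, but these come in pairs l, -l.\<close>
    have "(\<Sum>l\<in>UNIV - {0}. ?f l) = 0"
      using total
      by (simp add: sum.distrib sum_subtractf sum_distrib_left[symmetric] sum_nonzero card_nonzero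
          powers_zero_functional D(2))
    then have zero: "?f l = 0" if "l \<noteq> 0" for l
      using sum_nonneg_eq_0_iff[of "UNIV - {0}" ?f] equal(2) True that by simp
    have "24 * int (card ?Z) = (\<Sum>l\<in>UNIV - {0}. 24 * of_bool (squares D l = 171))"
    proof -
      have "?Z = (UNIV - {0}) \<inter> {l. squares D l = 171}" by auto
      then show ?thesis by (simp add: sum_distrib_left[symmetric] of_bool_def sum.If_cases)
    qed
    also have "\<dots> = (\<Sum>l\<in>UNIV - {0}. squares D l - 147)"
    proof (intro sum.cong refl)
      fix l :: vec3 assume "l \<in> UNIV - {0}"
      then show "24 * of_bool (squares D l = 171) = squares D l - 147"
        using equal(3)[of l] zero[of l] True by simp
    qed
    also have "\<dots> = 840"
      using total
      by (simp add: sum_subtractf sum_nonzero card_nonzero powers_zero_functional D(2))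
    finally have "card ?Z = 35" by simp
    moreover have "even (card ?Z)"
    proof (rule even_card_symmetric)
      fix l assume l: "l \<in> ?Z"
      have "level D (- l) c = level D l (- c)" for c
      proof -
        have "- d = c \<longleftrightarrow> d = - c" for d :: 3 by (metis minus_minus)
        then show ?thesis by (simp add: level_def dot_minus_left)
      qed
      moreover have "- (1::3) = 2" "- (2::3) = 1" by simp_all
      ultimately have "squares D (- l) = squares D l" by (simp only: squares_def lcard_def) simp
      then show "- l \<in> ?Z" using l by simp
    qed simp
    ultimately show False by simp
  next
    case False
    let ?A = "killing ?\<sigma>"
    \<comment> \<open>Removing \<open>y\<close> leaves a 20-point cap with sum
      \<open>?\<sigma> - y\<close>, to which adding its point \<open>z\<close> cannot give
      0.\<close>
    have no_diff: "y - z \<noteq> ?\<sigma>" if "y \<in> D" "z \<in> D" for y z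
    proof (cases "y = z")
      case ne: False
      have "card (D - {y}) = 20" using D(2) that by (simp add: card_Diff_singleton)
      moreover have "cap (D - {y})" using D' by (rule cap_subset) auto
      ultimately have "\<Sum>(D - {y}) + z \<noteq> 0" using cap_20_sum that ne by blast
      moreover have "\<Sum>(D - {y}) = ?\<sigma> - y" using that by (simp add: sum_diff1)
      ultimately show ?thesis by (auto simp: algebra_simps)
    qed (use False in auto)
    \<comment> \<open>Since the sum is independent of every nonzero difference, each point
      contributes 27 + 20 times 9 = 207, and there are 21 points. The two certificates on the two
      classes of functionals then add up to -1080.\<close>
    have qA: "(\<Sum>l\<in>?A. squares D l) = 4347"
    proof -
      have "(\<Sum>P\<in>D. int (card (?A \<inter> killing (P - x)))) = 207" if x: "x \<in> D" for x
      proof -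
        have "card (?A \<inter> killing (P - x)) = 9" if "P \<in> D" "P \<noteq> x" for P
        proof (rule card_killing_pair[OF False])
          show "?\<sigma> \<noteq> P - x" using no_diff[OF that(1) x] by auto
          have "?\<sigma> + (P - x) = 0 \<longleftrightarrow> x - P = ?\<sigma>" by (auto simp: algebra_simps add_eq_0_iff)
          then show "?\<sigma> + (P - x) \<noteq> 0" using no_diff[OF x that(1)] by simp
        qed (use that in simp)
        from sum_split_point[OF x, of "\<lambda>P. int (card (?A \<inter> killing (P - x)))" 9] this
        show ?thesis by (simp add: card_killing False D(2))
      qed
      then show ?thesis unfolding sum_squares by (simp add: D(2))
    qed
    have distinct: "0 \<le> 3669 - 39 * squares D l + 2 * cubes D l" if "l \<notin> ?A" for l
    proof -
      have "l \<noteq> 0" using that by (auto simp: killing_def)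
      then show ?thesis
        using certificate_21_distinct[of "lcard D l 0" "lcard D l 1" "lcard D l 2"] residue[of l]
          lcard_le_9[OF D'] lcard_nonneg[of D l] lcard_total[of D l] D(2) that
        by (simp add: squares_def cubes_def killing_def)
    qed
    have 0: "0 \<in> ?A" by (simp add: killing_def)
    have cA: "card ?A = 27" using False by (rule card_killing)
    have split: "(\<Sum>l\<in>UNIV. f l) = f 0 + (\<Sum>l\<in>?A - {0}. f l) + (\<Sum>l\<in>- ?A. f l)" for f :: "vec3 \<Rightarrow> int"
    proof -
      have "(\<Sum>l\<in>UNIV. f l) = (\<Sum>l\<in>?A. f l) + (\<Sum>l\<in>- ?A. f l)"
        by (subst sum.union_disjoint[symmetric]) (auto simp: Compl_partition)
      then show ?thesis using sum.remove[of ?A 0 f] 0 by simp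
    qed
    have "0 \<le> (\<Sum>l\<in>?A - {0}. 3528 - 38 * squares D l + 2 * cubes D l)"
      using equal(1) by (intro sum_nonneg) (auto simp: killing_def)
    moreover have "(\<Sum>l\<in>?A - {0}. 3528 - 38 * squares D l + 2 * cubes D l)
      = 26 * 3528 - 38 * (\<Sum>l\<in>?A - {0}. squares D l) + 2 * (\<Sum>l\<in>?A - {0}. cubes D l)"
      using cA 0 by (simp add: sum.distrib sum_subtractf sum_distrib_left[symmetric] card_Diff_singleton)
    moreover have "0 \<le> (\<Sum>l\<in>- ?A. 3669 - 39 * squares D l + 2 * cubes D l)"
      using distinct by (intro sum_nonneg) auto
    moreover have "(\<Sum>l\<in>- ?A. 3669 - 39 * squares D l + 2 * cubes D l)
      = 54 * 3669 - 39 * (\<Sum>l\<in>- ?A. squares D l) + 2 * (\<Sum>l\<in>- ?A. cubes D l)"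
      using cA by (simp add: sum.distrib sum_subtractf sum_distrib_left[symmetric] Compl_eq_Diff_UNIV
          card_Diff_subset card_vec3)
    moreover have "(\<Sum>l\<in>?A - {0}. squares D l) = 3906"
      using qA sum.remove[of ?A 0 "squares D"] 0 by (simp add: powers_zero_functional D(2))
    moreover have "(\<Sum>l\<in>- ?A. squares D l) = 8694"
      using split[of "squares D"] total(1) calculation(5) by (simp add: powers_zero_functional D(2))
    moreover have "(\<Sum>l\<in>?A - {0}. cubes D l) + (\<Sum>l\<in>- ?A. cubes D l) = 98280"
      using split[of "cubes D"] total(2) by (simp add: powers_zero_functional D(2))
    ultimately show False by linarith
  qed
qed

section \<open>The group \<open>C\<^sub>3\<^sup>4\<close>\<close>

definition short_free :: "vec3 multiset \<Rightarrow> bool" where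
  "short_free M \<longleftrightarrow> (\<forall>T. T \<subseteq># M \<and> T \<noteq> {#} \<and> size T \<le> 3 \<longrightarrow> \<Sum>\<^sub># T \<noteq> 0)"

lemma short_freeD: "short_free M \<Longrightarrow> T \<subseteq># M \<Longrightarrow> T \<noteq> {#} \<Longrightarrow> size T \<le> 3 \<Longrightarrow> \<Sum>\<^sub># T \<noteq> 0"
  unfolding short_free_def by blast

lemma short_free_count:
  assumes "short_free M" shows "count M x \<le> 2"
proof (rule ccontr)
  assume "\<not> count M x \<le> 2"
  then have "3 \<le> count M x" by simp
  then have "replicate_mset 3 x \<subseteq># M" by (simp only: count_le_replicate_mset_subset_eq)
  then have "\<Sum>\<^sub># (replicate_mset 3 x) \<noteq> 0"
    using assms by (intro short_freeD) auto
  moreover have "\<Sum>\<^sub># (replicate_mset 3 x) = x + x + x"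
    by (simp add: numeral_3_eq_3 add.assoc)
  ultimately show False using triple_vec3[of x] by simp
qed

lemma mset_set_subset_mset: "A \<subseteq> set_mset M \<Longrightarrow> mset_set A \<subseteq># M"
  by (intro mset_subset_eqI) (auto simp: count_mset_set' Suc_le_eq subset_iff)

text \<open>A zero-sum pair x, -x forms a line with 0, so adjoining 0 turns all relations of length
  at most 3 between distinct terms into lines. One of the 20 possible points is spent on 0.\<close>

lemma short_free_cap:
  assumes M: "short_free M"
  shows "0 \<notin># M" "cap (insert 0 (set_mset M))" "card (set_mset M) \<le> 19"
proof -
  show 0: "0 \<notin># M"
  proof
    assume "0 \<in># M"
    then have "{#0#} \<subseteq># M" by simp
    then show False using short_freeD[OF M, of "{#0#}"] by simp
  qed
  have no: "\<Sum>A \<noteq> 0" if A: "A \<subseteq> set_mset M" "A \<noteq> {}" "card A \<le> 3" for A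
  proof -
    have "\<Sum>\<^sub># (mset_set A) \<noteq> 0"
      using A mset_set_subset_mset[OF A(1)] by (intro short_freeD[OF M]) (auto simp: mset_set_empty_iff)
    then show ?thesis by (simp add: sum_unfold_sum_mset)
  qed
  show cap: "cap (insert 0 (set_mset M))"
    unfolding cap_def
  proof (intro ballI impI, rule ccontr)
    fix P Q R
    assume PQR: "P \<in> insert 0 (set_mset M)" "Q \<in> insert 0 (set_mset M)" "R \<in> insert 0 (set_mset M)"
      and s: "P + Q + R = 0" and ne: "P \<noteq> Q"
    have RP: "R \<noteq> P"
    proof
      assume "R = P"
      then have "P + Q + P = P + P + P" using s triple_vec3[of P] by simp
      then show False using ne by simp
    qed
    have RQ: "R \<noteq> Q"
    proof
      assume "R = Q"
      then have "P + Q + Q = Q + Q + Q" using s triple_vec3[of Q] by simp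
      then show False using ne by simp
    qed
    \<comment> \<open>Dropping 0 from a line leaves a nonempty set of terms with the same
      sum.\<close>
    let ?A = "{P, Q, R} - {0}"
    have "\<Sum>?A = \<Sum>{P, Q, R}" by (intro sum.mono_neutral_left) auto
    also have "\<dots> = 0" using s ne RP RQ by (simp add: add.assoc)
    finally have "\<Sum>?A = 0" .
    moreover have "?A \<subseteq> set_mset M" using PQR by blast
    moreover have "?A \<noteq> {}" using ne by blast
    moreover have "card ?A \<le> 3"
    proof -
      have "card ?A \<le> card {P, Q, R}" by (intro card_mono) auto
      also have "\<dots> \<le> 3" using card_length[of "[P, Q, R]"] by simp
      finally show ?thesis .
    qed
    ultimately show False using no by blast
  qed
  show "card (set_mset M) \<le> 19" using cap_card_le_20[OF cap] 0 by simp
qed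

lemma size_le_double_card:
  assumes "short_free M" shows "size M \<le> 2 * card (set_mset M)"
proof -
  have "size M = (\<Sum>x\<in>set_mset M. count M x)" by (rule size_multiset_overloaded_eq)
  also have "\<dots> \<le> (\<Sum>x\<in>set_mset M. 2)" using short_free_count[OF assms] by (intro sum_mono) auto
  finally show ?thesis by simp
qed

lemma short_free_large_sum:
  assumes M: "short_free M" and size: "37 \<le> size M"
  shows "\<Sum>\<^sub># M \<noteq> 0"
proof
  assume s: "\<Sum>\<^sub># M = 0"
  let ?A = "set_mset M"
  \<comment> \<open>\<open>M\<close> together with its simple points is the doubled support. From 37
    terms on there is at most one simple point, and since tripling gives 0 the 20-point cap with 0
    adjoined would have sum cancelled by that point, or by 0 itself.\<close>
  let ?R = "mset_set {x \<in> ?A. count M x = 1}"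
  have card: "card ?A = 19" using size_le_double_card[OF M] size short_free_cap(3)[OF M] by simp
  have "M + ?R = mset_set ?A + mset_set ?A"
  proof (rule multiset_eqI)
    fix x
    show "count (M + ?R) x = count (mset_set ?A + mset_set ?A) x"
    proof (cases "x \<in># M")
      case True
      then have "0 < count M x" by simp
      then have "count M x = 1 \<or> count M x = 2" using short_free_count[OF M, of x] by linarith
      then show ?thesis using True by (auto simp: count_mset_set')
    qed (simp add: count_mset_set' not_in_iff)
  qed
  note eq = this
  have e: "size M + size ?R = 2 * card ?A" "\<Sum>\<^sub># M + \<Sum>\<^sub># ?R = \<Sum>?A + \<Sum>?A"
    using arg_cong[OF eq, of size] arg_cong[OF eq, of sum_mset] sum_unfold_sum_mset[of "\<lambda>x. x" ?A]
    by simp_all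
  have sC: "\<Sum>(insert 0 ?A) = \<Sum>?A" using short_free_cap(1)[OF M] by simp
  have C: "cap (insert 0 ?A)" "card (insert 0 ?A) = 20"
    using short_free_cap[OF M] card by simp_all
  have "\<Sum>?A + \<Sum>\<^sub># ?R = \<Sum>?A + \<Sum>?A + \<Sum>?A" using e(2) s by (simp add: add.assoc)
  then have sR: "\<Sum>(insert 0 ?A) + \<Sum>\<^sub># ?R = 0" unfolding sC using triple_vec3 by simp
  have "size ?R \<le> 1" using e(1) card size by simp
  then consider "size ?R = 0" | "size ?R = 1" by linarith
  then show False
  proof cases
    case 1
    then have "?R = {#}" by (simp only: size_eq_0_iff_empty)
    then show False using cap_20_sum[OF C, of 0] sR by simp
  next
    case 2
    then obtain x where x: "?R = {#x#}" using size_1_singleton_mset by blast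
    then have "x \<in># ?R" by simp
    then have "x \<in> insert 0 ?A" by simp
    then show False using cap_20_sum[OF C] sR unfolding x by simp
  qed
qed

section \<open>Translation between the group and vectors\<close>

definition embed3 :: "(nat \<Rightarrow> int) \<Rightarrow> vec3" where
  "embed3 x = (of_int (x 0), of_int (x 1), of_int (x 2), of_int (x 3))"

lemma of_int_mod_self: "(of_int (z mod 3) :: 3) = of_int z"
proof -
  have "(of_int z :: 3) = of_int (3 * (z div 3) + z mod 3)" by simp
  also have "\<dots> = 3 * of_int (z div 3) + of_int (z mod 3)" by (simp only: of_int_add of_int_mult of_int_numeral)
  finally show ?thesis by (simp only: reduce_mod_3 mult_zero_left add_0_left)
qed

abbreviation (input) C34 :: "(nat \<Rightarrow> int) monoid" where
  "C34 \<equiv> cyclic_power 3 4"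

lemma embed3_mult: "embed3 (x \<otimes>\<^bsub>C34\<^esub> y) = embed3 x + embed3 y"
  using of_int_mod_self by (simp add: embed3_def mult_cyclic_power)

lemma embed3_one: "embed3 \<one>\<^bsub>C34\<^esub> = 0"
  by (simp add: embed3_def one_cyclic_power zero_prod_def)

lemma embed3_eq_zero:
  assumes "x \<in> carrier C34" "embed3 x = 0" shows "x = \<one>\<^bsub>C34\<^esub>"
proof -
  have x: "x \<in> {..<4} \<rightarrow>\<^sub>E {0..<3}" using assms(1) carrier_cyclic_power[of 3 4] by simp
  have d: "(of_int z :: 3) = 0 \<Longrightarrow> 3 dvd z" for z by (simp add: of_int_eq_0_iff_char_dvd)
  have dv: "3 dvd x 0" "3 dvd x 1" "3 dvd x 2" "3 dvd x 3"
    using assms(2) d by (auto simp: embed3_def zero_prod_def)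
  have "x i = 0" if "i < 4" for i
  proof -
    have "i = 0 \<or> i = 1 \<or> i = 2 \<or> i = 3" using that by auto
    then have "3 dvd x i" using dv by auto
    moreover have "0 \<le> x i" "x i < 3" using PiE_mem[OF x, of i] that by auto
    ultimately show ?thesis by presburger
  qed
  moreover have "x i = undefined" if "\<not> i < 4" for i using PiE_arb[OF x, of i] that by simp
  ultimately show ?thesis unfolding one_cyclic_power by (intro ext) simp
qed

lemma embed3_seq_sum:
  assumes "seq_over C34 S" shows "embed3 (seq_sum C34 S) = \<Sum>\<^sub># (image_mset embed3 S)"
proof -
  interpret comm_group C34 by (rule comm_group_cyclic_power)
  show ?thesis using assms
    by (induction S) (auto simp: embed3_one embed3_mult seq_sum_add_mset seq_over_def)
qed

lemma zero_sum_iff_embed3: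
  assumes "seq_over C34 S" shows "zero_sum C34 S \<longleftrightarrow> \<Sum>\<^sub># (image_mset embed3 S) = 0"
proof -
  interpret comm_group C34 by (rule comm_group_cyclic_power)
  show ?thesis
    using embed3_eq_zero[OF seq_sum_closed[OF assms]] embed3_seq_sum[OF assms] embed3_one
    by (auto simp: zero_sum_def)
qed

lemma group_exp_C34: "group_exp C34 = 3"
  by (rule group_exp_cyclic_power) simp_all

lemma short_free_embed3:
  assumes S: "seq_over C34 S" and no: "\<nexists>T. T \<subseteq># S \<and> short_zero_sum C34 T"
  shows "short_free (image_mset embed3 S)"
  unfolding short_free_def
proof (intro allI impI, elim conjE)
  fix U assume U: "U \<subseteq># image_mset embed3 S" "U \<noteq> {#}" "size U \<le> 3"
  obtain T where T: "T \<subseteq># S" "U = image_mset embed3 T"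
    using U(1) by (rule subset_image_mset_preimage)
  have "seq_over C34 T" using S T(1) by (auto simp: seq_over_def dest: mset_subset_eqD)
  moreover have "\<not> short_zero_sum C34 T" using no T(1) by blast
  ultimately show "\<Sum>\<^sub># U \<noteq> 0"
    using U(2,3) T(2) zero_sum_iff_embed3
    by (auto simp: short_zero_sum_def group_exp_C34 Suc_le_eq nonempty_has_size)
qed

section \<open>Explicit zero-sum sequences of lengths 4 to 36\<close>

type_synonym quad = "int \<times> int \<times> int \<times> int"

text \<open>The 20 nonzero zeros of the elliptic quadratic form \<open>x\<^sub>1\<^sup>2 + x\<^sub>2\<^sup>2 + x\<^sub>3x\<^sub>4\<close> form a cap; translated such
  that one of them becomes 0, these are the other 19.\<close>

definition cap_points :: "quad list" where
  "cap_points = [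
    (0, 0, 0, 1), (0, 0, 1, 2), (0, 0, 2, 2), (0, 1, 1, 1), (0, 1, 2, 0), (0, 2, 1, 1),
    (0, 2, 2, 0), (1, 0, 1, 1), (1, 0, 2, 0), (1, 1, 1, 0), (1, 1, 2, 1), (1, 2, 1, 0),
    (1, 2, 2, 1), (2, 0, 1, 1), (2, 0, 2, 0), (2, 1, 1, 0), (2, 1, 2, 1), (2, 2, 1, 0),
    (2, 2, 2, 1)]"

text \<open>Multiplicities of the points in a zero-sum sequence of length \<open>t\<close>, for \<open>4 \<le> t \<le> 36\<close>,
  found by random search.\<close>

definition multiplicities :: "nat list list" where
  "multiplicities = [
    [1, 0, 0, 0, 0, 1, 0, 1, 0, 0, 0, 0, 0, 0, 0, 1, 0, 0, 0],
    [0, 0, 1, 0, 0, 0, 0, 0, 1, 0, 0, 1, 0, 0, 1, 0, 1, 0, 0],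
    [0, 2, 0, 0, 1, 0, 0, 0, 0, 0, 0, 0, 0, 0, 0, 0, 1, 1, 1],
    [0, 1, 0, 0, 0, 0, 0, 2, 0, 1, 1, 1, 1, 0, 0, 0, 0, 0, 0],
    [0, 0, 1, 1, 0, 0, 0, 1, 0, 0, 1, 1, 0, 0, 1, 1, 1, 0, 0],
    [0, 1, 0, 0, 0, 0, 1, 0, 1, 0, 0, 0, 1, 1, 1, 0, 1, 1, 1],
    [0, 1, 1, 2, 0, 1, 0, 0, 1, 0, 1, 1, 1, 0, 1, 0, 0, 0, 0],
    [1, 0, 1, 0, 1, 1, 0, 0, 1, 0, 0, 0, 1, 1, 1, 0, 2, 0, 1],
    [2, 0, 0, 1, 0, 1, 0, 1, 2, 0, 1, 0, 0, 1, 0, 0, 1, 1, 1],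
    [0, 1, 2, 0, 0, 1, 1, 0, 1, 1, 1, 0, 1, 1, 0, 1, 1, 0, 1],
    [1, 0, 0, 1, 1, 0, 2, 0, 0, 1, 0, 2, 0, 1, 2, 2, 0, 1, 0],
    [1, 0, 0, 1, 0, 1, 2, 1, 1, 1, 0, 1, 1, 2, 1, 0, 1, 0, 1],
    [0, 0, 1, 2, 0, 1, 1, 1, 1, 1, 0, 0, 1, 2, 1, 1, 1, 0, 2],
    [1, 0, 1, 1, 1, 1, 2, 2, 1, 0, 0, 1, 1, 0, 1, 1, 1, 2, 0],
    [1, 1, 0, 1, 0, 1, 1, 2, 2, 2, 0, 1, 1, 0, 2, 1, 1, 1, 0],
    [0, 1, 1, 0, 0, 0, 2, 2, 2, 1, 1, 0, 0, 2, 2, 0, 1, 2, 2],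
    [1, 2, 1, 1, 2, 1, 1, 1, 1, 1, 0, 1, 0, 1, 2, 2, 1, 1, 0],
    [0, 2, 2, 2, 1, 0, 2, 0, 2, 1, 0, 0, 0, 1, 1, 2, 2, 1, 2],
    [1, 1, 1, 1, 0, 1, 1, 2, 1, 1, 1, 2, 1, 2, 2, 1, 2, 1, 0],
    [0, 1, 2, 1, 1, 2, 0, 1, 2, 0, 2, 1, 2, 1, 1, 1, 1, 2, 2],
    [1, 1, 1, 1, 0, 2, 2, 2, 2, 1, 1, 1, 1, 1, 1, 2, 1, 2, 1],
    [2, 1, 2, 1, 1, 1, 2, 2, 1, 1, 2, 1, 2, 0, 1, 2, 1, 1, 1],
    [1, 1, 1, 2, 2, 1, 2, 2, 1, 1, 2, 0, 2, 2, 2, 2, 2, 0, 0],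
    [1, 2, 1, 1, 2, 2, 2, 1, 2, 0, 2, 2, 1, 1, 0, 2, 1, 2, 2],
    [2, 1, 1, 1, 2, 1, 2, 1, 2, 2, 1, 2, 1, 2, 2, 1, 0, 2, 2],
    [2, 2, 2, 2, 2, 1, 2, 1, 2, 1, 1, 1, 2, 1, 1, 2, 1, 1, 2],
    [2, 2, 0, 1, 2, 2, 1, 1, 2, 2, 1, 2, 2, 1, 2, 2, 2, 1, 2],
    [0, 2, 2, 2, 2, 2, 2, 1, 1, 2, 1, 2, 1, 2, 1, 2, 2, 2, 2],
    [2, 0, 2, 2, 1, 2, 1, 2, 2, 1, 2, 2, 2, 2, 2, 2, 2, 2, 1],
    [2, 2, 2, 2, 2, 1, 2, 1, 1, 2, 2, 2, 2, 2, 2, 2, 2, 0, 2],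
    [2, 2, 1, 2, 2, 2, 1, 2, 2, 2, 2, 1, 2, 2, 2, 2, 2, 1, 2],
    [2, 2, 1, 2, 2, 2, 2, 2, 1, 2, 2, 2, 2, 2, 1, 2, 2, 2, 2],
    [0, 2, 2, 2, 2, 2, 2, 2, 2, 2, 2, 2, 2, 2, 2, 2, 2, 2, 2]]"

fun quad_list :: "quad \<Rightarrow> int list" where
  "quad_list (a, b, c, d) = [a, b, c, d]"

definition expand :: "nat list \<Rightarrow> quad list" where
  "expand ms = concat (map2 replicate ms cap_points)"

text \<open>The point that completes a line modulo 3, or the common point if the arguments coincide
  modulo 3.\<close>

fun third_point :: "quad \<Rightarrow> quad \<Rightarrow> quad" where
  "third_point (a, b, c, d) (a', b', c', d') =
    ((- a - a') mod 3, (- b - b') mod 3, (- c - c') mod 3, (- d - d') mod 3)"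

definition reduced :: "quad \<Rightarrow> bool" where
  "reduced x \<longleftrightarrow> (\<forall>a\<in>set (quad_list x). 0 \<le> a \<and> a < 3)"

lemma cap_points_cap:
  "\<forall>x\<in>set cap_points. reduced x \<and> x \<noteq> (0, 0, 0, 0) \<and> third_point x (0, 0, 0, 0) \<notin> set cap_points \<and>
    (\<forall>y\<in>set cap_points. x \<noteq> y \<longrightarrow> third_point x y \<notin> set cap_points)"
  by code_simp

lemma multiplicities_le_2: "\<forall>ms\<in>set multiplicities. \<forall>m\<in>set ms. m \<le> 2"
  by code_simp

text \<open>The rows start at length 4, hence the shift of the index. The singleton names the
  expanded list within an executable formula.\<close>

lemma multiplicities_zero_sum:
  "\<forall>t\<in>set [4..<37]. \<forall>xs\<in>{expand (multiplicities ! (t - 4))}. length xs = t \<and>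
    (\<forall>i\<in>set [0..<4]. (\<Sum>x\<leftarrow>xs. quad_list x ! i) mod 3 = 0)"
  by code_simp

lemma length_multiplicities: "length multiplicities = 33"
  by (simp add: multiplicities_def)

lemma distinct_cap_points: "distinct cap_points"
  by (simp add: cap_points_def)

lemma length_cap_points: "length cap_points = 19"
  by (simp add: cap_points_def)

text \<open>All example sequences lie in the doubled cap, so it is enough to rule out short zero-sum
  subsequences there.\<close>

lemma expand_subset:
  assumes "\<forall>m\<in>set ms. m \<le> 2" shows "mset (expand ms) \<subseteq># mset cap_points + mset cap_points"
proof -
  have "mset (concat (map2 replicate ms ps)) \<subseteq># mset ps + mset ps" for ps :: "quad list"
    using assms
  proof (induction ms arbitrary: ps)
    case (Cons m ms)
    show ?case
    proof (cases ps)
      case ps: (Cons p qs)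
      have "m \<le> count (replicate_mset 2 p) p" using Cons.prems by simp
      then have "replicate_mset m p \<subseteq># replicate_mset 2 p"
        by (simp only: count_le_replicate_mset_subset_eq)
      moreover have "mset (concat (map2 replicate ms qs)) \<subseteq># mset qs + mset qs" using Cons by simp
      ultimately have "replicate_mset m p + mset (concat (map2 replicate ms qs))
          \<subseteq># replicate_mset 2 p + (mset qs + mset qs)"
        by (rule subset_mset.add_mono)
      then show ?thesis by (simp add: ps numeral_2_eq_2)
    qed simp
  qed simp
  then show ?thesis by (simp add: expand_def)
qed

definition point :: "quad \<Rightarrow> nat \<Rightarrow> int" where
  "point x = (\<lambda>i\<in>{..<4}. quad_list x ! i mod 3)"

lemma seq_over_points: "seq_over C34 (image_mset point M)"
  by (auto simp: seq_over_def carrier_cyclic_power point_def split: if_splits)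

lemma zero_sum_points:
  "zero_sum C34 (image_mset point M) \<longleftrightarrow> (\<forall>i<4. (\<Sum>x\<in>#M. quad_list x ! i) mod 3 = 0)"
proof -
  have "seq_sum C34 (image_mset point M) = (\<lambda>i\<in>{..<4}. (\<Sum>x\<in>#M. quad_list x ! i) mod 3)"
    using seq_sum_cyclic_power[of 3 4 "\<lambda>i x. quad_list x ! i" M] by (simp add: point_def[abs_def])
  then show ?thesis by (auto simp: zero_sum_def one_cyclic_power fun_eq_iff restrict_def)
qed

lemma third_point_unique:
  assumes "reduced z" "\<forall>i<4. (quad_list x ! i + quad_list y ! i + quad_list z ! i) mod 3 = 0"
  shows "z = third_point x y"
proof -
  obtain a b c d where x: "x = (a, b, c, d)" by (cases x)
  obtain a' b' c' d' where y: "y = (a', b', c', d')" by (cases y)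
  obtain a'' b'' c'' d'' where z: "z = (a'', b'', c'', d'')" by (cases z)
  have *: "w = (- u - v) mod 3" if "(u + v + w) mod 3 = 0" "0 \<le> w" "w < 3" for u v w :: int
    using that by presburger
  have r: "0 \<le> a''" "a'' < 3" "0 \<le> b''" "b'' < 3" "0 \<le> c''" "c'' < 3" "0 \<le> d''" "d'' < 3"
    using assms(1) by (simp_all add: reduced_def z)
  have m: "(a + a' + a'') mod 3 = 0" "(b + b' + b'') mod 3 = 0" "(c + c' + c'') mod 3 = 0"
    "(d + d' + d'') mod 3 = 0"
    using assms(2)[rule_format, of 0] assms(2)[rule_format, of 1] assms(2)[rule_format, of 2]
      assms(2)[rule_format, of 3]
    by (simp_all add: x y z)
  have "a'' = (- a - a') mod 3" "b'' = (- b - b') mod 3" "c'' = (- c - c') mod 3"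
    "d'' = (- d - d') mod 3"
    using *[OF m(1) r(1,2)] *[OF m(2) r(3,4)] *[OF m(3) r(5,6)] *[OF m(4) r(7,8)] .
  then show ?thesis unfolding x y z third_point.simps prod.inject by blast
qed

text \<open>One or two terms with sum 0 give a line after filling up with 0, which
  \<open>cap_points_cap\<close> excludes. Three terms with sum 0 must coincide, but multiplicities
  are at most 2.\<close>

lemma points_no_short_zero_sum:
  assumes M: "M \<subseteq># mset cap_points + mset cap_points" and T: "T \<subseteq># image_mset point M"
  shows "\<not> short_zero_sum C34 T"
proof
  assume short: "short_zero_sum C34 T"
  obtain U where U: "U \<subseteq># M" "T = image_mset point U"
    using T by (rule subset_image_mset_preimage)
  have UM: "U \<subseteq># mset cap_points + mset cap_points" using U(1) M by (rule subset_mset.order_trans)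
  have size: "1 \<le> size U" "size U \<le> 3"
    using short U(2) by (auto simp: short_zero_sum_def group_exp_C34)
  have z: "(\<Sum>x\<in>#U. quad_list x ! i) mod 3 = 0" if "i < 4" for i
    using short U(2) zero_sum_points[of U] that by (simp add: short_zero_sum_def)
  have mem: "x \<in> set cap_points" if "x \<in># U" for x
    using mset_subset_eqD[OF UM that] by simp
  have count: "count U x \<le> 2" for x
  proof -
    have "\<forall>x. count (mset cap_points) x = (if x \<in> set cap_points then 1 else 0)"
      using distinct_cap_points unfolding distinct_count_atmost_1 .
    from spec[OF this, of x] have "count (mset cap_points) x \<le> 1" by (simp split: if_splits)
    moreover have "count U x \<le> count (mset cap_points) x + count (mset cap_points) x"
      using mset_subset_eq_count[OF UM, of x] by simp
    ultimately show ?thesis by simp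
  qed
  let ?o = "(0, 0, 0, 0) :: quad"
  have o: "quad_list ?o ! i = 0" if "i < 4" for i
  proof -
    have "i = 0 \<or> i = 1 \<or> i = 2 \<or> i = 3" using that by auto
    then show ?thesis by auto
  qed
  note cap = bspec[OF cap_points_cap]
  consider "size U = 1" | "size U = 2" | "size U = 3" using size by linarith
  then show False
  proof cases
    case 1
    then obtain x where x: "U = {#x#}" using size_1_singleton_mset by blast
    then have xc: "x \<in> set cap_points" using mem by simp
    have "x = third_point ?o ?o" using z o cap[OF xc] by (intro third_point_unique) (simp_all add: x)
    then show False using cap[OF xc] by simp
  next
    case 2
    then obtain x V where V: "U = add_mset x V" "size V = 1"
      using size_eq_Suc_imp_eq_union[of U 1] by auto
    then obtain y where U2: "U = {#x, y#}" using size_1_singleton_mset by blast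
    then have c: "x \<in> set cap_points" "y \<in> set cap_points" using mem by simp_all
    have "y = third_point x ?o"
      using z o cap[OF c(2)] by (intro third_point_unique) (simp_all add: U2)
    then show False using cap[OF c(1)] c(2) by blast
  next
    case 3
    then obtain x V where V: "U = add_mset x V" "size V = 2"
      using size_eq_Suc_imp_eq_union[of U 2] by auto
    then obtain y W where W: "V = add_mset y W" "size W = 1"
      using size_eq_Suc_imp_eq_union[of V 1] by auto
    then obtain w where U3: "U = {#x, y, w#}" using size_1_singleton_mset V by blast
    then have c: "x \<in> set cap_points" "y \<in> set cap_points" "w \<in> set cap_points" using mem by simp_all
    have w: "w = third_point x y"
      using z cap[OF c(3)] by (intro third_point_unique) (simp_all add: U3 add.assoc)
    have x: "x = third_point y w"
      using z cap[OF c(1)] by (intro third_point_unique) (simp_all add: U3 ac_simps)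
    have "x = y" using cap[OF c(1)] c(2,3) w by blast
    moreover have "y = w" using cap[OF c(2)] c(1,3) x by blast
    ultimately show False using count[of x] by (simp add: U3)
  qed
qed

lemma C34_example:
  assumes "4 \<le> t" "t \<le> 36"
  shows "\<exists>S. seq_over C34 S \<and> zero_sum C34 S \<and> size S = t \<and> (\<forall>T. T \<subseteq># S \<longrightarrow> \<not> short_zero_sum C34 T)"
proof -
  let ?ms = "multiplicities ! (t - 4)"
  let ?xs = "expand ?ms"
  have "t \<in> set [4..<37]" using assms unfolding set_upt atLeastLessThan_iff by linarith
  then have xs: "length ?xs = t" "\<forall>i\<in>set [0..<4]. (\<Sum>x\<leftarrow>?xs. quad_list x ! i) mod 3 = 0"
    using multiplicities_zero_sum by blast+
  have "?ms \<in> set multiplicities" using assms length_multiplicities by (intro nth_mem) simp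
  then have "mset ?xs \<subseteq># mset cap_points + mset cap_points"
    using multiplicities_le_2 by (intro expand_subset) blast
  moreover have "zero_sum C34 (image_mset point (mset ?xs))"
    unfolding zero_sum_points using xs(2) by (simp flip: sum_mset_sum_list)
  ultimately show ?thesis
    using xs(1) seq_over_points points_no_short_zero_sum
    by (intro exI[of _ "image_mset point (mset ?xs)"]) simp
qed

section \<open>The values for C_3^4\<close>

theorem eta_C34: "eta C34 = 39"
proof -
  interpret comm_group C34 by (rule comm_group_cyclic_power)
  show ?thesis
  proof (rule eta_eqI)
    fix S assume S: "seq_over C34 S" "39 \<le> size S"
    show "\<exists>T. T \<subseteq># S \<and> short_zero_sum C34 T"
    proof (rule ccontr)
      assume "\<not> ?thesis"
      then have "short_free (image_mset embed3 S)" using short_free_embed3[OF S(1)] by blast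
      then show False using size_le_double_card short_free_cap(3) S(2) by fastforce
    qed
  next
    let ?M = "mset cap_points + mset cap_points"
    show "seq_over C34 (image_mset point ?M)" by (rule seq_over_points)
    show "39 \<le> size (image_mset point ?M) + 1" by (simp add: length_cap_points)
    show "\<not> short_zero_sum C34 T" if "T \<subseteq># image_mset point ?M" for T
      using that by (intro points_no_short_zero_sum[of ?M]) simp_all
  qed
qed

theorem C0_C34: "C0 C34 = {37, 38}"
proof -
  interpret comm_group C34 by (rule comm_group_cyclic_power)
  have fin: "finite (carrier C34)" by (simp add: finite_cyclic_power)
  have D9: "davenport C34 \<le> 9" using davenport_cyclic_power_le[of 3 4] by simp
  \<comment> \<open>Among three terms every nonempty zero-sum subsequence is short, and three points
    of the cap have none. Hence all relevant lengths lie in the range of the examples.\<close>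
  have D4: "4 \<le> davenport C34"
  proof (rule ccontr)
    assume "\<not> 4 \<le> davenport C34"
    let ?M = "mset (take 3 cap_points)"
    have "davenport C34 \<le> size (image_mset point ?M)"
      using \<open>\<not> 4 \<le> davenport C34\<close> by (simp add: length_cap_points)
    then obtain T where T: "T \<subseteq># image_mset point ?M" "T \<noteq> {#}" "zero_sum C34 T"
      using davenport_zero_sum[OF fin seq_over_points] by metis
    have "size T \<le> 3" using size_mset_mono[OF T(1)] by simp
    moreover have "1 \<le> size T" using T(2) by (simp add: Suc_le_eq nonempty_has_size[symmetric])
    ultimately have "short_zero_sum C34 T" using T(3) by (simp add: short_zero_sum_def group_exp_C34)
    moreover have "?M \<subseteq># mset cap_points"
      by (metis append_take_drop_id mset_append mset_subset_eq_add_left)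
    then have "?M \<subseteq># mset cap_points + mset cap_points"
      by (meson mset_subset_eq_add_left subset_mset.order_trans)
    ultimately show False using points_no_short_zero_sum T(1) by blast
  qed
  have large: "\<exists>T. T \<subseteq># S \<and> short_zero_sum C34 T"
    if S: "seq_over C34 S" "zero_sum C34 S" "37 \<le> size S" for S
  proof (rule ccontr)
    assume no: "\<not> ?thesis"
    have "\<Sum>\<^sub># (image_mset embed3 S) \<noteq> 0"
      using short_free_embed3[OF S(1) no] S(3) by (intro short_free_large_sum) simp_all
    then show False using S(2) zero_sum_iff_embed3[OF S(1)] by simp
  qed
  show ?thesis
  proof (rule Set.set_eqI)
    fix u :: int
    show "u \<in> C0 C34 \<longleftrightarrow> u \<in> {37, 38}"
    proof
      assume u: "u \<in> C0 C34"
      then have b: "int (davenport C34) + 1 \<le> u" "u \<le> 38" unfolding C0_def eta_C34 by simp_all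
      obtain t where t: "u = int t" using b(1) nonneg_int_cases[of u] by auto
      have "\<not> t \<le> 36"
      proof
        assume "t \<le> 36"
        moreover have "4 \<le> t" using b(1) t D4 by simp
        ultimately obtain S where S: "seq_over C34 S" "zero_sum C34 S" "size S = t"
          "\<forall>T. T \<subseteq># S \<longrightarrow> \<not> short_zero_sum C34 T" using C34_example by blast
        then show False using u t unfolding C0_def by blast
      qed
      then show "u \<in> {37, 38}" using b(2) t by auto
    next
      assume "u \<in> {37, 38}"
      then have "37 \<le> u" "u \<le> 38" by auto
      then show "u \<in> C0 C34" unfolding C0_def eta_C34 using D9 large by auto
    qed
  qed
qed

theorem theorem1p4:
  shows "(\<forall>G :: 'a monoid.
            comm_group G \<and> finite (carrier G) \<and> \<not> cyclic_group G \<longrightarrow>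
            (\<exists>n1 n2. 1 < n1 \<and> 0 < n2 \<and> n1 dvd n2 \<and>
               G \<cong> integer_mod_group n1 \<times>\<times> integer_mod_group n2) \<longrightarrow>
            C0 G = {int (davenport G) + 1..int (eta G) - 1}) \<and>
         (\<forall>(G :: 'a monoid) (H :: 'b monoid) (p :: nat) (n :: nat) (m :: nat).
            comm_group G \<and> finite (carrier G) \<and> \<not> cyclic_group G \<longrightarrow>
            prime p \<and> 0 < n \<and> 0 < m \<and> comm_group H \<and> finite_p_group p H \<and>
              davenport H \<le> p ^ n \<and> G \<cong> integer_mod_group (p ^ n * m) \<times>\<times> H \<longrightarrow>
            C0 G = {int (davenport G) + 1..int (eta G) - 1}) \<and>
         (C0 (cyclic_power 3 4) =
            {int (eta (cyclic_power 3 4)) - 2, int (eta (cyclic_power 3 4)) - 1} \<and>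
          {int (eta (cyclic_power 3 4)) - 2, int (eta (cyclic_power 3 4)) - 1} = {37, 38}) \<and>
         (\<forall>r\<ge>3. C0 (cyclic_power 2 r) =
            {int (eta (cyclic_power 2 r)) - 3, int (eta (cyclic_power 2 r)) - 2})"
proof (intro conjI allI impI)
  fix G :: "'a monoid"
  assume G: "comm_group G \<and> finite (carrier G) \<and> \<not> cyclic_group G"
    and iso: "\<exists>n1 n2. 1 < n1 \<and> 0 < n2 \<and> n1 dvd n2 \<and>
      G \<cong> integer_mod_group n1 \<times>\<times> integer_mod_group n2"
  from iso obtain n1 n2 where "1 < n1" "0 < n2" "n1 dvd n2"
    "G \<cong> integer_mod_group n1 \<times>\<times> integer_mod_group n2" by blast
  then show "C0 G = {int (davenport G) + 1..int (eta G) - 1}"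
    using G by (intro C0_rank_two[of G n1 n2]) auto
next
  fix G :: "'a monoid" and H :: "'b monoid" and p n m :: nat
  assume "comm_group G \<and> finite (carrier G) \<and> \<not> cyclic_group G"
    and "prime p \<and> 0 < n \<and> 0 < m \<and> comm_group H \<and> finite_p_group p H \<and>
      davenport H \<le> p ^ n \<and> G \<cong> integer_mod_group (p ^ n * m) \<times>\<times> H"
  then show "C0 G = {int (davenport G) + 1..int (eta G) - 1}"
    by (intro C0_p_group_extension[of G p m H n]) auto
next
  show "C0 C34 = {int (eta C34) - 2, int (eta C34) - 1}"
    unfolding C0_C34 eta_C34 by simp
  show "{int (eta C34) - 2, int (eta C34) - 1} = {37, 38}"
    unfolding eta_C34 by simp
next
  fix r :: nat
  assume "3 \<le> r"
  then show "C0 (cyclic_power 2 r) = {int (eta (cyclic_power 2 r)) - 3, int (eta (cyclic_power 2 r)) - 2}"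
    by (rule C0_cyclic_power_2)
qed

end
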